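(* Let $m>10^{11}$ be a coarse integer and $\chi$ a primitive Dirichlet character modulo $m$. For $M,N\in\mathbb{Z}$ with $N>0$ put $S(N,M)=\sum_{M<n\le M+N}\chi(n)$. Then for all such $M,N$, $$|S(N,M)|<10\,N^{1/2}m^{3/16}(\log m)^{1/2}.$$
   Context: A positive integer $m$ is called coarse if $m$ is either prime or a product of two distinct primes each exceeding $m^{3/8}\log m$. $\log$ is the natural logarithm. *)

theory Defs
  imports "HOL-Analysis.Analysis" "HOL-Number_Theory.Number_Theory"
begin

definition coarse :: "nat \<Rightarrow> bool" where
  "coarse m \<longleftrightarrow> m > 0 \<and>
     (prime m \<or>
      (\<exists>p q. prime p \<and> prime q \<and> p \<noteq> q \<and> m = p * q \<and>
             real p > real m powr (3/8) * ln (real m) \<and>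
             real q > real m powr (3/8) * ln (real m)))"

text \<open>
  Dirichlet characters modulo \<open>m\<close> are taken as functions on all of the integers,
  extended by zero off the residue classes coprime to \<open>m\<close>.
\<close>

definition dirichlet_character :: "nat \<Rightarrow> (int \<Rightarrow> complex) \<Rightarrow> bool" where
  "dirichlet_character m chi \<longleftrightarrow> m > 0 \<and>
     (\<forall>a b. chi (a * b) = chi a * chi b) \<and>
     (\<forall>a b. [a = b] (mod int m) \<longrightarrow> chi a = chi b) \<and>
     (\<forall>a. chi a \<noteq> 0 \<longleftrightarrow> coprime a (int m))"

definition induced_by :: "nat \<Rightarrow> (int \<Rightarrow> complex) \<Rightarrow> (int \<Rightarrow> complex) \<Rightarrow> bool" where
  "induced_by m chi psi \<longleftrightarrow> (\<forall>a. coprime a (int m) \<longrightarrow> chi a = psi a)"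

definition primitive_character :: "nat \<Rightarrow> (int \<Rightarrow> complex) \<Rightarrow> bool" where
  "primitive_character m chi \<longleftrightarrow> dirichlet_character m chi \<and>
     \<not> (\<exists>d psi. d dvd m \<and> d < m \<and> dirichlet_character d psi \<and> induced_by m chi psi)"

definition char_sum :: "(int \<Rightarrow> complex) \<Rightarrow> int \<Rightarrow> int \<Rightarrow> complex" where
  "char_sum chi N M = (\<Sum>n\<in>{M<..M+N}. chi n)"

end

(*
  Burgess's method with fourth moments. For N beyond m^(5/8) log m the Polya-Vinogradov inequality
  suffices, and for N below 100 m^(3/8) log m the bound is trivial. In between, replace n by n + a b with
  a <= A = N / (25 H) and b <= H = m^(1/4); by induction on N the shift costs only a fraction of the
  claimed bound. Since chi(n + a b) = chi(a) chi(n/a + b), Hoelder's inequality reduces the shifted sum to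
  counting the coincidences n/a = n'/a' modulo m and to the fourth moment of the sums of chi over
  intervals of length H.

  The fourth moment needs the Weil bound for the sums of chi(x+a) chi(x+b) cnj(chi(x+c) chi(x+d)) modulo a
  prime, which is proved here by Stepanov's method. Inverting at one of the four points leaves three
  points and a polynomial whose degree is coprime to p - 1. The L-function of the sum is then a quadratic
  polynomial, and Stepanov's bound over all extensions of the prime field puts its roots in place.
*)
theory Submission
  imports Defs "HOL-Algebra.Algebraic_Closure_Type" "Berlekamp_Zassenhaus.Finite_Field"
begin

hide_const (open) Divisibility.prime Divisibility.irreducible Polynomials.degree Polynomials.lead_coeff
  Coset.order up_ring.coeff up_ring.monom module.smult

section \<open>Finite fields inside an algebraically closed field\<close>

text \<open>The four-point sum has exponents \<open>1, 1, p - 2, p - 2\<close>, and their total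
  \<open>2 * (p - 1)\<close> is as far from coprime to \<open>p - 1\<close> as possible. Stepanov's
  argument in the present form needs coprimality, since that makes the degrees of the auxiliary
  terms distinct. Sending a point of exponent 1 to infinity leaves the total
  \<open>2 * (p - 1) - 1\<close>, and it leaves only two inverse roots, whose size can be read off
  from their power sums by elementary algebra. Coarseness acts through the prime factors: each is at
  least \<open>m^(3/8) * log m\<close>, so it exceeds every \<open>a\<close> in use and is at least
  \<open>H\<close>. Hence every \<open>a\<close> is invertible modulo \<open>m\<close>, and distinct
  shifts \<open>b\<close> stay distinct modulo each prime, which gives square root cancellation at
  all primes of \<open>m\<close> at once. The constant 10 splits as 6 + 4. Shifts have length at
  most \<open>N / 25\<close>, so by induction each of the two boundary sums costs
  \<open>10 / sqrt 25 = 2\<close> units; the averaged sum has 6 units left.\<close>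

definition Fq :: "nat \<Rightarrow> 'a::{alg_closed_field,field_prime_char} set" where
  "Fq n = {x. x ^ (CHAR('a) ^ n) = x}"

lemma size_proots_alg_closed:
  fixes f :: "'a::alg_closed_field poly"
  assumes "f \<noteq> 0"
  shows "size (proots f) = degree f"
proof -
  obtain A where A: "size A = degree f" "f = smult (lead_coeff f) (\<Prod>x\<in>#A. [:-x, 1:])"
    using alg_closed_imp_factorization[OF assms] by blast
  have "proots f = proots (\<Prod>x\<in>#A. [:-x, 1:])"
    by (subst A(2)) (simp add: assms)
  also have "\<dots> = A"
  proof (induction A)
    case (add x A)
    have "(\<Prod>x\<in>#A. [:-x, 1:]) \<noteq> 0" by auto
    thus ?case using add by (simp add: proots_mult del: mult_pCons_left)
  qed auto
  finally show ?thesis using A(1) by simp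
qed

lemma poly_pderiv_eq_0_of_order:
  fixes f :: "'a::field poly"
  assumes "f \<noteq> 0" "order x f \<ge> 2"
  shows "poly (pderiv f) x = 0"
proof -
  have "[:-x, 1:] ^ 2 dvd f" using assms by (simp add: order_divides)
  then obtain g where "f = [:-x, 1:] ^ 2 * g" by (elim dvdE)
  hence "f = [:-x, 1:] * ([:-x, 1:] * g)" by (simp only: power2_eq_square mult.assoc)
  thus ?thesis by (simp only: pderiv_mult poly_add poly_mult) simp
qed

lemma prime_CHAR: "prime CHAR('a::field_prime_char)"
  by simp

lemma one_less_CHAR_power: "n > 0 \<Longrightarrow> 1 < CHAR('a::field_prime_char) ^ n"
  using prime_gt_1_nat[OF prime_CHAR[where 'a='a]] by (rule one_less_power)

lemma Fq_roots: "Fq n = {x::'a. poly (monom 1 (CHAR('a::{alg_closed_field,field_prime_char}) ^ n) - [:0,1:]) x = 0}"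
  by (auto simp: Fq_def poly_monom)

lemma degree_frobenius_poly:
  assumes "n > 0"
  shows "degree (monom 1 (CHAR('a::field_prime_char) ^ n) - [:0,1::'a:]) = CHAR('a) ^ n"
proof -
  have "degree ([:0,1::'a:]) < degree (monom (1::'a) (CHAR('a) ^ n))"
    using one_less_CHAR_power[OF assms, where 'a='a] by (simp add: degree_monom_eq)
  hence "degree (monom 1 (CHAR('a) ^ n) + - [:0,1::'a:]) = degree (monom (1::'a) (CHAR('a) ^ n))"
    by (intro degree_add_eq_left) simp
  thus ?thesis unfolding add_uminus_conv_diff by (simp add: degree_monom_eq)
qed

lemma finite_Fq [simp]:
  assumes "n > 0"
  shows "finite (Fq n :: 'a::{alg_closed_field,field_prime_char} set)"
proof -
  have "monom 1 (CHAR('a) ^ n) - [:0,1::'a:] \<noteq> 0"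
    using degree_frobenius_poly[OF assms, where 'a='a] one_less_CHAR_power[OF assms, where 'a='a] by (metis degree_0 not_one_less_zero)
  from poly_roots_finite[OF this] show ?thesis unfolding Fq_roots .
qed

text \<open>The polynomial \<open>X^q - X\<close> has derivative \<open>-1\<close> in characteristic
  \<open>p\<close>, so its roots are simple, and over an algebraically closed field there are as
  many of them as its degree.\<close>

lemma card_Fq:
  assumes n: "n > 0"
  shows "card (Fq n :: 'a::{alg_closed_field,field_prime_char} set) = CHAR('a) ^ n"
proof -
  let ?f = "monom 1 (CHAR('a) ^ n) - [:0,1::'a:]"
  have f0: "?f \<noteq> 0"
    using degree_frobenius_poly[OF assms, where 'a='a] one_less_CHAR_power[OF assms, where 'a='a] by (metis degree_0 not_one_less_zero)
  have "of_nat (CHAR('a) ^ n) = (0::'a)" using n by simp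
  hence d: "pderiv ?f = - 1"
    using n by (simp add: pderiv_diff pderiv_monom pderiv_pCons one_pCons zero_power)
  have ord: "order x ?f = 1" if "poly ?f x = 0" for x
  proof -
    have "order x ?f \<noteq> 0" using f0 that by (simp add: order_eq_0_iff)
    moreover have "\<not> order x ?f \<ge> 2"
      using poly_pderiv_eq_0_of_order[OF f0, of x] by (auto simp: d)
    ultimately show ?thesis by linarith
  qed
  have "CHAR('a) ^ n = size (proots ?f)"
    using size_proots_alg_closed[OF f0] degree_frobenius_poly[OF assms, where 'a='a] by simp
  also have "\<dots> = (\<Sum>x\<in>{x. poly ?f x = 0}. order x ?f)"
    using f0 by (simp add: size_multiset_overloaded_eq)
  also have "\<dots> = card {x. poly ?f x = 0}"
    using ord by simp
  finally show ?thesis by (simp add: Fq_roots)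
qed

text \<open>Gaussian elimination on the coefficient of degree \<open>M\<close>: multiples of a pivot
  are subtracted from the other polynomials, and the induction applies to those. This supplies the
  nontrivial solution in Stepanov's method.\<close>

lemma linear_dependent_polys:
  fixes P :: "'i \<Rightarrow> 'a::field poly"
  assumes "finite I" "card I > M" "\<And>i k. i \<in> I \<Longrightarrow> k \<ge> M \<Longrightarrow> coeff (P i) k = 0"
  shows "\<exists>c. (\<exists>i\<in>I. c i \<noteq> 0) \<and> (\<Sum>i\<in>I. smult (c i) (P i)) = 0"
  using assms
proof (induction M arbitrary: I P)
  case 0
  then obtain i where "i \<in> I" by (metis card_gt_0_iff ex_in_conv)
  moreover have "P i = 0" if "i \<in> I" for i
    using 0(3)[OF that] by (simp add: poly_eq_iff)
  ultimately show ?case by (intro exI[of _ "\<lambda>_. 1"]) auto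
next
  case (Suc M)
  show ?case
  proof (cases "\<forall>i\<in>I. coeff (P i) M = 0")
    case True
    have "coeff (P i) k = 0" if "i \<in> I" "k \<ge> M" for i k
      using that True Suc.prems(3)[of i k] by (cases "k = M") auto
    with Suc.IH[of I P] Suc.prems show ?thesis by auto
  next
    case False
    then obtain j where j: "j \<in> I" "coeff (P j) M \<noteq> 0" by blast
    define r where "r i = coeff (P i) M / coeff (P j) M" for i
    define P' where "P' i = P i - smult (r i) (P j)" for i
    have "coeff (P' i) k = 0" if "i \<in> I - {j}" "k \<ge> M" for i k
      using that j Suc.prems(3)[of i k] Suc.prems(3)[of j k] by (cases "k = M") (auto simp: P'_def r_def)
    moreover have "card (I - {j}) > M" using Suc.prems j by simp
    ultimately obtain c i0 where c: "i0 \<in> I - {j}" "c i0 \<noteq> 0" "(\<Sum>i\<in>I-{j}. smult (c i) (P' i)) = 0"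
      using Suc.IH[of "I - {j}" P'] Suc.prems(1) by auto
    define c' where "c' = c(j := - (\<Sum>i\<in>I-{j}. c i * r i))"
    have "(\<Sum>i\<in>I. smult (c' i) (P i)) = smult (c' j) (P j) + (\<Sum>i\<in>I-{j}. smult (c' i) (P i))"
      using Suc.prems(1) j by (simp add: sum.remove)
    also have "(\<Sum>i\<in>I-{j}. smult (c' i) (P i)) = (\<Sum>i\<in>I-{j}. smult (c i) (P i))"
      by (intro sum.cong) (auto simp: c'_def)
    also have "smult (c' j) (P j) = - (\<Sum>i\<in>I-{j}. smult (c i) (smult (r i) (P j)))"
      by (simp add: c'_def smult_sum)
    also have "\<dots> + (\<Sum>i\<in>I-{j}. smult (c i) (P i)) = (\<Sum>i\<in>I-{j}. smult (c i) (P' i))"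
      by (simp add: P'_def smult_diff_right sum_subtractf)
    finally have "(\<Sum>i\<in>I. smult (c' i) (P i)) = 0" using c(3) by simp
    moreover have "c' i0 \<noteq> 0" using c by (auto simp: c'_def)
    ultimately show ?thesis using c(1) by blast
  qed
qed

text \<open>Among the terms with nonzero scalar exactly one has the largest degree, and its leading
  coefficient cannot cancel.\<close>

lemma sum_smult_distinct_degrees_nonzero:
  fixes P :: "'i \<Rightarrow> 'a::field poly"
  assumes "finite I" "inj_on (\<lambda>i. degree (P i)) I" "\<And>i. i \<in> I \<Longrightarrow> P i \<noteq> 0" "i0 \<in> I" "c i0 \<noteq> 0"
  shows "(\<Sum>i\<in>I. smult (c i) (P i)) \<noteq> 0"
proof -
  define J where "J = {i\<in>I. c i \<noteq> 0}"
  have J: "finite J" "J \<noteq> {}" using assms by (auto simp: J_def)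
  define m where "m = Max ((\<lambda>i. degree (P i)) ` J)"
  have "m \<in> (\<lambda>i. degree (P i)) ` J" unfolding m_def using J by (intro Max_in) auto
  then obtain j where j: "j \<in> J" "degree (P j) = m" by auto
  have "coeff (\<Sum>i\<in>I. smult (c i) (P i)) m = (\<Sum>i\<in>I. c i * coeff (P i) m)"
    by (simp add: coeff_sum)
  also have "\<dots> = (\<Sum>i\<in>{j}. c i * coeff (P i) m)"
  proof (rule sum.mono_neutral_right)
    show "\<forall>i\<in>I - {j}. c i * coeff (P i) m = 0"
    proof
      fix i assume i: "i \<in> I - {j}"
      show "c i * coeff (P i) m = 0"
      proof (cases "c i = 0")
        case False
        hence "i \<in> J" using i by (auto simp: J_def)
        hence "degree (P i) \<le> m" using J by (auto simp: m_def)
        moreover have "degree (P i) \<noteq> m"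
          using i j assms(2) by (auto simp: J_def inj_on_def)
        ultimately show ?thesis by (simp add: coeff_eq_0)
      qed auto
    qed
  qed (use assms j in \<open>auto simp: J_def\<close>)
  also have "\<dots> \<noteq> 0" using j assms(3)[of j] by (auto simp: J_def)
  finally show ?thesis by auto
qed

section \<open>Stepanov's method\<close>

text \<open>
  With \<open>q = B\<^sup>2\<close>, the auxiliary polynomial is
  \<open>T = (\<Sum>i<d. \<Sum>j<J. \<Sum>k<\<rho>. c i j k * x ^ (k + j * B) * f ^ (i * b))\<close>. Wherever \<open>x ^ q = x\<close> and
  \<open>f x ^ ((q - 1) / d) = a\<close>, the product \<open>T x ^ B * f x ^ B\<close> takes the value of the polynomial
  \<open>(\<Sum>i<d. \<Sum>j<J. \<Sum>k<\<rho>. c i j k ^ B * a ^ i * x ^ (k * B + j) * f ^ (B - i * b))\<close>, whose degree is so small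
  that it can be made to vanish identically by linear algebra in the unknowns \<open>c i j k ^ B\<close>.
  Taking the \<open>B\<close>-th power replaces the (Hasse) derivatives of the usual argument. The terms of \<open>T\<close>
  have distinct degrees because \<open>degree f\<close> is coprime to \<open>d\<close>, hence \<open>T \<noteq> 0\<close>.
\<close>

lemma stepanov_bound:
  fixes f :: "'a::{alg_closed_field,field_prime_char} poly"
  assumes B: "B = CHAR('a) ^ \<mu>" "B = d * b + 1" and d: "d > 0"
    and cop: "coprime (degree f) d"
    and b: "b > (degree f + 2) * (d * degree f + 1)" and a: "a \<noteq> 0"
  shows "card {x. x ^ (B\<^sup>2) = x \<and> poly f x ^ (b * (B + 1)) = a} \<le> (b + 2 * degree f + 2) * B"
proof -
  define D where "D = degree f"
  \<comment> \<open>The factor \<open>f ^ (B - i * b)\<close> has degree at most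
    \<open>B * D\<close>; cutting \<open>k\<close> at \<open>b - D\<close> compensates for it and
    keeps all degrees below \<open>M\<close>. \<open>J\<close> is chosen so that the
    \<open>d * J * \<rho>\<close> unknowns outnumber the \<open>M\<close> equations.\<close>
  define \<rho> where "\<rho> = b - D"
  define J where "J = b + D + 2"
  have b': "b > D" "b > 0"
    using b unfolding D_def by (auto intro: le_less_trans[rotated] simp: algebra_simps)
  have b\<rho>: "b = \<rho> + D" "\<rho> > 0" using b' by (auto simp: \<rho>_def)
  have Bpos: "B > 0" using B by simp
  define I where "I = {..<d} \<times> {..<J} \<times> {..<\<rho>}"
  define P where "P = (\<lambda>(i,j,k). smult (a ^ i) (monom 1 (k * B + j) * f ^ (B - i * b)))"
  define R where "R = (\<lambda>(i,j,k). monom 1 (k + j * B) * f ^ (i * b))"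
  define M where "M = (b - 1) * B + J"
  have fin: "finite I" by (simp add: I_def)
  have ib: "i * b \<le> d * b" if "i < d" for i using that by (intro mult_right_mono) auto
  have coeffP: "coeff (P t) n = 0" if t: "t \<in> I" and n: "n \<ge> M" for t n
  proof -
    obtain i j k where ijk: "t = (i,j,k)" "i < d" "j < J" "k < \<rho>" using t by (auto simp: I_def)
    have "degree (P t) \<le> degree (monom (1::'a) (k * B + j)) + degree (f ^ (B - i * b))"
      unfolding P_def ijk prod.case by (intro order.trans[OF degree_smult_le] degree_mult_le)
    also have "\<dots> \<le> (k * B + j) + (B - i * b) * D"
      unfolding D_def by (intro add_mono degree_monom_le degree_power_le[THEN order.trans]) (simp_all add: mult.commute)
    also have "\<dots> \<le> ((\<rho> - 1) * B + j) + B * D"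
      using ijk by (intro add_mono mult_right_mono) auto
    also have "\<dots> = (b - 1) * B + j"
    proof -
      have "b - 1 = (\<rho> - 1) + D" using b\<rho> by simp
      thus ?thesis by (simp add: algebra_simps)
    qed
    also have "\<dots> < M" using ijk by (simp add: M_def)
    finally show ?thesis using n by (intro coeff_eq_0) simp
  qed
  have card: "card I > M"
  proof -
    have "int (card I) = int d * (int b + int D + 2) * (int b - int D)"
      using b\<rho> by (simp add: I_def J_def card_cartesian_product algebra_simps)
    moreover have "int (b - 1) = int b - 1" using b' by simp
    hence "int M = (int b - 1) * (int d * int b + 1) + int b + int D + 2"
      by (simp only: M_def J_def B(2) of_nat_add of_nat_mult of_nat_1 of_nat_numeral)
    \<comment> \<open>Expanding gives
      \<open>card I - M = (3 * d - 2) * b - (D + 2) * (d * D + 1) + 1\<close>, which the lower bound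
      on \<open>b\<close> makes positive.\<close>
    moreover have "int b > (int D + 2) * (int d * int D + 1)"
      using b unfolding D_def by (metis (mono_tags) of_nat_1 of_nat_add of_nat_less_iff of_nat_mult of_nat_numeral)
    moreover have "int b * (3 * int d - 2) \<ge> int b * 1"
      using d by (intro mult_left_mono) auto
    ultimately have "int (card I) > int M" by (simp add: algebra_simps power2_eq_square)
    thus ?thesis by simp
  qed
  obtain C t0 where C: "t0 \<in> I" "C t0 \<noteq> 0" "(\<Sum>t\<in>I. smult (C t) (P t)) = 0"
    using linear_dependent_polys[where P = P, OF fin card coeffP] by blast
  \<comment> \<open>The relation is linear in the \<open>B\<close>-th powers of the wanted
    coefficients; algebraic closedness supplies the roots.\<close>
  have "\<forall>t. \<exists>y. y ^ B = C t" using nth_root_exists[OF Bpos] by blast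
  then obtain c where c: "\<And>t. c t ^ B = C t" by metis
  define T where "T = (\<Sum>t\<in>I. smult (c t) (R t))"
  show ?thesis
  proof (cases "f = 0")
    case True
    hence "{x. x ^ (B\<^sup>2) = x \<and> poly f x ^ (b * (B + 1)) = a} = {}" using a b' by (auto simp: power_0_left)
    thus ?thesis by (simp only: card.empty le0)
  next
    case f0: False
    have degR: "degree (R (i,j,k)) = k + j * B + i * b * D" for i j k
      unfolding R_def D_def using f0 by (simp add: degree_mult_eq degree_monom_eq degree_power_eq)
    have T0: "T \<noteq> 0" unfolding T_def
    proof (rule sum_smult_distinct_degrees_nonzero[OF fin _ _ C(1)])
      show "R t \<noteq> 0" for t using f0 by (auto simp: R_def split: prod.splits)
      show "c t0 \<noteq> 0" using C(2) c[of t0] Bpos by (auto simp: power_0_left)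
      show "inj_on (\<lambda>t. degree (R t)) I"
      proof (rule inj_onI)
        fix t t' assume t: "t \<in> I" "t' \<in> I" and eq: "degree (R t) = degree (R t')"
        obtain i j k where ijk: "t = (i,j,k)" "i < d" "j < J" "k < \<rho>" using t by (auto simp: I_def)
        obtain i' j' k' where ijk': "t' = (i',j',k')" "i' < d" "j' < J" "k' < \<rho>" using t by (auto simp: I_def)
        define x y z where "x = int i - int i'" and "y = int j - int j'" and "z = int k - int k'"
        have "k + j * B + i * b * D = k' + j' * B + i' * b * D"
          using eq by (simp add: ijk ijk' degR)
        hence "int k + int j * int B + int i * int b * int D = int k' + int j' * int B + int i' * int b * int D"
          by (metis of_nat_add of_nat_mult)
        hence "z + y * int B + x * int b * int D = 0" by (simp add: x_def y_def z_def algebra_simps)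
        \<comment> \<open>Since \<open>d * b = B - 1\<close>, multiplying by \<open>d\<close> leaves
          \<open>d * z - D * x\<close> modulo \<open>B\<close>. This number is smaller than
          \<open>B\<close> in absolute value, hence zero. Then \<open>d\<close> divides
          \<open>D * x\<close>, by coprimality it divides \<open>x\<close>, and the range of
          \<open>x\<close> forces \<open>x = 0\<close>.\<close>
        hence "int d * (z + y * int B + x * int b * int D) = 0" by simp
        hence "int d * z + int d * y * int B + x * (int d * int b) * int D = 0" by (simp add: algebra_simps)
        moreover have db: "int d * int b = int B - 1" using B(2) by simp
        ultimately have "int d * z + int d * y * int B + x * (int B - 1) * int D = 0" by (simp only: db)
        hence e: "int d * z - int D * x = - (int B) * (int d * y + int D * x)"
          by (simp add: algebra_simps)
        have "\<bar>x\<bar> \<le> int d - 1" "\<bar>z\<bar> \<le> int \<rho> - 1" using ijk ijk' by (auto simp: x_def z_def)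
        hence "int D * \<bar>x\<bar> \<le> int D * (int d - 1)" "int d * \<bar>z\<bar> \<le> int d * (int \<rho> - 1)"
          by (intro mult_left_mono; simp)+
        moreover have "\<bar>int d * z - int D * x\<bar> \<le> int d * \<bar>z\<bar> + int D * \<bar>x\<bar>"
          by (rule order.trans[OF abs_triangle_ineq4]) (simp add: abs_mult)
        moreover have "int d * (int \<rho> - 1) + int D * (int d - 1) < int B"
          using B(2) b\<rho> d by (simp add: algebra_simps)
        ultimately have "\<bar>int d * z - int D * x\<bar> < int B" by linarith
        moreover have "int B dvd int d * z - int D * x" using e by simp
        ultimately have z0: "int d * z - int D * x = 0"
          using dvd_imp_le_int[of "int d * z - int D * x" "int B"] by fastforce
        hence "int d dvd int D * x" by (metis dvd_triv_left eq_iff_diff_eq_0)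
        moreover have "coprime (int d) (int D)" using cop by (simp add: D_def coprime_commute)
        ultimately have "int d dvd x" by (simp add: coprime_dvd_mult_right_iff)
        hence x0: "x = 0" using \<open>\<bar>x\<bar> \<le> int d - 1\<close> dvd_imp_le_int[of x "int d"] by fastforce
        hence "z = 0" using z0 d by simp
        moreover have "y = 0" using e x0 z0 Bpos d by simp
        ultimately show "t = t'" using x0 by (simp add: ijk ijk' x_def y_def z_def)
      qed
    qed
    have "poly T x = 0" if x: "x ^ (B\<^sup>2) = x" "poly f x ^ (b * (B + 1)) = a" for x
    proof -
      have fx: "poly f x \<noteq> 0" using x a b' by (auto simp: power_0_left)
      have "poly T x ^ B * poly f x ^ B = (\<Sum>t\<in>I. (c t * poly (R t) x) ^ B) * poly f x ^ B"
        unfolding T_def B(1) by (simp add: poly_sum freshmans_dream_sum'[OF _ refl])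
      also have "\<dots> = (\<Sum>t\<in>I. C t * poly (P t) x)"
        unfolding sum_distrib_right
      proof (rule sum.cong[OF refl])
        fix t assume "t \<in> I"
        then obtain i j k where ijk: "t = (i,j,k)" "i < d" by (auto simp: I_def)
        \<comment> \<open>Here \<open>b * (B + 1) = (q - 1) / d\<close> is the exponent at which
          \<open>f\<close> takes the value \<open>a\<close>. The additional factor
          \<open>poly f x ^ B\<close> keeps the remaining exponent \<open>B - i * b\<close>
          nonnegative.\<close>
        have "i * b \<le> B" using ib[OF ijk(2)] B(2) by linarith
        hence e: "i * b * B + B = b * (B + 1) * i + (B - i * b)"
          by (simp add: algebra_simps)
        have "poly (R t) x ^ B * poly f x ^ B = x ^ (k * B) * (x ^ (B\<^sup>2)) ^ j * poly f x ^ (i * b * B + B)"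
          by (simp add: ijk R_def poly_monom power_mult_distrib power_add algebra_simps flip: power_mult)
             (simp add: power2_eq_square algebra_simps)
        also have "\<dots> = x ^ (k * B) * x ^ j * (a ^ i * poly f x ^ (B - i * b))"
          unfolding e x(1) power_add power_mult[of _ _ i] x(2) ..
        also have "\<dots> = poly (P t) x"
          by (simp add: ijk P_def poly_monom power_add algebra_simps)
        finally show "(c t * poly (R t) x) ^ B * poly f x ^ B = C t * poly (P t) x"
          by (simp add: power_mult_distrib c mult.assoc)
      qed
      also have "\<dots> = poly (\<Sum>t\<in>I. smult (C t) (P t)) x" by (simp add: poly_sum)
      finally show ?thesis using C(3) fx Bpos by simp
    qed
    hence "card {x. x ^ (B\<^sup>2) = x \<and> poly f x ^ (b * (B + 1)) = a} \<le> card {x. poly T x = 0}"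
      by (intro card_mono poly_roots_finite T0) auto
    also have "\<dots> \<le> degree T" by (rule card_poly_roots_bound[OF T0])
    also have "\<dots> \<le> (b + 2 * D + 2) * B"
      unfolding T_def
    proof (rule degree_sum_le[OF fin])
      fix t assume "t \<in> I"
      then obtain i j k where ijk: "t = (i,j,k)" "i < d" "j < J" "k < \<rho>" by (auto simp: I_def)
      have "degree (smult (c t) (R t)) \<le> k + j * B + i * b * D"
        using degree_smult_le[of "c t" "R t"] degR[of i j k] ijk by simp
      also have "\<dots> \<le> B + (b + D + 1) * B + B * D"
      proof (intro add_mono mult_right_mono)
        have "b \<le> d * b" using d by simp
        thus "k \<le> B" using ijk B(2) b\<rho> by linarith
        show "j \<le> b + D + 1" using ijk by (simp add: J_def)
        show "i * b \<le> B" using ib[OF ijk(2)] B(2) by linarith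
      qed auto
      also have "\<dots> = (b + 2 * D + 2) * B" by (simp add: algebra_simps)
      finally show "degree (smult (c t) (R t)) \<le> (b + 2 * D + 2) * B" .
    qed
    finally show ?thesis by (simp add: D_def)
  qed
qed

text \<open>The exponent \<open>b * (B + 1)\<close> is that of the norm down to the prime field.
  Stepanov's method bounds each fibre \<open>S a\<close> of this norm only from above, by
  \<open>\<kappa>\<close>. But the fibres and the zeros of \<open>f\<close> exhaust the field, and
  \<open>(p - 1) * \<kappa>\<close> exceeds \<open>B^2\<close> by at most a constant times
  \<open>B\<close>. So the deficits \<open>\<kappa> - card (S a)\<close> are nonnegative with a
  small total, and since \<open>chi\<close> sums to zero they may replace the fibre sizes.\<close>

lemma norm_char_sum_Fq:
  fixes f :: "'a::{alg_closed_field,field_prime_char} poly" and chi :: "'a \<Rightarrow> complex"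
  assumes B: "B = CHAR('a) ^ \<mu>" "B = (CHAR('a) - 1) * b + 1" and \<mu>: "\<mu> > 0"
    and cop: "coprime (degree f) (CHAR('a) - 1)" and f0: "f \<noteq> 0"
    and b: "b > (degree f + 2) * ((CHAR('a) - 1) * degree f + 1)"
    and f: "\<And>x. x \<in> Fq (2 * \<mu>) \<Longrightarrow> poly f x \<in> Fq (2 * \<mu>)"
    and chi: "chi 0 = 0" "\<And>x. cmod (chi x) \<le> 1" "(\<Sum>a\<in>Fq 1. chi a) = 0"
  shows "cmod (\<Sum>x\<in>Fq (2 * \<mu>). chi (poly f x ^ (b * (B + 1)))) \<le>
    real ((CHAR('a) - 1) * (2 * degree f + 2) * B + degree f)"
proof -
  define d D where "d = CHAR('a) - 1" and "D = degree f"
  define \<kappa> where "\<kappa> = (b + 2 * D + 2) * B"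
  have d: "d > 0" using prime_gt_1_nat[OF prime_CHAR[where 'a='a]] by (simp add: d_def)
  have q: "CHAR('a) ^ (2 * \<mu>) = B\<^sup>2" unfolding B(1) by (simp add: power_mult mult.commute flip: power_mult)
  define S where "S a = {x. x ^ (B\<^sup>2) = x \<and> poly f x ^ (b * (B + 1)) = a}" for a
  define A where "A = Fq 1 - {0::'a}"
  define Z where "Z = {x\<in>Fq (2 * \<mu>). poly f x = 0}"
  have Fq: "(Fq (2 * \<mu>) :: 'a set) = {x. x ^ (B\<^sup>2) = x}" by (simp add: Fq_def q)
  have fin: "finite (Fq (2 * \<mu>) :: 'a set)" "finite A" using \<mu> by (auto simp: A_def)
  have finS: "finite (S a)" for a using fin by (rule_tac finite_subset[of _ "Fq (2 * \<mu>)"]) (auto simp: S_def Fq)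
  have bpos: "b > 0" using b by simp
  have e: "b * (B + 1) * d = B\<^sup>2 - 1"
    using B(2) by (simp add: d_def power2_eq_square algebra_simps)
  have Fq1: "(Fq 1 :: 'a set) = insert 0 A" by (auto simp: A_def Fq_def)
  have A_iff: "y \<in> A \<longleftrightarrow> y ^ d = 1" for y :: 'a
  proof -
    have "y ^ CHAR('a) = y * y ^ d" unfolding d_def by (simp flip: power_Suc)
    thus ?thesis using d by (auto simp: A_def Fq_def power_0_left)
  qed
  have cardA: "card A = d"
    using card_Fq[OF zero_less_one, where 'a='a] fin(2) unfolding Fq1
    by (subst (asm) card_insert_disjoint) (auto simp: A_def d_def)
  have nonzero: "poly f x ^ (b * (B + 1)) \<in> A" if "x \<in> Fq (2 * \<mu>)" "poly f x \<noteq> 0" for x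
  proof -
    have "poly f x ^ (B\<^sup>2) = poly f x" using f[OF that(1)] by (simp add: Fq)
    moreover have "poly f x ^ (B\<^sup>2) = poly f x * poly f x ^ (B\<^sup>2 - 1)"
      using B(2) by (simp flip: power_Suc)
    ultimately have "poly f x ^ (B\<^sup>2 - 1) = 1" using that(2) by simp
    thus ?thesis unfolding A_iff by (simp only: e flip: power_mult)
  qed
  have union: "Fq (2 * \<mu>) - Z = (\<Union>a\<in>A. S a)"
  proof (intro equalityI subsetI)
    show "x \<in> (\<Union>a\<in>A. S a)" if "x \<in> Fq (2 * \<mu>) - Z" for x
      using nonzero[of x] that by (intro UN_I[of "poly f x ^ (b * (B + 1))"]) (auto simp: Z_def S_def Fq)
  qed (use bpos in \<open>auto simp: S_def Fq Z_def A_def power_0_left\<close>)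
  have disj: "\<forall>a\<in>A. \<forall>b\<in>A. a \<noteq> b \<longrightarrow> S a \<inter> S b = {}" by (auto simp: S_def)
  have cardS: "(\<Sum>a\<in>A. card (S a)) = card (Fq (2 * \<mu>) - Z)"
    unfolding union using fin finS disj by (subst card_UN_disjoint) auto
  have "card Z \<le> D"
    unfolding D_def by (rule order.trans[OF card_mono card_poly_roots_bound[OF f0]]) (auto simp: Z_def poly_roots_finite f0)
  moreover have "card (Fq (2 * \<mu>) - Z) = B\<^sup>2 - card Z"
    using fin \<mu> card_Fq[of "2 * \<mu>", where 'a='a] by (subst card_Diff_subset) (auto simp: Z_def q)
  ultimately have cardS: "B\<^sup>2 \<le> (\<Sum>a\<in>A. card (S a)) + D"
    using cardS by linarith
  have cardS': "(\<Sum>a\<in>A. real (card (S a))) \<ge> real (B\<^sup>2) - real D"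
    using of_nat_mono[OF cardS, where 'a=real] by simp
  have le: "card (S a) \<le> \<kappa>" if "a \<in> A" for a
    unfolding S_def \<kappa>_def D_def
    by (rule stepanov_bound[OF B d[unfolded d_def] cop b]) (use that in \<open>auto simp: A_def\<close>)
  have "(\<Sum>x\<in>Fq (2 * \<mu>). chi (poly f x ^ (b * (B + 1)))) = (\<Sum>x\<in>Fq (2 * \<mu>) - Z. chi (poly f x ^ (b * (B + 1))))"
    using fin bpos chi(1) by (intro sum.mono_neutral_right) (auto simp: Z_def power_0_left)
  also have "\<dots> = (\<Sum>a\<in>A. \<Sum>x\<in>S a. chi (poly f x ^ (b * (B + 1))))"
    unfolding union using fin finS disj by (intro sum.UNION_disjoint) auto
  also have "\<dots> = (\<Sum>a\<in>A. chi a * of_nat (card (S a)))"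
    by (intro sum.cong refl) (auto simp: S_def mult.commute)
  also have "\<dots> = (\<Sum>a\<in>A. chi a * of_nat (card (S a))) - of_nat \<kappa> * (\<Sum>a\<in>A. chi a)"
    using chi(1,3) fin unfolding Fq1 by (subst (asm) sum.insert) (auto simp: A_def)
  also have "\<dots> = (\<Sum>a\<in>A. chi a * of_real (real (card (S a)) - real \<kappa>))"
    by (simp add: sum_distrib_left sum_subtractf algebra_simps)
  finally have "cmod (\<Sum>x\<in>Fq (2 * \<mu>). chi (poly f x ^ (b * (B + 1)))) \<le>
      (\<Sum>a\<in>A. cmod (chi a * of_real (real (card (S a)) - real \<kappa>)))"
    by (simp add: norm_sum)
  also have "\<dots> \<le> (\<Sum>a\<in>A. real \<kappa> - real (card (S a)))"
  proof (rule sum_mono)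
    fix a assume "a \<in> A"
    hence "real (card (S a)) \<le> real \<kappa>" using le by simp
    thus "cmod (chi a * of_real (real (card (S a)) - real \<kappa>)) \<le> real \<kappa> - real (card (S a))"
      using mult_left_le_one_le[of "real \<kappa> - real (card (S a))" "cmod (chi a)"] chi(2)[of a]
      unfolding norm_mult norm_of_real by simp
  qed
  also have "\<dots> = real d * real \<kappa> - (\<Sum>a\<in>A. real (card (S a)))"
    by (simp add: sum_subtractf cardA)
  also have "\<dots> \<le> real d * real \<kappa> - (real (B\<^sup>2) - real D)" using cardS' by simp
  also have "\<dots> \<le> real (d * (2 * D + 2) * B + D)"
  proof -
    have "d * \<kappa> = (d * b) * B + d * (2 * D + 2) * B"
      by (simp add: \<kappa>_def algebra_simps)
    moreover have "(d * b) * B \<le> B\<^sup>2"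
      using B(2) unfolding power2_eq_square by (intro mult_right_mono) (auto simp: d_def)
    ultimately have "d * \<kappa> \<le> B\<^sup>2 + d * (2 * D + 2) * B" by simp
    hence "real d * real \<kappa> \<le> real (B\<^sup>2) + real (d * (2 * D + 2) * B)"
      by (metis of_nat_add of_nat_le_iff of_nat_mult)
    thus ?thesis by simp
  qed
  finally show ?thesis by (simp add: d_def D_def)
qed

section \<open>The L-function of a character\<close>

definition frob_map :: "'a::{alg_closed_field,field_prime_char} poly \<Rightarrow> 'a poly" where
  "frob_map = map_poly (\<lambda>c. c ^ CHAR('a))"

definition Fp_monic :: "nat \<Rightarrow> 'a::{alg_closed_field,field_prime_char} poly set" where
  "Fp_monic n = {g. degree g = n \<and> lead_coeff g = 1 \<and> frob_map g = g}"

text \<open>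
  Polynomials over the prime field are those fixed by \<^term>\<open>frob_map\<close>. For \<open>x \<in> Fq r\<close> the polynomial
  \<open>frob_poly r x\<close> is the characteristic polynomial of \<open>x\<close> over the prime field; its value at \<open>u\<close> is
  the norm of \<open>u - x\<close>.
\<close>

definition frob_poly :: "nat \<Rightarrow> 'a::{alg_closed_field,field_prime_char} \<Rightarrow> 'a poly" where
  "frob_poly r x = (\<Prod>j<r. [:- (x ^ CHAR('a) ^ j), 1:])"

section \<open>Polynomials over the prime field\<close>

lemma coeff_frob_map: "coeff (frob_map g) i = coeff g i ^ CHAR('a)"
  for g :: "'a::{alg_closed_field,field_prime_char} poly"
  unfolding frob_map_def by (rule coeff_map_poly) (simp add: power_0_left)

lemma frob_map_fixed_iff: "frob_map g = g \<longleftrightarrow> (\<forall>i. coeff g i \<in> Fq 1)"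
  by (simp add: poly_eq_iff coeff_frob_map Fq_def)

lemma frob_map_add: "frob_map (g + h) = frob_map g + frob_map h"
  by (simp add: poly_eq_iff coeff_frob_map freshmans_dream[OF prime_CHAR refl])

lemma frob_map_mult: "frob_map (g * h) = frob_map g * frob_map h"
  by (simp add: poly_eq_iff coeff_frob_map coeff_mult freshmans_dream_sum[OF prime_CHAR refl] power_mult_distrib)

lemma frob_map_1 [simp]: "frob_map 1 = 1"
  by (simp add: poly_eq_iff coeff_frob_map power_0_left)

lemma frob_map_smult: "frob_map (smult c g :: 'a::{alg_closed_field,field_prime_char} poly) = smult (c ^ CHAR('a)) (frob_map g)"
  by (simp add: poly_eq_iff coeff_frob_map power_mult_distrib)

lemma frob_map_prod: "frob_map (\<Prod>i\<in>A. g i) = (\<Prod>i\<in>A. frob_map (g i))"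
  by (induction A rule: infinite_finite_induct) (auto simp: frob_map_mult)

lemma frob_map_linear: "frob_map [:-a, 1:] = [:- (a ^ CHAR('a)), 1:]" for a :: "'a::{alg_closed_field,field_prime_char}"
  by (simp add: poly_eq_iff coeff_frob_map coeff_pCons power_0_left minus_power_prime_CHAR split: nat.splits)

lemma Fq1_iff: "x \<in> Fq 1 \<longleftrightarrow> x ^ CHAR('a) = x" for x :: "'a::{alg_closed_field,field_prime_char}"
  by (simp add: Fq_def)

lemma Fq1_closed:
  fixes x y :: "'a::{alg_closed_field,field_prime_char}"
  shows "0 \<in> (Fq 1 :: 'a set)" "1 \<in> (Fq 1 :: 'a set)"
    "x \<in> Fq 1 \<Longrightarrow> y \<in> Fq 1 \<Longrightarrow> x + y \<in> Fq 1" "x \<in> Fq 1 \<Longrightarrow> y \<in> Fq 1 \<Longrightarrow> x * y \<in> Fq 1"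
    "x \<in> Fq 1 \<Longrightarrow> - x \<in> Fq 1" "x \<in> Fq 1 \<Longrightarrow> y \<in> Fq 1 \<Longrightarrow> x - y \<in> Fq 1"
    "x \<in> Fq 1 \<Longrightarrow> inverse x \<in> Fq 1" "x \<in> Fq 1 \<Longrightarrow> x ^ n \<in> Fq 1"
proof -
  show "0 \<in> (Fq 1 :: 'a set)" "1 \<in> (Fq 1 :: 'a set)"
    unfolding Fq1_iff by (simp_all add: power_0_left)
  show add: "x + y \<in> Fq 1" if "x \<in> Fq 1" "y \<in> Fq 1" for x y :: 'a
    using that unfolding Fq1_iff by (simp add: freshmans_dream[OF prime_CHAR refl])
  show "x \<in> Fq 1 \<Longrightarrow> y \<in> Fq 1 \<Longrightarrow> x * y \<in> Fq 1"
    unfolding Fq1_iff by (simp add: power_mult_distrib)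
  show uminus: "- x \<in> Fq 1" if "x \<in> Fq 1" for x :: 'a
    using that unfolding Fq1_iff by (simp add: minus_power_prime_CHAR[OF refl prime_CHAR])
  show "x \<in> Fq 1 \<Longrightarrow> y \<in> Fq 1 \<Longrightarrow> x - y \<in> Fq 1"
    using add[of x "- y"] uminus[of y] by simp
  show "x \<in> Fq 1 \<Longrightarrow> inverse x \<in> Fq 1"
    unfolding Fq1_iff by (simp add: power_inverse)
  show "x \<in> Fq 1 \<Longrightarrow> x ^ n \<in> Fq 1"
    unfolding Fq1_iff by (metis power_mult mult.commute)
qed

lemma poly_frob_power:
  "poly g x ^ CHAR('a) = poly (frob_map g) (x ^ CHAR('a))" for x :: "'a::{alg_closed_field,field_prime_char}"
proof -
  have "poly g x ^ CHAR('a) = (\<Sum>i\<le>degree g. (coeff g i * x ^ i) ^ CHAR('a))"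
    unfolding poly_altdef by (rule freshmans_dream_sum[OF prime_CHAR refl])
  also have "\<dots> = (\<Sum>i\<le>degree g. coeff (frob_map g) i * (x ^ CHAR('a)) ^ i)"
    by (intro sum.cong refl) (simp add: coeff_frob_map power_mult_distrib mult.commute flip: power_mult)
  also have "\<dots> = poly (frob_map g) (x ^ CHAR('a))"
  proof -
    have "degree (frob_map g) = degree g"
      unfolding frob_map_def by (rule degree_map_poly) auto
    thus ?thesis by (simp add: poly_altdef)
  qed
  finally show ?thesis .
qed

lemma poly_Fq:
  assumes "frob_map g = g" "x \<in> Fq n"
  shows "poly g x \<in> Fq n"
proof -
  have "poly g x ^ CHAR('a) ^ n = poly g (x ^ CHAR('a) ^ n)" for n
  proof (induction n)
    case (Suc n)
    have "poly g x ^ CHAR('a) ^ Suc n = (poly g x ^ CHAR('a) ^ n) ^ CHAR('a)"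
      by (simp add: mult.commute flip: power_mult)
    thus ?case unfolding Suc by (simp add: poly_frob_power assms(1) mult.commute flip: power_mult)
  qed simp
  thus ?thesis using assms(2) by (simp add: Fq_def)
qed

lemma finite_Fp_monic: "finite (Fp_monic n :: 'a::{alg_closed_field,field_prime_char} poly set)"
proof (rule finite_subset)
  show "Fp_monic n \<subseteq> (\<lambda>c. \<Sum>i\<le>n. monom (c i) i) ` (PiE {..n} (\<lambda>_. Fq 1 :: 'a set))"
  proof
    fix g :: "'a poly" assume g: "g \<in> Fp_monic n"
    hence "g = (\<Sum>i\<le>n. monom (restrict (coeff g) {..n} i) i)"
      using poly_as_sum_of_monoms[of g] by (simp add: Fp_monic_def)
    moreover have "restrict (coeff g) {..n} \<in> PiE {..n} (\<lambda>_. Fq 1)"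
      using g by (auto simp: Fp_monic_def frob_map_fixed_iff)
    ultimately show "g \<in> (\<lambda>c. \<Sum>i\<le>n. monom (c i) i) ` (PiE {..n} (\<lambda>_. Fq 1))" by blast
  qed
  show "finite ((\<lambda>c. \<Sum>i\<le>n. monom (c i) i) ` (PiE {..n} (\<lambda>_. Fq 1 :: 'a set)))"
    by (intro finite_imageI finite_PiE) auto
qed

lemma Fp_monic_0: "Fp_monic 0 = {1}"
  by (auto simp: Fp_monic_def elim!: degree_eq_zeroE)

lemma frob_poly_Suc: "frob_poly (Suc r) x = frob_poly r x * [:- (x ^ CHAR('a) ^ r), 1:]"
  for x :: "'a::{alg_closed_field,field_prime_char}"
  by (simp add: frob_poly_def mult.commute del: mult_pCons_left mult_pCons_right)

lemma frob_poly_nonzero: "frob_poly r x \<noteq> 0"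
  by (auto simp: frob_poly_def)

lemma frob_poly_add:
  fixes x :: "'a::{alg_closed_field,field_prime_char}"
  assumes "x \<in> Fq e"
  shows "frob_poly (e + r) x = frob_poly e x * frob_poly r x"
proof (induction r)
  case (Suc r)
  have "x ^ CHAR('a) ^ (e + r) = x ^ CHAR('a) ^ r"
    using assms by (simp add: Fq_def power_add power_mult)
  thus ?case using Suc by (simp add: frob_poly_Suc mult.assoc del: mult_pCons_left mult_pCons_right)
qed (simp add: frob_poly_def)

lemma degree_frob_poly: "degree (frob_poly r x) = r"
  unfolding frob_poly_def by (subst degree_prod_sum_eq) auto

text \<open>Frobenius on the coefficients moves each linear factor to the next one, and the factor
  of index \<open>r\<close> equals that of index 0 because \<open>x\<close> lies in
  \<open>Fq r\<close>; so the product is unchanged.\<close>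

lemma frob_poly_Fp_monic:
  fixes x :: "'a::{alg_closed_field,field_prime_char}"
  assumes "x \<in> Fq r"
  shows "frob_poly r x \<in> Fp_monic r"
proof -
  define h where "h j = [:- (x ^ CHAR('a) ^ j), 1:]" for j
  have "frob_map (frob_poly r x) = (\<Prod>j<r. h (Suc j))"
    by (simp add: frob_poly_def frob_map_prod frob_map_linear h_def mult.commute flip: power_mult)
  also have "\<dots> = frob_poly r x"
  proof -
    have "h r = h 0" using assms by (simp add: h_def Fq_def)
    hence "(\<Prod>j<r. h (Suc j)) * h 0 = (\<Prod>j<r. h j) * h 0"
      using prod.lessThan_Suc_shift[of h r] prod.lessThan_Suc[of h r] by (metis mult.commute)
    moreover have "h 0 \<noteq> 0" by (simp add: h_def)
    ultimately show ?thesis by (simp add: frob_poly_def h_def del: mult_pCons_left mult_pCons_right)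
  qed
  finally have "frob_map (frob_poly r x) = frob_poly r x" .
  moreover have "lead_coeff (frob_poly r x) = 1"
    unfolding frob_poly_def by (simp add: lead_coeff_prod)
  ultimately show ?thesis by (simp add: Fp_monic_def degree_frob_poly)
qed

lemma Fp_monic_nonzero: "g \<in> Fp_monic n \<Longrightarrow> g \<noteq> 0"
  by (auto simp: Fp_monic_def)

lemma Fp_monic_mult: "g \<in> Fp_monic n \<Longrightarrow> h \<in> Fp_monic m \<Longrightarrow> g * h \<in> Fp_monic (n + m)"
  using Fp_monic_nonzero[of g n] Fp_monic_nonzero[of h m]
  by (auto simp: Fp_monic_def frob_map_mult degree_mult_eq coeff_mult_degree_sum)

lemma Fp_monic_divide:
  assumes "g \<in> Fp_monic n" "g * h \<in> Fp_monic m"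
  shows "h \<in> Fp_monic (m - n)" "n \<le> m"
proof -
  have nz: "g \<noteq> 0" "h \<noteq> 0" using Fp_monic_nonzero[OF assms(2)] by auto
  hence deg: "degree (g * h) = degree g + degree h" by (rule degree_mult_eq)
  thus "n \<le> m" using assms by (auto simp: Fp_monic_def)
  have "g * frob_map h = g * h" using assms by (simp add: Fp_monic_def frob_map_mult)
  hence "frob_map h = h" using nz by simp
  moreover have lc: "lead_coeff (g * h) = 1" "lead_coeff g = 1"
    using assms unfolding Fp_monic_def by blast+
  have "lead_coeff h = 1" using lead_coeff_mult[of g h] unfolding lc by simp
  ultimately show "h \<in> Fp_monic (m - n)" using assms deg by (auto simp: Fp_monic_def)
qed

section \<open>Frobenius orbits of roots\<close>

lemma inj_frob_power: "x ^ CHAR('a) ^ n = y ^ CHAR('a) ^ n \<longleftrightarrow> x = y"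
  for x y :: "'a::{alg_closed_field,field_prime_char}"
proof
  assume "x ^ CHAR('a) ^ n = y ^ CHAR('a) ^ n"
  moreover have "((x - y) + y) ^ CHAR('a) ^ n = (x - y) ^ CHAR('a) ^ n + y ^ CHAR('a) ^ n"
    by (rule freshmans_dream'[OF prime_CHAR refl])
  ultimately have "(x - y) ^ CHAR('a) ^ n = 0" by simp
  thus "x = y" by simp
qed simp

lemma frob_orbit_roots:
  fixes x :: "'a::{alg_closed_field,field_prime_char}"
  assumes "frob_map g = g" "poly g x = 0"
  shows "poly g (x ^ CHAR('a) ^ j) = 0"
proof (induction j)
  case (Suc j)
  have "poly g (x ^ CHAR('a) ^ Suc j) = poly g (x ^ CHAR('a) ^ j) ^ CHAR('a)"
    by (simp add: poly_frob_power assms(1) mult.commute flip: power_mult)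
  thus ?case using Suc by (simp add: power_0_left)
qed (use assms in auto)

lemma prod_linear_dvd:
  fixes h :: "'a::field poly"
  assumes "finite A" "\<And>a. a \<in> A \<Longrightarrow> poly h a = 0"
  shows "(\<Prod>a\<in>A. [:-a, 1:]) dvd h"
  using assms
proof (induction A arbitrary: h rule: finite_induct)
  case (insert a A)
  then obtain k where k: "h = (\<Prod>a\<in>A. [:-a, 1:]) * k" by (metis dvdE insertCI)
  have "poly (\<Prod>a\<in>A. [:-a, 1:]) a \<noteq> 0" using insert by (auto simp: poly_prod)
  moreover have "poly h a = 0" using insert by simp
  ultimately have "poly k a = 0" by (simp add: k)
  hence "[:-a, 1:] dvd k" by (simp add: poly_eq_0_iff_dvd)
  thus ?case unfolding k using insert by (simp add: mult_dvd_mono mult.commute del: mult_pCons_left mult_pCons_right)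
qed simp

text \<open>The Frobenius orbit of a root stays among the finitely many roots of \<open>g\<close>,
  and injectivity of Frobenius makes it return to \<open>x\<close> itself. For the least period
  \<open>e\<close> the orbit has \<open>e\<close> distinct members, so \<open>frob_poly e x\<close>
  is the minimal polynomial of \<open>x\<close> over the prime field.\<close>

lemma exists_frob_period:
  fixes x :: "'a::{alg_closed_field,field_prime_char}"
  assumes "g \<noteq> 0" "frob_map g = g" "poly g x = 0"
  obtains e where "e > 0" "x \<in> Fq e" "\<And>r. r > 0 \<Longrightarrow> x \<in> Fq r \<Longrightarrow> e \<le> r" "frob_poly e x dvd g" "order x (frob_poly e x) = 1"
proof -
  have "range (\<lambda>j. x ^ CHAR('a) ^ j) \<subseteq> {y. poly g y = 0}"
    using frob_orbit_roots[OF assms(2,3)] by auto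
  hence "finite (range (\<lambda>j. x ^ CHAR('a) ^ j))" by (rule finite_subset[OF _ poly_roots_finite[OF assms(1)]])
  hence "\<not> inj (\<lambda>j. x ^ CHAR('a) ^ j)" using finite_imageD by blast
  then obtain i j where ij: "i < j" "x ^ CHAR('a) ^ i = x ^ CHAR('a) ^ j"
    unfolding inj_def by (metis linorder_neqE_nat)
  have period: "x \<in> Fq (j - i)" if "i < j" "x ^ CHAR('a) ^ i = x ^ CHAR('a) ^ j" for i j
  proof -
    have "CHAR('a) ^ j = CHAR('a) ^ (j - i) * CHAR('a) ^ i"
      using that(1) by (simp flip: power_add)
    hence "(x ^ CHAR('a) ^ (j - i)) ^ CHAR('a) ^ i = x ^ CHAR('a) ^ i"
      using that(2) by (simp only: power_mult)
    thus ?thesis using inj_frob_power[of "x ^ CHAR('a) ^ (j - i)" i x] by (simp only: Fq_def mem_Collect_eq)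
  qed
  define e where "e = (LEAST e. e > 0 \<and> x \<in> Fq e)"
  have ex: "j - i > 0 \<and> x \<in> Fq (j - i)" using ij period by auto
  have e: "e > 0" "x \<in> Fq e" using LeastI[of "\<lambda>e. e > 0 \<and> x \<in> Fq e", OF ex] by (auto simp: e_def)
  have min: "e \<le> r" if "r > 0" "x \<in> Fq r" for r unfolding e_def using that by (intro Least_le) auto
  have inj: "inj_on (\<lambda>j. x ^ CHAR('a) ^ j) {..<e}"
  proof (rule linorder_inj_onI')
    fix i j assume "i \<in> {..<e}" "j \<in> {..<e}" "i < j"
    thus "x ^ CHAR('a) ^ i \<noteq> x ^ CHAR('a) ^ j" using period[of i j] min[of "j - i"] by auto
  qed
  have fp: "frob_poly e x = (\<Prod>a\<in>(\<lambda>j. x ^ CHAR('a) ^ j) ` {..<e}. [:-a, 1:])"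
    unfolding frob_poly_def by (subst prod.reindex[OF inj]) simp
  have "frob_poly e x dvd g"
    unfolding fp using frob_orbit_roots[OF assms(2,3)] by (intro prod_linear_dvd) auto
  moreover have "order x (frob_poly e x) = 1"
  proof -
    obtain e' where e': "e = Suc e'" using e by (cases e) auto
    define h where "h = (\<Prod>j<e'. [:- (x ^ CHAR('a) ^ Suc j), 1:])"
    have "frob_poly e x = [:-x, 1:] * h"
      unfolding frob_poly_def e' h_def by (subst prod.lessThan_Suc_shift) simp
    moreover have "poly h x \<noteq> 0"
    proof
      assume "poly h x = 0"
      then obtain j where "j < e'" "x = x ^ CHAR('a) ^ Suc j" by (auto simp: h_def poly_prod)
      thus False using inj_onD[OF inj, of 0 "Suc j"] e' by simp
    qed
    hence "h \<noteq> 0" "order x h = 0" by (auto simp: order_0I)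
    ultimately show ?thesis
      using order_power_n_n[of x 1] by (simp add: order_mult del: mult_pCons_left)
  qed
  ultimately show ?thesis using that e min by blast
qed

text \<open>The \<open>r\<close> with \<open>x \<in> Fq r\<close> are the multiples of the period
  \<open>e\<close>, and \<open>frob_poly (k * e) x\<close> is the \<open>k\<close>-th power of the
  minimal polynomial. So the count is the multiplicity of that polynomial in \<open>g\<close>, which
  is the order of \<open>x\<close>. The induction divides out one copy at a time.\<close>

lemma card_frob_poly_dvd:
  fixes x :: "'a::{alg_closed_field,field_prime_char}"
  assumes "g \<in> Fp_monic n"
  shows "finite {r. r > 0 \<and> x \<in> Fq r \<and> frob_poly r x dvd g} \<and>
    card {r. r > 0 \<and> x \<in> Fq r \<and> frob_poly r x dvd g} = order x g"
  using assms
proof (induction n arbitrary: g rule: less_induct)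
  case (less n)
  have g: "g \<noteq> 0" "frob_map g = g" using less.prems Fp_monic_nonzero by (auto simp: Fp_monic_def)
  show ?case
  proof (cases "poly g x = 0")
    case False
    have "\<not> frob_poly r x dvd g" if "r > 0" for r
    proof
      assume "frob_poly r x dvd g"
      moreover have "[:- (x ^ CHAR('a) ^ 0), 1:] dvd frob_poly r x"
        unfolding frob_poly_def using that by (intro dvd_prodI) auto
      ultimately have "[:-x, 1:] dvd g" by (metis dvd_trans power_0 power_one_right)
      thus False using False by (simp add: poly_eq_0_iff_dvd)
    qed
    hence eq: "{r. r > 0 \<and> x \<in> Fq r \<and> frob_poly r x dvd g} = {}" by auto
    show ?thesis unfolding eq using False by (simp add: order_0I)
  next
    case True
    obtain e where e: "e > 0" "x \<in> Fq e" "\<And>r. r > 0 \<Longrightarrow> x \<in> Fq r \<Longrightarrow> e \<le> r" "frob_poly e x dvd g" "order x (frob_poly e x) = 1"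
      using exists_frob_period[OF g True] by metis
    obtain h where h: "g = frob_poly e x * h" using e(4) by (elim dvdE)
    have hm: "h \<in> Fp_monic (n - e)" "e \<le> n"
      using Fp_monic_divide[OF frob_poly_Fp_monic[OF e(2)], of h n] less.prems h by auto
    have IH: "finite {r. r > 0 \<and> x \<in> Fq r \<and> frob_poly r x dvd h}"
      "card {r. r > 0 \<and> x \<in> Fq r \<and> frob_poly r x dvd h} = order x h"
      using less.IH[of "n - e" h] hm e(1) by auto
    have Fq_iff: "x \<in> Fq (e + r) \<longleftrightarrow> x \<in> Fq r" for r
      using e(2) by (simp add: Fq_def power_add power_mult)
    have eq: "{r. r > 0 \<and> x \<in> Fq r \<and> frob_poly r x dvd g} =
        insert e ((+) e ` {r. r > 0 \<and> x \<in> Fq r \<and> frob_poly r x dvd h})" (is "?L = ?R")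
    proof (intro equalityI subsetI)
      fix r assume r: "r \<in> ?L"
      hence "e \<le> r" using e(3) by auto
      then obtain s where s: "r = e + s" using le_Suc_ex by blast
      show "r \<in> ?R"
      proof (cases "s = 0")
        case False
        have "x \<in> Fq s" using r Fq_iff[of s] by (simp add: s)
        moreover have "frob_poly s x dvd h"
          using r frob_poly_nonzero[of e x] by (simp add: s frob_poly_add[OF e(2)] h)
        ultimately show ?thesis using False s by auto
      qed (use s in auto)
    next
      fix r assume "r \<in> ?R"
      thus "r \<in> ?L" using e Fq_iff h by (auto simp: frob_poly_add[OF e(2)])
    qed
    have "e \<notin> (+) e ` {r. r > 0 \<and> x \<in> Fq r \<and> frob_poly r x dvd h}" by auto
    hence "card ?L = Suc (order x h)" unfolding eq using IH by (simp add: card_image)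
    also have "\<dots> = order x g" using g(1) e(5) by (simp add: h order_mult)
    finally show ?thesis using IH unfolding eq by simp
  qed
qed

text \<open>After exchanging the sums each root of \<open>g\<close> contributes its multiplicity,
  and the multiplicities add up to the degree.\<close>

lemma card_frob_poly_dvd_pairs:
  fixes g :: "'a::{alg_closed_field,field_prime_char} poly"
  assumes "g \<in> Fp_monic n"
  shows "(\<Sum>r\<in>{1..n}. card {x\<in>Fq r. frob_poly r x dvd g}) = n"
proof -
  have g: "g \<noteq> 0" "degree g = n" using assms Fp_monic_nonzero by (auto simp: Fp_monic_def)
  define Z where "Z = {x. poly g x = 0}"
  have finZ: "finite Z" using g by (simp add: Z_def poly_roots_finite)
  have root: "x \<in> Z" if "r > 0" "frob_poly r x dvd g" for r x
  proof -
    have "[:- (x ^ CHAR('a) ^ 0), 1:] dvd frob_poly r x"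
      unfolding frob_poly_def using that by (intro dvd_prodI) auto
    hence "[:-x, 1:] dvd g" using that(2) by (metis dvd_trans power_0 power_one_right)
    thus ?thesis by (simp add: Z_def poly_eq_0_iff_dvd)
  qed
  have "(\<Sum>r\<in>{1..n}. card {x\<in>Fq r. frob_poly r x dvd g}) = (\<Sum>r\<in>{1..n}. \<Sum>x\<in>Z. if x \<in> Fq r \<and> frob_poly r x dvd g then 1 else 0)"
  proof (rule sum.cong[OF refl])
    fix r assume "r \<in> {1..n}"
    hence "{x\<in>Fq r. frob_poly r x dvd g} = {x\<in>Z. x \<in> Fq r \<and> frob_poly r x dvd g}" using root[of r] by auto
    thus "card {x\<in>Fq r. frob_poly r x dvd g} = (\<Sum>x\<in>Z. if x \<in> Fq r \<and> frob_poly r x dvd g then 1 else 0)"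
      using finZ by (simp add: sum.If_cases Int_def)
  qed
  also have "\<dots> = (\<Sum>x\<in>Z. \<Sum>r\<in>{1..n}. if x \<in> Fq r \<and> frob_poly r x dvd g then 1 else 0)"
    by (rule sum.swap)
  also have "\<dots> = (\<Sum>x\<in>Z. order x g)"
  proof (rule sum.cong[OF refl])
    fix x
    have "r \<le> n" if "frob_poly r x dvd g" for r
      using dvd_imp_degree_le[OF that g(1)] by (simp add: degree_frob_poly g)
    hence "{r\<in>{1..n}. x \<in> Fq r \<and> frob_poly r x dvd g} = {r. r > 0 \<and> x \<in> Fq r \<and> frob_poly r x dvd g}" by auto
    thus "(\<Sum>r\<in>{1..n}. if x \<in> Fq r \<and> frob_poly r x dvd g then 1 else 0) = order x g"
      using card_frob_poly_dvd[OF assms, of x] by (simp add: sum.If_cases Int_def)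
  qed
  also have "\<dots> = size (proots g)" using g by (simp add: size_multiset_overloaded_eq Z_def)
  also have "\<dots> = n" using size_proots_alg_closed[OF g(1)] g(2) by simp
  finally show ?thesis .
qed

section \<open>Size of two complex numbers from their power sums\<close>

lemma power_le_imp_le_of_eventually:
  fixes x y C :: real
  assumes "x \<ge> 0" "y > 0" "\<And>n. n \<ge> n0 \<Longrightarrow> x ^ n \<le> C * y ^ n"
  shows "x \<le> y"
proof (rule ccontr)
  assume "\<not> x \<le> y"
  hence gt: "x / y > 1" using assms by simp
  then obtain n where n: "C < (x / y) ^ n" using real_arch_pow by blast
  define N where "N = max n n0"
  have "(x / y) ^ n \<le> (x / y) ^ N" using gt by (intro power_increasing) (auto simp: N_def)
  hence "C < x ^ N / y ^ N" using n by (simp add: power_divide)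
  hence "C * y ^ N < x ^ N" using assms by (simp add: pos_less_divide_eq)
  thus False using assms(3)[of N] by (simp add: N_def)
qed

text \<open>The identity \<open>2 * (u * v) ^ n = (u ^ n + v ^ n)^2 - (u ^ (2 * n) + v ^ (2 *
  n))\<close> shows that \<open>u * v\<close> has size at most \<open>R^2\<close>. If
  \<open>u\<close> were larger than \<open>R\<close>, then \<open>v\<close> would be at most
  \<open>R\<close>, and \<open>u ^ n\<close> alone would be bounded by a multiple of
  \<open>R ^ n\<close>, which is absurd for large \<open>n\<close>.\<close>

lemma two_power_sums_bound:
  fixes u v :: complex and R C :: real
  assumes R: "R > 0" and bound: "\<And>n. n \<ge> n0 \<Longrightarrow> cmod (u ^ n + v ^ n) \<le> C * R ^ n"
  shows "cmod u \<le> R"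
proof (rule ccontr)
  assume "\<not> cmod u \<le> R"
  hence u: "cmod u > R" by simp
  have C: "C \<ge> 0"
  proof -
    have "0 \<le> C * R ^ n0" using bound[of n0] norm_ge_zero order_trans by blast
    thus ?thesis using zero_less_power[OF R, of n0] by (simp add: zero_le_mult_iff)
  qed
  have uv: "cmod (u * v) ^ n \<le> (C\<^sup>2 + C) * (R\<^sup>2) ^ n" if n: "n \<ge> n0" for n
  proof -
    have "2 * (u * v) ^ n = (u ^ n + v ^ n)\<^sup>2 - (u ^ (2 * n) + v ^ (2 * n))"
      by (simp add: power2_sum power_mult_distrib power_mult[symmetric] mult.commute[of n 2])
    hence "cmod (2 * (u * v) ^ n) \<le> cmod ((u ^ n + v ^ n)\<^sup>2) + cmod (u ^ (2 * n) + v ^ (2 * n))"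
      by (simp add: norm_triangle_ineq4)
    also have "\<dots> \<le> (C * R ^ n)\<^sup>2 + C * R ^ (2 * n)"
      unfolding norm_power using bound[OF n] bound[of "2 * n"] n by (intro add_mono power_mono) auto
    also have "\<dots> = (C\<^sup>2 + C) * (R\<^sup>2) ^ n"
      by (simp add: power_mult_distrib distrib_right power_mult[symmetric] mult.commute[of n 2])
    finally have "2 * cmod (u * v) ^ n \<le> (C\<^sup>2 + C) * (R\<^sup>2) ^ n"
      by (simp only: norm_mult[of 2] norm_power norm_numeral)
    moreover have "0 \<le> cmod (u * v) ^ n" by simp
    ultimately show ?thesis by linarith
  qed
  have "cmod (u * v) \<le> R\<^sup>2"
    by (rule power_le_imp_le_of_eventually[OF norm_ge_zero _ uv]) (use R in simp)
  hence "R * cmod v \<le> R * R"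
    using mult_right_mono[of R "cmod u" "cmod v"] u by (simp add: norm_mult power2_eq_square)
  hence v: "cmod v \<le> R" using R by simp
  have un: "cmod u ^ n \<le> (C + 1) * R ^ n" if n: "n \<ge> n0" for n
  proof -
    have "cmod (u ^ n) \<le> cmod (u ^ n + v ^ n) + cmod (v ^ n)"
      by (metis add_diff_cancel_right' norm_triangle_ineq4)
    also have "\<dots> \<le> C * R ^ n + R ^ n"
      unfolding norm_power[of v] using bound[OF n] v by (intro add_mono power_mono) auto
    finally show ?thesis by (simp add: norm_power algebra_simps)
  qed
  have "cmod u \<le> R" by (rule power_le_imp_le_of_eventually[OF norm_ge_zero R un])
  thus False using u by simp
qed

lemma geometric_sum_nat: "(p - 1) * (\<Sum>j<n. p ^ j) + 1 = p ^ n" if "p > 0" for p n :: nat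
proof (induction n)
  case (Suc n)
  have "(p - 1) * (\<Sum>j<Suc n. p ^ j) + 1 = ((p - 1) * (\<Sum>j<n. p ^ j) + 1) + (p - 1) * p ^ n"
    by (simp add: algebra_simps)
  also have "\<dots> = p ^ Suc n" unfolding Suc using that by (simp add: algebra_simps diff_mult_distrib)
  finally show ?case .
qed simp

text \<open>\<open>chi\<close> is a total function on the algebraically closed type but a character
  only on the prime field, so each use of multiplicativity comes with a proof of membership in
  \<open>Fq 1\<close>.\<close>

locale mult_char =
  fixes chi :: "'a::{alg_closed_field,field_prime_char} \<Rightarrow> complex"
  assumes chi_0: "chi 0 = 0" and chi_1: "chi 1 = 1"
    and chi_mult: "\<And>x y. x \<in> Fq 1 \<Longrightarrow> y \<in> Fq 1 \<Longrightarrow> chi (x * y) = chi x * chi y"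
    and chi_le: "\<And>x. cmod (chi x) \<le> 1"
    and chi_nontrivial: "\<exists>a\<in>Fq 1. a \<noteq> 0 \<and> chi a \<noteq> 1"
begin

lemma chi_power: "x \<in> Fq 1 \<Longrightarrow> chi (x ^ n) = chi x ^ n"
  by (induction n) (auto simp: chi_1 chi_mult Fq1_closed simp del: One_nat_def)

lemma chi_prod: "(\<And>i. i \<in> A \<Longrightarrow> f i \<in> Fq 1) \<Longrightarrow> (\<Prod>i\<in>A. f i) \<in> Fq 1 \<and> chi (\<Prod>i\<in>A. f i) = (\<Prod>i\<in>A. chi (f i))"
  by (induction A rule: infinite_finite_induct) (auto simp: chi_1 chi_mult Fq1_closed simp del: One_nat_def)

lemma chi_power_CHAR:
  assumes "a \<in> Fq 1" "a \<noteq> 0"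
  shows "chi a ^ (CHAR('a) - 1) = 1"
proof -
  have "a * a ^ (CHAR('a) - 1) = a"
    using assms(1)[unfolded Fq1_iff] prime_gt_0_nat[OF prime_CHAR[where 'a='a]] by (simp flip: power_Suc)
  hence "a ^ (CHAR('a) - 1) = 1" using assms(2) by simp
  thus ?thesis using chi_power[OF assms(1), of "CHAR('a) - 1"] by (simp add: chi_1)
qed

lemma sum_chi_power:
  assumes a: "a \<in> Fq 1" "a \<noteq> 0" "chi a ^ e \<noteq> 1"
  shows "(\<Sum>x\<in>Fq 1. chi x ^ e) = 0"
proof -
  have inv: "a * (inverse a * x) = x" "inverse a * (a * x) = x" for x
    using a(2) by (simp_all flip: mult.assoc)
  have "(\<Sum>x\<in>Fq 1. chi x ^ e) = (\<Sum>x\<in>Fq 1. chi (a * x) ^ e)"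
    by (rule sum.reindex_bij_witness[of _ "\<lambda>x. a * x" "\<lambda>x. inverse a * x"])
       (use a(1) in \<open>auto simp: inv intro!: Fq1_closed(4,7) simp del: One_nat_def inverse_eq_divide\<close>)
  also have "\<dots> = chi a ^ e * (\<Sum>x\<in>Fq 1. chi x ^ e)"
    unfolding sum_distrib_left using a by (intro sum.cong) (auto simp: chi_mult power_mult_distrib simp del: One_nat_def)
  finally show ?thesis using a(3) by simp
qed

lemma sum_chi: "(\<Sum>x\<in>Fq 1. chi x) = 0"
  using chi_nontrivial sum_chi_power[of _ 1] by auto

end

locale char_sum_data = mult_char chi for chi :: "'a::{alg_closed_field,field_prime_char} \<Rightarrow> complex" +
  fixes U :: "'a set" and e :: "'a \<Rightarrow> nat"
  assumes finite_U: "finite U" and U_Fq: "U \<subseteq> Fq 1"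
begin

text \<open>A completely multiplicative function on monic polynomials over the prime field. Its
  L-function has the coefficients \<open>coeff_sum n\<close>, and the \<open>power_sum r\<close> are
  the coefficients of the logarithmic derivative: the analogues of the character sum over the
  extensions of degree \<open>r\<close>.\<close>

definition lam :: "'a poly \<Rightarrow> complex" where
  "lam g = (\<Prod>u\<in>U. chi (poly g u) ^ e u)"

definition coeff_sum :: "nat \<Rightarrow> complex" where
  "coeff_sum n = (\<Sum>g\<in>Fp_monic n. lam g)"

definition power_sum :: "nat \<Rightarrow> complex" where
  "power_sum r = (\<Sum>x\<in>Fq r. lam (frob_poly r x))"

lemma lam_mult: "frob_map g = g \<Longrightarrow> frob_map h = h \<Longrightarrow> lam (g * h) = lam g * lam h"
  unfolding lam_def prod.distrib[symmetric] using U_Fq poly_Fq[of g _ 1] poly_Fq[of h _ 1]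
  by (intro prod.cong refl) (auto simp: chi_mult power_mult_distrib subset_iff simp del: One_nat_def)

text \<open>
  Logarithmic derivative of the Euler product: a polynomial \<open>g\<close> of degree \<open>n\<close> is divisible by
  \<open>frob_poly r x\<close> for exactly \<open>n\<close> pairs \<open>(r, x)\<close>.
\<close>

lemma newton_identity: "of_nat n * coeff_sum n = (\<Sum>r\<in>{1..n}. power_sum r * coeff_sum (n - r))"
proof -
  have "of_nat n * coeff_sum n = (\<Sum>g\<in>Fp_monic n. lam g * of_nat n)"
    by (simp add: coeff_sum_def sum_distrib_left mult.commute)
  also have "\<dots> = (\<Sum>g\<in>Fp_monic n. \<Sum>r\<in>{1..n}. \<Sum>x\<in>Fq r. if frob_poly r x dvd g then lam g else 0)"
  proof (rule sum.cong[OF refl])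
    fix g :: "'a poly" assume g: "g \<in> Fp_monic n"
    have "lam g * of_nat n = lam g * of_nat (\<Sum>r\<in>{1..n}. card {x\<in>Fq r. frob_poly r x dvd g})"
      by (simp only: card_frob_poly_dvd_pairs[OF g])
    also have "\<dots> = (\<Sum>r\<in>{1..n}. \<Sum>x\<in>{x\<in>Fq r. frob_poly r x dvd g}. lam g)"
      by (simp add: sum_distrib_left mult.commute)
    also have "\<dots> = (\<Sum>r\<in>{1..n}. \<Sum>x\<in>Fq r. if frob_poly r x dvd g then lam g else 0)"
    proof (rule sum.cong[OF refl])
      fix r assume "r \<in> {1..n}"
      hence "finite (Fq r :: 'a set)" by simp
      thus "(\<Sum>x\<in>{x\<in>Fq r. frob_poly r x dvd g}. lam g) = (\<Sum>x\<in>Fq r. if frob_poly r x dvd g then lam g else 0)"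
        by (rule sum.inter_filter)
    qed
    finally show "lam g * of_nat n = (\<Sum>r\<in>{1..n}. \<Sum>x\<in>Fq r. if frob_poly r x dvd g then lam g else 0)" .
  qed
  also have "\<dots> = (\<Sum>r\<in>{1..n}. \<Sum>x\<in>Fq r. \<Sum>g\<in>Fp_monic n. if frob_poly r x dvd g then lam g else 0)"
    by (subst sum.swap, intro sum.cong refl, subst sum.swap) simp
  also have "\<dots> = (\<Sum>r\<in>{1..n}. \<Sum>x\<in>Fq r. lam (frob_poly r x) * coeff_sum (n - r))"
  proof (intro sum.cong refl)
    fix r and x :: 'a assume r: "r \<in> {1..n}" and x: "x \<in> Fq r"
    have f: "frob_poly r x \<in> Fp_monic r" by (rule frob_poly_Fp_monic[OF x])
    have "(\<Sum>g\<in>Fp_monic n. if frob_poly r x dvd g then lam g else 0) = (\<Sum>g\<in>{g\<in>Fp_monic n. frob_poly r x dvd g}. lam g)"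
      by (simp add: sum.inter_filter finite_Fp_monic)
    also have "{g\<in>Fp_monic n. frob_poly r x dvd g} = (\<lambda>h. frob_poly r x * h) ` Fp_monic (n - r)"
    proof (intro equalityI subsetI)
      fix g assume "g \<in> {g\<in>Fp_monic n. frob_poly r x dvd g}"
      hence g: "frob_poly r x dvd g" "g \<in> Fp_monic n" by auto
      then obtain h where "g = frob_poly r x * h" by (elim dvdE)
      thus "g \<in> (\<lambda>h. frob_poly r x * h) ` Fp_monic (n - r)"
        using Fp_monic_divide(1)[OF f, of h n] g by auto
    next
      fix g assume "g \<in> (\<lambda>h. frob_poly r x * h) ` Fp_monic (n - r)"
      thus "g \<in> {g\<in>Fp_monic n. frob_poly r x dvd g}" using Fp_monic_mult[OF f, of _ "n - r"] r by auto
    qed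
    also have "(\<Sum>g\<in>(\<lambda>h. frob_poly r x * h) ` Fp_monic (n - r). lam g) = (\<Sum>h\<in>Fp_monic (n - r). lam (frob_poly r x * h))"
      by (subst sum.reindex) (auto simp: inj_on_def frob_poly_nonzero)
    also have "\<dots> = (\<Sum>h\<in>Fp_monic (n - r). lam (frob_poly r x) * lam h)"
      using f by (intro sum.cong refl lam_mult) (auto simp: Fp_monic_def)
    finally show "(\<Sum>g\<in>Fp_monic n. if frob_poly r x dvd g then lam g else 0) = lam (frob_poly r x) * coeff_sum (n - r)"
      by (simp add: coeff_sum_def sum_distrib_left)
  qed
  finally show ?thesis by (simp add: power_sum_def sum_distrib_right)
qed

lemma coeff_sum_0: "coeff_sum 0 = 1"
  by (simp add: coeff_sum_def Fp_monic_0 lam_def chi_1)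

text \<open>
  Adding multiples of the Lagrange polynomial of \<open>u0\<close> moves only the factor at \<open>u0\<close>, over which
  the character sums to zero.
\<close>

lemma coeff_sum_eq_0:
  assumes n: "n \<ge> card U" and u0: "u0 \<in> U" and a: "a \<in> Fq 1" "a \<noteq> 0" "chi a ^ e u0 \<noteq> 1"
  shows "coeff_sum n = 0"
proof -
  define c where "c = inverse (\<Prod>u\<in>U-{u0}. u0 - u)"
  define l where "l = smult c (\<Prod>u\<in>U-{u0}. [:-u, 1:])"
  have pr: "(\<Prod>u\<in>U-{u0}. u0 - u) \<in> Fq 1"
    using chi_prod[of "U - {u0}" "\<lambda>u. u0 - u"] Fq1_closed(6) U_Fq u0 by blast
  hence "c ^ CHAR('a) = c" unfolding c_def using Fq1_closed(7) Fq1_iff by blast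
  moreover have "u ^ CHAR('a) = u" if "u \<in> U" for u using U_Fq that Fq1_iff by blast
  hence "(\<Prod>u\<in>U-{u0}. [:- (u ^ CHAR('a)), 1:]) = (\<Prod>u\<in>U-{u0}. [:-u, 1:])"
    by (intro prod.cong) auto
  ultimately have "frob_map l = l"
    unfolding l_def by (simp add: frob_map_smult frob_map_prod frob_map_linear)
  have l1: "poly l u0 = 1" using finite_U by (simp add: l_def c_def poly_prod)
  have l0: "poly l u = 0" if "u \<in> U - {u0}" for u
  proof -
    have "(\<Prod>v\<in>U-{u0}. - v + u) = 0" using that finite_U by (intro prod_zero bexI[of _ u]) auto
    thus ?thesis by (simp add: l_def poly_prod)
  qed
  have "degree l \<le> card (U - {u0})"
    unfolding l_def using degree_smult_le[of c "\<Prod>u\<in>U-{u0}. [:-u, 1:]"] by (simp add: degree_prod_sum_eq)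
  also have "\<dots> < card U" using card_Diff1_less[OF finite_U u0] .
  finally have dl: "degree l < n" using n by simp
  \<comment> \<open>The degree of \<open>l\<close> is below \<open>card U\<close>, hence below
    \<open>n\<close>, so adding a multiple of \<open>l\<close> keeps a polynomial monic of degree
    \<open>n\<close>.\<close>
  have shift: "g + smult t l \<in> Fp_monic n" if "g \<in> Fp_monic n" "t \<in> Fq 1" for g t
  proof -
    have "coeff l (degree g) = 0" using that dl by (intro coeff_eq_0) (auto simp: Fp_monic_def)
    moreover have "degree (smult t l) < degree g" using that dl degree_smult_le[of t l] by (auto simp: Fp_monic_def)
    ultimately have deg: "degree (g + smult t l) = degree g" "lead_coeff (g + smult t l) = lead_coeff g"
      by (auto simp: degree_add_eq_left coeff_eq_0)
    have g: "degree g = n" "lead_coeff g = 1" "frob_map g = g"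
      using that(1) unfolding Fp_monic_def by blast+
    have "t ^ CHAR('a) = t" using that(2) Fq1_iff by blast
    hence "frob_map (g + smult t l) = g + smult t l"
      by (simp only: frob_map_add frob_map_smult g \<open>frob_map l = l\<close>)
    with deg g(1,2) have "degree (g + smult t l) = n \<and> lead_coeff (g + smult t l) = 1 \<and> frob_map (g + smult t l) = g + smult t l"
      by metis
    thus ?thesis unfolding Fp_monic_def by blast
  qed
  have lam_shift: "lam (g + smult t l) = chi (poly g u0 + t) ^ e u0 * (\<Prod>u\<in>U-{u0}. chi (poly g u) ^ e u)" for g t
    unfolding lam_def using finite_U u0 l1 l0 by (subst prod.remove[of _ u0]) (auto intro!: prod.cong)
  have "of_nat (CHAR('a)) * coeff_sum n = (\<Sum>t\<in>(Fq 1 :: 'a set). \<Sum>g\<in>Fp_monic n. lam g)"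
    using card_Fq[OF zero_less_one, where 'a='a] by (simp add: coeff_sum_def)
  also have "\<dots> = (\<Sum>t\<in>Fq 1. \<Sum>g\<in>Fp_monic n. lam (g + smult t l))"
  proof (rule sum.cong[OF refl])
    fix t :: 'a assume t: "t \<in> Fq 1"
    hence t': "- t \<in> Fq 1" by (rule Fq1_closed(5))
    show "(\<Sum>g\<in>Fp_monic n. lam g) = (\<Sum>g\<in>Fp_monic n. lam (g + smult t l))"
      by (rule sum.reindex_bij_witness[of _ "\<lambda>g. g + smult t l" "\<lambda>g. g + smult (- t) l"])
         (use shift[OF _ t] shift[OF _ t'] in auto)
  qed
  also have "\<dots> = (\<Sum>g\<in>Fp_monic n. \<Sum>t\<in>Fq 1. lam (g + smult t l))" by (rule sum.swap)
  also have "\<dots> = (\<Sum>g\<in>(Fp_monic n :: 'a poly set). 0)"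
  proof (rule sum.cong[OF refl])
    fix g :: "'a poly" assume g: "g \<in> Fp_monic n"
    have gu: "poly g u0 \<in> Fq 1" using g u0 U_Fq by (intro poly_Fq) (auto simp: Fp_monic_def)
    have "(\<Sum>t\<in>Fq 1. chi (poly g u0 + t) ^ e u0) = (\<Sum>t\<in>Fq 1. chi t ^ e u0)"
      by (rule sum.reindex_bij_witness[of _ "\<lambda>t. t - poly g u0" "\<lambda>t. poly g u0 + t"])
         (use gu Fq1_closed in \<open>auto simp del: One_nat_def\<close>)
    also have "\<dots> = 0" by (rule sum_chi_power[OF a])
    finally show "(\<Sum>t\<in>Fq 1. lam (g + smult t l)) = 0"
      by (simp add: lam_shift flip: sum_distrib_right)
  qed
  finally show ?thesis by simp
qed

text \<open>At a point \<open>u\<close> of the prime field \<open>frob_poly r x\<close> takes the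
  norm of \<open>u - x\<close> as its value, which is
  \<open>(u - x) ^ (1 + p + ... + p ^ (r - 1))\<close>. Multiplicativity then collects the points
  into one polynomial, to which Stepanov's bound applies.\<close>

lemma lam_frob_poly:
  assumes "x \<in> Fq r"
  shows "lam (frob_poly r x) = chi (poly (\<Prod>u\<in>U. [:u, -1:] ^ e u) x ^ (\<Sum>j<r. CHAR('a) ^ j))"
proof -
  define E where "E = (\<Sum>j<r. CHAR('a) ^ j)"
  have pu: "poly (frob_poly r x) u = (u - x) ^ E" if u: "u \<in> U" for u
  proof -
    have "u ^ CHAR('a) = u" using u U_Fq Fq1_iff by blast
    hence u': "u ^ CHAR('a) ^ j = u" for j
      by (induction j) (simp_all add: power_mult)
    have "(u - x) ^ CHAR('a) ^ j = u - x ^ CHAR('a) ^ j" for j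
      using freshmans_dream'[OF prime_CHAR[where 'a='a] refl, of "u - x" x j] u'[of j] by (simp add: eq_diff_eq)
    hence "poly (frob_poly r x) u = (\<Prod>j<r. (u - x) ^ CHAR('a) ^ j)"
      by (simp add: frob_poly_def poly_prod)
    thus ?thesis by (simp add: E_def power_sum)
  qed
  have mem: "poly (frob_poly r x) u \<in> Fq 1" if "u \<in> U" for u
    using frob_poly_Fp_monic[OF assms] U_Fq that by (intro poly_Fq) (auto simp: Fp_monic_def)
  have "lam (frob_poly r x) = (\<Prod>u\<in>U. chi (poly (frob_poly r x) u ^ e u))"
    unfolding lam_def using mem by (intro prod.cong) (auto simp: chi_power simp del: One_nat_def)
  also have "\<dots> = chi (\<Prod>u\<in>U. poly (frob_poly r x) u ^ e u)"
  proof -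
    have "poly (frob_poly r x) u ^ e u \<in> Fq 1" if "u \<in> U" for u
      using mem[OF that] by (rule Fq1_closed(8))
    from chi_prod[of U, OF this] show ?thesis by simp
  qed
  also have "(\<Prod>u\<in>U. poly (frob_poly r x) u ^ e u) = (\<Prod>u\<in>U. ((u - x) ^ e u) ^ E)"
    using pu by (intro prod.cong refl) (simp add: mult.commute flip: power_mult)
  also have "\<dots> = poly (\<Prod>u\<in>U. [:u, -1:] ^ e u) x ^ E"
    by (simp add: poly_prod prod_power_distrib)
  finally show ?thesis by (simp add: E_def)
qed

text \<open>
  With at most three points the L-function is a quadratic polynomial with inverse roots \<open>\<alpha>\<close>, \<open>\<beta>\<close>.
  Stepanov's bound over ever larger fields loses only a constant, so it forces
  \<open>cmod \<alpha> \<le> sqrt p\<close> and \<open>cmod \<beta> \<le> sqrt p\<close>.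
\<close>

lemma weil_bound_three_points:
  assumes card: "card U \<le> 3" and cop: "coprime (\<Sum>u\<in>U. e u) (CHAR('a) - 1)"
  shows "cmod (\<Sum>x\<in>Fq 1. \<Prod>u\<in>U. chi (u - x) ^ e u) \<le> 2 * sqrt CHAR('a)"
proof -
  define p where "p = CHAR('a)"
  define F where "F = (\<Prod>u\<in>U. [:u, -1:] ^ e u)"
  define D where "D = (\<Sum>u\<in>U. e u)"
  have p: "p > 1" unfolding p_def by (rule prime_gt_1_nat[OF prime_CHAR])
  have degF: "degree F = D" "F \<noteq> 0"
    unfolding F_def D_def using finite_U by (auto simp: degree_prod_sum_eq degree_power_eq)
  have fF: "frob_map F = F"
  proof -
    have "frob_map ([:u, -1:] ^ k) = [:u, -1:] ^ k" if "u \<in> U" for u k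
    proof (induction k)
      case (Suc k)
      have "frob_map [:u, -1:] = [:u, -1:]"
        unfolding frob_map_fixed_iff using U_Fq that Fq1_closed(1,2) Fq1_closed(5)[OF Fq1_closed(2)]
        by (auto simp: coeff_pCons split: nat.splits)
      thus ?case using Suc by (simp add: frob_map_mult del: mult_pCons_left)
    qed simp
    thus ?thesis unfolding F_def frob_map_prod by (intro prod.cong) auto
  qed
  \<comment> \<open>If \<open>chi ^ e u\<close> were trivial at every point, then both
    \<open>D\<close> and \<open>p - 1\<close> would annihilate \<open>chi\<close>, and by Bezout so
    would 1, against nontriviality. A point \<open>u0\<close> of this kind is what makes the
    coefficients from degree 3 on vanish.\<close>
  have ex: "\<exists>u0\<in>U. \<exists>a\<in>Fq 1. a \<noteq> 0 \<and> chi a ^ e u0 \<noteq> 1"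
  proof (rule ccontr)
    assume "\<not> ?thesis"
    hence *: "chi a ^ e u = 1" if "u \<in> U" "a \<in> Fq 1" "a \<noteq> 0" for u a using that by blast
    obtain a where a: "a \<in> Fq 1" "a \<noteq> 0" "chi a \<noteq> 1" using chi_nontrivial by blast
    have 1: "chi a ^ D = 1" unfolding D_def power_sum using * a by (simp add: prod.neutral)
    have 2: "chi a ^ (p - 1) = 1" unfolding p_def by (rule chi_power_CHAR[OF a(1,2)])
    have "coprime (p - 1) D" using cop by (simp only: D_def p_def coprime_commute)
    hence "gcd (p - 1) D = 1" by (rule coprime_imp_gcd_eq_1)
    moreover have "p - 1 \<noteq> 0" using p by simp
    ultimately obtain x y where xy: "(p - 1) * x = D * y + 1" using bezout_nat[of "p - 1" D] by metis
    have "chi a ^ (D * y + 1) = chi a"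
      by (simp only: power_add power_mult 1 power_one mult_1_left power_one_right)
    moreover have "chi a ^ (D * y + 1) = 1" unfolding xy[symmetric] power_mult 2 by simp
    ultimately have "chi a = 1" by (simp only:)
    thus False using a by simp
  qed
  have A0: "coeff_sum n = 0" if "n \<ge> 3" for n
  proof -
    obtain u0 a where u0: "u0 \<in> U" and a: "a \<in> Fq 1" "a \<noteq> 0" "chi a ^ e u0 \<noteq> 1" using ex by blast
    have "card U \<le> n" using card that by simp
    thus ?thesis using coeff_sum_eq_0[OF _ u0 a] by simp
  qed
  define A1 A2 where "A1 = coeff_sum 1" and "A2 = coeff_sum 2"
  \<comment> \<open>The signs come from factoring the L-function as \<open>1 + A1 * T + A2 * T^2 =
    (1 - \<alpha> * T) * (1 - \<beta> * T)\<close>.\<close>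
  define s where "s = csqrt (A1\<^sup>2 - 4 * A2)"
  define \<alpha> \<beta> where "\<alpha> = (- A1 + s) / 2" and "\<beta> = (- A1 - s) / 2"
  have s2: "s\<^sup>2 = A1\<^sup>2 - 4 * A2" unfolding s_def by simp
  have ab: "\<alpha> + \<beta> = - A1" "\<alpha> * \<beta> = A2"
    using s2 by (auto simp: \<alpha>_def \<beta>_def field_simps power2_eq_square)
  have A1: "A1 = - (\<alpha> + \<beta>)" using ab(1) by simp
  have ps: "n > 0 \<Longrightarrow> power_sum n = - (\<alpha> ^ n + \<beta> ^ n)" for n
  proof (induction n rule: less_induct)
    case (less n)
    consider "n = 1" | "n = 2" | "n \<ge> 3" using less.prems by linarith
    thus ?case
    proof cases
      case 1
      thus ?thesis using newton_identity[of 1] ab by (simp add: coeff_sum_0 A1_def)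
    next
      case 2
      have "2 * A2 = power_sum 1 * A1 + power_sum 2"
        using newton_identity[of 2] by (simp add: coeff_sum_0 A1_def A2_def numeral_2_eq_2 atLeastAtMostSuc_conv)
      moreover have "power_sum 1 = A1" using newton_identity[of 1] by (simp add: coeff_sum_0 A1_def)
      ultimately have "power_sum 2 = 2 * A2 - A1 * A1" by simp
      also have "\<dots> = - (\<alpha>\<^sup>2 + \<beta>\<^sup>2)"
        unfolding ab(2)[symmetric] A1 by (simp add: power2_eq_square algebra_simps)
      finally show ?thesis using 2 by simp
    next
      case 3
      define m where "m = n - 3"
      have n: "n = m + 3" using 3 by (simp add: m_def)
      have "0 = (\<Sum>r\<in>{1..n}. power_sum r * coeff_sum (n - r))"
        using newton_identity[of n] A0[of n] 3 by simp
      also have "\<dots> = (\<Sum>r\<in>{m+1,m+2,m+3}. power_sum r * coeff_sum (n - r))"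
        by (rule sum.mono_neutral_right) (use n A0 in \<open>auto\<close>)
      also have "\<dots> = power_sum (m+1) * A2 + power_sum (m+2) * A1 + power_sum (m+3)"
        by (simp add: n coeff_sum_0 A1_def A2_def)
      finally have "power_sum n = - (power_sum (m+1) * A2 + power_sum (m+2) * A1)"
        unfolding n eq_neg_iff_add_eq_0 by (simp add: add_ac)
      also have "\<dots> = - (\<alpha> ^ (m+3) + \<beta> ^ (m+3))"
      proof -
        have ps12: "power_sum (m+1) = - (\<alpha> ^ (m+1) + \<beta> ^ (m+1))" "power_sum (m+2) = - (\<alpha> ^ (m+2) + \<beta> ^ (m+2))"
          by (intro less.IH; simp add: n)+
        show ?thesis unfolding ps12 ab(2)[symmetric] A1
          by (simp add: power_add algebra_simps power2_eq_square power3_eq_cube)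
      qed
      finally show ?thesis by (simp add: n)
    qed
  qed
  \<comment> \<open>The size that Stepanov's bound demands of \<open>b\<close>; it is exceeded once
    \<open>n > c0\<close>, because \<open>b\<close> is at least \<open>n\<close>.\<close>
  define c0 where "c0 = (D + 2) * ((p - 1) * D + 1)"
  define K where "K = real ((p - 1) * (2 * D + 2) + D)"
  \<comment> \<open>Stepanov's bound concerns fields whose size is a square \<open>B^2\<close> with
    \<open>B = p ^ n\<close>. Hence the extensions have even degree \<open>2 * n\<close>, and the
    numbers to be located are \<open>\<alpha>^2\<close> and \<open>\<beta>^2\<close>, with
    \<open>R = p\<close>.\<close>
  have bound: "cmod ((\<alpha>\<^sup>2) ^ n + (\<beta>\<^sup>2) ^ n) \<le> K * real p ^ n" if n: "n \<ge> Suc c0" for n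
  proof -
    define b where "b = (\<Sum>j<n. p ^ j)"
    have B: "p ^ n = (p - 1) * b + 1" unfolding b_def using geometric_sum_nat[of p n] p by simp
    have "n \<le> b" unfolding b_def using sum_mono[of "{..<n}" "\<lambda>_. 1" "\<lambda>j. p ^ j"] p by simp
    hence b: "b > c0" using n by simp
    have "(p - 1) * (\<Sum>j<2*n. p ^ j) + 1 = p ^ n * p ^ n"
      using geometric_sum_nat[of p "2 * n"] p by (simp add: mult_2 power_add)
    also have "\<dots> = (p - 1) * (b * (p ^ n + 1)) + 1"
      using B by (simp add: algebra_simps)
    finally have E: "(\<Sum>j<2*n. p ^ j) = b * (p ^ n + 1)" using p by simp
    have "lam (frob_poly (2 * n) x) = chi (poly F x ^ (b * (p ^ n + 1)))" if "x \<in> Fq (2 * n)" for x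
      using lam_frob_poly[OF that] unfolding F_def[symmetric] p_def[symmetric] E .
    hence "power_sum (2 * n) = (\<Sum>x\<in>Fq (2 * n). chi (poly F x ^ (b * (p ^ n + 1))))"
      unfolding power_sum_def by (intro sum.cong refl)
    also have "cmod \<dots> \<le> real ((p - 1) * (2 * D + 2) * p ^ n + D)"
      unfolding p_def degF(1)[symmetric]
    proof (rule norm_char_sum_Fq[where \<mu> = n])
      show "CHAR('a) ^ n = (CHAR('a) - 1) * b + 1" using B by (simp add: p_def)
      show "coprime (degree F) (CHAR('a) - 1)" using cop by (simp add: degF D_def)
      show "b > (degree F + 2) * ((CHAR('a) - 1) * degree F + 1)" using b by (simp add: c0_def p_def degF)
    qed (use n degF(2) chi_0 chi_le sum_chi poly_Fq[OF fF] in auto)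
    finally have "cmod (power_sum (2 * n)) \<le> real ((p - 1) * (2 * D + 2) * p ^ n + D)" .
    also have "\<dots> \<le> K * real p ^ n"
    proof -
      have "(p - 1) * (2 * D + 2) * p ^ n + D \<le> ((p - 1) * (2 * D + 2) + D) * p ^ n"
        unfolding distrib_right using p by (intro add_left_mono) simp
      hence "real ((p - 1) * (2 * D + 2) * p ^ n + D) \<le> real (((p - 1) * (2 * D + 2) + D) * p ^ n)"
        by (rule of_nat_mono)
      thus ?thesis by (simp add: K_def)
    qed
    also have "power_sum (2 * n) = - ((\<alpha>\<^sup>2) ^ n + (\<beta>\<^sup>2) ^ n)"
      using ps[of "2 * n"] n by (simp add: power_mult)
    finally show ?thesis by (simp only: norm_minus_cancel)
  qed
  have "cmod (\<alpha>\<^sup>2) \<le> real p" "cmod (\<beta>\<^sup>2) \<le> real p"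
    using two_power_sums_bound[of "real p" "Suc c0" "\<alpha>\<^sup>2" "\<beta>\<^sup>2" K] two_power_sums_bound[of "real p" "Suc c0" "\<beta>\<^sup>2" "\<alpha>\<^sup>2" K] bound p
    by (auto simp: add.commute)
  hence "cmod \<alpha> \<le> sqrt p" "cmod \<beta> \<le> sqrt p" by (auto simp: norm_power intro!: real_le_rsqrt)
  moreover have "power_sum 1 = - (\<alpha> + \<beta>)" using ps[of 1] by simp
  hence "cmod (power_sum 1) \<le> cmod \<alpha> + cmod \<beta>"
    using norm_triangle_ineq[of \<alpha> \<beta>] by (simp only: norm_minus_cancel)
  moreover have "power_sum 1 = (\<Sum>x\<in>Fq 1. \<Prod>u\<in>U. chi (u - x) ^ e u)"
    by (simp add: power_sum_def lam_def frob_poly_def)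
  ultimately show ?thesis unfolding p_def by (simp del: One_nat_def)
qed

end

section \<open>Dirichlet characters\<close>

lemma dirichlet_character_mult: "dirichlet_character m chi \<Longrightarrow> chi (a * b) = chi a * chi b"
  by (simp add: dirichlet_character_def)

lemma dirichlet_character_cong: "dirichlet_character m chi \<Longrightarrow> [a = b] (mod int m) \<Longrightarrow> chi a = chi b"
  by (simp add: dirichlet_character_def)

lemma dirichlet_character_eq_0_iff: "dirichlet_character m chi \<Longrightarrow> chi a = 0 \<longleftrightarrow> \<not> coprime a (int m)"
  by (auto simp: dirichlet_character_def)

lemma dirichlet_character_1:
  assumes "dirichlet_character m chi"
  shows "chi 1 = 1"
proof -
  have "chi 1 * chi 1 = chi 1" using dirichlet_character_mult[OF assms, of 1 1] by simp
  moreover have "chi 1 \<noteq> 0" by (simp add: dirichlet_character_eq_0_iff[OF assms])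
  ultimately show ?thesis by simp
qed

lemma dirichlet_character_power: "dirichlet_character m chi \<Longrightarrow> chi (a ^ n) = chi a ^ n"
  by (induction n) (simp_all add: dirichlet_character_1 dirichlet_character_mult)

lemma dirichlet_character_mod: "dirichlet_character m chi \<Longrightarrow> chi (a mod int m) = chi a"
  by (rule dirichlet_character_cong) auto

lemma dirichlet_character_power_totient:
  assumes "dirichlet_character m chi" "coprime a (int m)"
  shows "chi a ^ totient m = 1"
proof -
  have m: "m > 0" using assms(1) by (simp add: dirichlet_character_def)
  define b where "b = nat (a mod int m)"
  have b: "int b = a mod int m" using m by (simp add: b_def)
  have "coprime (int b) (int m)" using assms(2) m by (simp add: b)
  hence "[b ^ totient m = 1] (mod m)" by (intro euler_theorem) simp
  hence "[int b ^ totient m = 1] (mod int m)" using cong_int_iff[of "b ^ totient m" 1 m] by simp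
  hence "chi (int b ^ totient m) = chi 1" by (rule dirichlet_character_cong[OF assms(1)])
  thus ?thesis
    using assms(1) by (simp add: dirichlet_character_power dirichlet_character_1 b dirichlet_character_mod)
qed

lemma norm_dirichlet_character:
  assumes "dirichlet_character m chi" "coprime a (int m)"
  shows "cmod (chi a) = 1"
proof -
  have "m > 0" using assms(1) by (simp add: dirichlet_character_def)
  hence "totient m > 0" by simp
  moreover have "cmod (chi a) ^ totient m = 1"
    using dirichlet_character_power_totient[OF assms] by (simp flip: norm_power)
  ultimately show ?thesis using power_eq_iff_eq_base[of "totient m" "cmod (chi a)" 1] by simp
qed

lemma norm_dirichlet_character_le: "dirichlet_character m chi \<Longrightarrow> cmod (chi a) \<le> 1"
  using norm_dirichlet_character[of m chi a] dirichlet_character_eq_0_iff[of m chi a] by force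

lemma dirichlet_character_mult_cnj:
  assumes "dirichlet_character m chi" "coprime a (int m)"
  shows "chi a * cnj (chi a) = 1"
  using norm_dirichlet_character[OF assms] by (simp add: complex_norm_square[symmetric])

section \<open>The Weil bound over the integers\<close>

text \<open>Phrased over integer residues, without any field type, so that it is a predicate of a
  number \<open>p\<close> and can be established for each \<open>p\<close> through some field of
  that characteristic.\<close>

definition weil_three_points :: "nat \<Rightarrow> bool" where
  "weil_three_points p \<longleftrightarrow> (\<forall>chi U (e :: int \<Rightarrow> nat).
     dirichlet_character p chi \<longrightarrow> (\<exists>a. coprime a (int p) \<and> chi a \<noteq> 1) \<longrightarrow>
     U \<subseteq> {0..<int p} \<longrightarrow> card U \<le> 3 \<longrightarrow> coprime (\<Sum>u\<in>U. e u) (p - 1) \<longrightarrow>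
     cmod (\<Sum>x\<in>{0..<int p}. \<Prod>u\<in>U. chi (u - x) ^ e u) \<le> 2 * sqrt p)"

lemma of_int_Fq1: "of_int k \<in> (Fq 1 :: 'a::{alg_closed_field,field_prime_char} set)"
proof -
  have nat: "of_nat n \<in> (Fq 1 :: 'a set)" for n
    by (induction n) (use Fq1_closed(1-3) in \<open>auto simp del: One_nat_def\<close>)
  show ?thesis
    by (cases k rule: int_cases2) (use nat Fq1_closed(5) in \<open>auto simp del: One_nat_def\<close>)
qed

lemma bij_betw_of_int_Fq1:
  "bij_betw of_int {0..<int CHAR('a)} (Fq 1 :: 'a::{alg_closed_field,field_prime_char} set)"
proof -
  have inj: "inj_on (of_int :: int \<Rightarrow> 'a) {0..<int CHAR('a)}"
    by (auto simp: inj_on_def of_int_eq_iff_cong_CHAR cong_def)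
  moreover have "(of_int :: int \<Rightarrow> 'a) ` {0..<int CHAR('a)} = Fq 1"
  proof (rule card_subset_eq)
    show "card ((of_int :: int \<Rightarrow> 'a) ` {0..<int CHAR('a)}) = card (Fq 1 :: 'a set)"
      using card_Fq[OF zero_less_one, where 'a='a] by (simp add: card_image[OF inj])
  qed (use of_int_Fq1 in auto)
  ultimately show ?thesis by (simp add: bij_betw_def)
qed

text \<open>Reduction of integers identifies the residues below \<open>p\<close> with the prime
  field \<open>Fq 1\<close>; the character, the points and the exponents are carried along this
  bijection.\<close>

lemma weil_three_points_CHAR: "weil_three_points CHAR('a::{alg_closed_field,field_prime_char})"
  unfolding weil_three_points_def
proof (intro allI impI)
  fix chi :: "int \<Rightarrow> complex" and U :: "int set" and e :: "int \<Rightarrow> nat"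
  define p where "p = CHAR('a)"
  assume D': "dirichlet_character CHAR('a) chi" and nt: "\<exists>a. coprime a (int CHAR('a)) \<and> chi a \<noteq> 1"
    and U': "U \<subseteq> {0..<int CHAR('a)}" and cU: "card U \<le> 3" and cop: "coprime (\<Sum>u\<in>U. e u) (CHAR('a) - 1)"
  note D = D'[folded p_def] and U = U'[folded p_def]
  have finU: "finite U" by (rule finite_subset[OF U]) simp
  have bij: "bij_betw of_int {0..<int p} (Fq 1 :: 'a set)" unfolding p_def by (rule bij_betw_of_int_Fq1)
  have eq_iff: "(of_int k :: 'a) = of_int l \<longleftrightarrow> [k = l] (mod int p)" for k l
    unfolding p_def by (rule of_int_eq_iff_cong_CHAR)
  define g :: "'a \<Rightarrow> int" where "g = inv_into {0..<int p} of_int"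
  have g: "[g (of_int k) = k] (mod int p)" for k
  proof -
    have "(of_int k :: 'a) \<in> of_int ` {0..<int p}" using bij of_int_Fq1 by (auto simp: bij_betw_def)
    from f_inv_into_f[OF this] show ?thesis unfolding eq_iff[symmetric] g_def .
  qed
  define chi' :: "'a \<Rightarrow> complex" where "chi' y = chi (g y)" for y
  have chi': "chi' (of_int k) = chi k" for k
    unfolding chi'_def by (rule dirichlet_character_cong[OF D g])
  have Fq1: "\<exists>k. y = of_int k" if "y \<in> Fq 1" for y :: 'a
    using that bij by (auto simp: bij_betw_def)
  have inj: "inj_on (of_int :: int \<Rightarrow> 'a) U" using bij U by (auto simp: bij_betw_def intro: inj_on_subset)
  define e' :: "'a \<Rightarrow> nat" where "e' v = e (inv_into U of_int v)" for v
  have e': "e' (of_int u) = e u" if "u \<in> U" for u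
    unfolding e'_def using inv_into_f_f[OF inj that] by simp
  have p: "prime p" unfolding p_def by simp
  interpret char_sum_data chi' "of_int ` U" e'
  proof
    show "chi' 0 = 0" using chi'[of 0] p dirichlet_character_eq_0_iff[OF D, of 0] by auto
    show "chi' 1 = 1" using chi'[of 1] by (simp add: dirichlet_character_1[OF D])
    show "chi' (x * y) = chi' x * chi' y" if "x \<in> Fq 1" "y \<in> Fq 1" for x y
      using Fq1[OF that(1)] Fq1[OF that(2)] chi' dirichlet_character_mult[OF D] by (metis of_int_mult)
    show "cmod (chi' x) \<le> 1" for x unfolding chi'_def by (rule norm_dirichlet_character_le[OF D])
    obtain a where a: "coprime a (int p)" "chi a \<noteq> 1" using nt unfolding p_def by blast
    have "\<not> [a = 0] (mod int p)" using a(1) p by (auto simp: cong_0_iff dest: coprime_common_divisor)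
    hence "(of_int a :: 'a) \<noteq> 0" using eq_iff[of a 0] by simp
    thus "\<exists>a\<in>Fq 1. a \<noteq> 0 \<and> chi' a \<noteq> 1" using a(2) of_int_Fq1[of a, where 'a='a] chi' by metis
    show "finite ((of_int :: int \<Rightarrow> 'a) ` U)" using finU by simp
    show "(of_int :: int \<Rightarrow> 'a) ` U \<subseteq> Fq 1" using of_int_Fq1 by blast
  qed
  have "cmod (\<Sum>x\<in>Fq 1. \<Prod>u\<in>of_int ` U. chi' (u - x) ^ e' u) \<le> 2 * sqrt CHAR('a)"
  proof (rule weil_bound_three_points)
    show "card ((of_int :: int \<Rightarrow> 'a) ` U) \<le> 3" using cU by (simp add: card_image[OF inj])
    have "(\<Sum>u\<in>(of_int :: int \<Rightarrow> 'a) ` U. e' u) = (\<Sum>u\<in>U. e u)"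
      unfolding sum.reindex[OF inj] by (simp add: e')
    thus "coprime (\<Sum>u\<in>(of_int :: int \<Rightarrow> 'a) ` U. e' u) (CHAR('a) - 1)" using cop by simp
  qed
  also have "(\<Sum>x\<in>Fq 1. \<Prod>u\<in>(of_int :: int \<Rightarrow> 'a) ` U. chi' (u - x) ^ e' u) =
      (\<Sum>x\<in>{0..<int p}. \<Prod>u\<in>(of_int :: int \<Rightarrow> 'a) ` U. chi' (u - of_int x) ^ e' u)"
    by (rule sum.reindex_bij_betw[OF bij, symmetric])
  also have "\<dots> = (\<Sum>x\<in>{0..<int p}. \<Prod>u\<in>U. chi (u - x) ^ e u)"
    unfolding prod.reindex[OF inj] using chi' by (intro sum.cong refl prod.cong) (simp_all add: e' flip: of_int_diff)
  finally show "cmod (\<Sum>x\<in>{0..<int CHAR('a)}. \<Prod>u\<in>U. chi (u - x) ^ e u) \<le> 2 * sqrt CHAR('a)"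
    by (simp add: p_def)
qed

text \<open>
  A type cannot depend on the variable \<open>p\<close>. So \<open>weil_three_points_CHAR\<close> is applied to one fixed
  prime, chosen to be a counterexample if there is any; this prime is a constant and
  can be turned into a type.
\<close>

definition test_prime :: nat where
  "test_prime = (if \<exists>p. prime p \<and> \<not> weil_three_points p then SOME p. prime p \<and> \<not> weil_three_points p else 2)"

lemma prime_test_prime: "prime test_prime"
  unfolding test_prime_def using someI_ex[of "\<lambda>p. prime p \<and> \<not> weil_three_points p"] by auto

typedef test_residues = "{..<test_prime}"
  using prime_gt_0_nat[OF prime_test_prime] by (metis lessThan_iff)

instance test_residues :: prime_card
proof
  interpret type_definition Rep_test_residues Abs_test_residues "{..<test_prime}"
    by (rule type_definition_test_residues)
  show "prime CARD(test_residues)" using card prime_test_prime by simp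
qed

lemma CARD_test_residues: "CARD(test_residues) = test_prime"
proof -
  interpret type_definition Rep_test_residues Abs_test_residues "{..<test_prime}"
    by (rule type_definition_test_residues)
  show ?thesis using card by simp
qed

instance alg_closure :: (field_prime_char) field_prime_char
  by (rule field_prime_charI') simp

theorem weil_three_points_prime:
  assumes "prime p"
  shows "weil_three_points p"
proof (rule ccontr)
  assume "\<not> weil_three_points p"
  hence "\<exists>p. prime p \<and> \<not> weil_three_points p" using assms by blast
  hence "\<not> weil_three_points test_prime"
    unfolding test_prime_def using someI_ex[of "\<lambda>p. prime p \<and> \<not> weil_three_points p"] by auto
  moreover have "CHAR(test_residues mod_ring alg_closure) = test_prime"
    by (simp add: CARD_test_residues)
  ultimately show False using weil_three_points_CHAR[where 'a = "test_residues mod_ring alg_closure"] by simp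
qed

section \<open>Fourth moments of short character sums\<close>

lemma sum_residues_shift:
  fixes f :: "int \<Rightarrow> 'b::comm_monoid_add"
  assumes "m > 0" "\<And>a b. [a = b] (mod m) \<Longrightarrow> f a = f b"
  shows "(\<Sum>x\<in>{0..<m}. f (x + c)) = (\<Sum>x\<in>{0..<m}. f x)"
proof (rule sum.reindex_bij_witness[of _ "\<lambda>x. (x - c) mod m" "\<lambda>x. (x + c) mod m"])
  show "f ((x + c) mod m) = f (x + c)" for x by (rule assms(2)) auto
qed (use assms(1) in \<open>auto simp: mod_simps\<close>)

lemma sum_residues_mult:
  fixes f g :: "int \<Rightarrow> complex"
  assumes "p > 0" "q > 0" "coprime p q"
    and f: "\<And>a b. [a = b] (mod p) \<Longrightarrow> f a = f b" and g: "\<And>a b. [a = b] (mod q) \<Longrightarrow> g a = g b"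
  shows "(\<Sum>x\<in>{0..<p * q}. f x * g x) = (\<Sum>x\<in>{0..<p}. f x) * (\<Sum>x\<in>{0..<q}. g x)"
proof -
  define h where "h x = (x mod p, x mod q)" for x
  have inj: "inj_on h {0..<p * q}"
  proof (rule inj_onI)
    fix x y assume xy: "x \<in> {0..<p * q}" "y \<in> {0..<p * q}" "h x = h y"
    hence "[x = y] (mod p * q)"
      using coprime_cong_mult[OF _ _ assms(3), of x y] by (simp add: h_def cong_def)
    thus "x = y" using xy by (simp add: cong_def)
  qed
  have "h ` {0..<p * q} = {0..<p} \<times> {0..<q}"
  proof (rule card_subset_eq)
    show "h ` {0..<p * q} \<subseteq> {0..<p} \<times> {0..<q}" using assms by (auto simp: h_def)
    show "card (h ` {0..<p * q}) = card ({0..<p} \<times> {0..<q})"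
      using assms by (simp add: card_image[OF inj] card_cartesian_product nat_mult_distrib)
  qed simp
  hence bij: "bij_betw h {0..<p * q} ({0..<p} \<times> {0..<q})" using inj by (simp add: bij_betw_def)
  have "(\<Sum>x\<in>{0..<p}. f x) * (\<Sum>x\<in>{0..<q}. g x) = (\<Sum>z\<in>{0..<p} \<times> {0..<q}. f (fst z) * g (snd z))"
    by (simp add: sum_product sum.cartesian_product case_prod_unfold)
  also have "\<dots> = (\<Sum>x\<in>{0..<p * q}. f (fst (h x)) * g (snd (h x)))"
    by (rule sum.reindex_bij_betw[OF bij, symmetric])
  also have "\<dots> = (\<Sum>x\<in>{0..<p * q}. f x * g x)"
  proof (rule sum.cong[OF refl])
    show "f (fst (h x)) * g (snd (h x)) = f x * g x" for x
      using f[of "x mod p" x] g[of "x mod q" x] by (simp add: h_def)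
  qed
  finally show ?thesis by simp
qed

text \<open>The complete sum that belongs to one quadruple of shifts when the fourth power of a
  short sum is expanded.\<close>

definition quad_sum :: "nat \<Rightarrow> (int \<Rightarrow> complex) \<Rightarrow> int \<Rightarrow> int \<Rightarrow> int \<Rightarrow> int \<Rightarrow> complex" where
  "quad_sum m chi a b c d =
    (\<Sum>x\<in>{0..<int m}. chi (x + a) * chi (x + b) * cnj (chi (x + c)) * cnj (chi (x + d)))"

text \<open>On units conjugation is inversion and the power \<open>p - 1\<close> is trivial; for
  \<open>p > 2\<close> the exponent \<open>p - 2\<close> is positive, so the zero values agree as
  well. Conjugates thus become exponents in the three-point bound.\<close>

lemma cnj_dirichlet_character_prime:
  assumes D: "dirichlet_character p chi" and p: "prime p" "p > 2"
  shows "cnj (chi a) = chi a ^ (p - 2)"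
proof (cases "coprime a (int p)")
  case True
  have "p - 1 = Suc (p - 2)" using p by simp
  hence "chi a * chi a ^ (p - 2) = chi a ^ (p - 1)" by simp
  also have "\<dots> = 1" using dirichlet_character_power_totient[OF D True] p by (simp add: totient_prime)
  also have "\<dots> = chi a * cnj (chi a)" by (simp add: dirichlet_character_mult_cnj[OF D True])
  finally show ?thesis using dirichlet_character_eq_0_iff[OF D, of a] True by simp
next
  case False
  thus ?thesis using dirichlet_character_eq_0_iff[OF D, of a] p by simp
qed

lemma neg_inverse_mod_prime:
  assumes p: "prime p" and t: "\<not> int p dvd t"
  shows "[t * (- (t ^ (p - 2))) = - 1] (mod int p)"
proof (cases "p = 2")
  case False
  hence p2: "p > 2" using prime_ge_2_nat[OF p] by simp
  have "[(nat (t mod int p)) ^ (p - 1) = 1] (mod p)"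
  proof (rule fermat_theorem[OF p])
    show "\<not> p dvd nat (t mod int p)"
      using t p by (metis dvd_mod_iff dvd_refl int_dvd_int_iff int_nat_eq pos_mod_sign of_nat_0_less_iff prime_gt_0_nat)
  qed
  hence "[int (nat (t mod int p)) ^ (p - 1) = 1] (mod int p)" using cong_int_iff[of "nat (t mod int p) ^ (p - 1)" 1 p] by simp
  moreover have "int (nat (t mod int p)) = t mod int p" using p prime_gt_0_nat by simp
  ultimately have "[t ^ (p - 1) = 1] (mod int p)" by (simp add: cong_def power_mod)
  hence "[- (t ^ (p - 1)) = - 1] (mod int p)" by (simp add: cong_minus_minus_iff)
  moreover have "p - 1 = Suc (p - 2)" using p2 by simp
  hence "t * t ^ (p - 2) = t ^ (p - 1)" by simp
  ultimately show ?thesis by simp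
next
  case True
  thus ?thesis using t by (simp add: cong_def) presburger
qed

text \<open>The inversion \<open>x + a = - 1 / t\<close> sends the point \<open>- a\<close> to infinity.\<close>

lemma quad_sum_prime_bound:
  assumes p: "prime p" and D: "dirichlet_character p chi" and nt: "\<exists>a. coprime a (int p) \<and> chi a \<noteq> 1"
    and ab: "\<not> [a = b] (mod int p)" and ac: "\<not> [a = c] (mod int p)" and ad: "\<not> [a = d] (mod int p)"
  shows "cmod (quad_sum p chi a b c d) \<le> 3 * sqrt p"
proof -
  have cop_iff: "coprime k (int p) \<longleftrightarrow> \<not> int p dvd k" for k
    using p by (metis coprime_commute prime_imp_coprime_int prime_nat_int_transfer coprime_absorb_left not_prime_unit)
  have p2: "p > 2"
  proof (rule ccontr)
    assume "\<not> p > 2"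
    hence "p = 2" using prime_ge_2_nat[OF p] by simp
    obtain a where a: "coprime a (int p)" "chi a \<noteq> 1" using nt by blast
    have "[a = 1] (mod int p)" using a(1) \<open>p = 2\<close> by (simp add: cop_iff cong_def) presburger
    hence "chi a = 1" using dirichlet_character_cong[OF D] dirichlet_character_1[OF D] by metis
    thus False using a by simp
  qed
  have p0: "int p > 0" using p2 by simp
  note mult = dirichlet_character_mult[OF D] and cong = dirichlet_character_cong[OF D]
  \<comment> \<open>By Fermat this is \<open>- 1 / t\<close> modulo \<open>p\<close>, an involution
    of the nonzero residues.\<close>
  define y where "y t = (- (t ^ (p - 2))) mod int p" for t
  have ty: "[t * y t = - 1] (mod int p)" if "\<not> int p dvd t" for t
    using neg_inverse_mod_prime[OF p that] unfolding y_def cong_def by (simp add: mod_mult_right_eq)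
  have y_range: "y t \<in> {1..<int p}" if "t \<in> {1..<int p}" for t
  proof -
    have t: "\<not> int p dvd t" using that zdvd_not_zless by auto
    have "y t \<noteq> 0" using ty[OF t] p2 by (auto simp: cong_def zmod_minus1)
    moreover have "0 \<le> y t" "y t < int p" using p0 by (auto simp: y_def)
    ultimately show ?thesis by auto
  qed
  have y_invol: "y (y t) = t" if "t \<in> {1..<int p}" for t
  proof -
    have t: "\<not> int p dvd t" "\<not> int p dvd y t" using that y_range[OF that] zdvd_not_zless by auto
    have "[y t * y (y t) = y t * t] (mod int p)"
      using ty[OF t(1)] ty[OF t(2)] by (metis cong_sym cong_trans mult.commute)
    hence "[y (y t) = t] (mod int p)" using cong_mult_lcancel[of "y t" "int p"] cop_iff t(2) by blast
    thus ?thesis using that y_range[OF y_range[OF that]] by (simp add: cong_def)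
  qed
  \<comment> \<open>The summand after a translation that moves the first point to 0.\<close>
  define F where "F x = chi x * chi (x + (b - a)) * cnj (chi (x + (c - a))) * cnj (chi (x + (d - a)))" for x
  have F_cong: "F x = F x'" if "[x = x'] (mod int p)" for x x'
  proof -
    have "chi (x + k) = chi (x' + k)" for k using that by (intro cong) (simp add: cong_add_rcancel)
    from this[of 0] this[of "b - a"] this[of "c - a"] this[of "d - a"] show ?thesis by (simp add: F_def)
  qed
  have "quad_sum p chi a b c d = (\<Sum>x\<in>{0..<int p}. F (x + a))"
    by (simp add: quad_sum_def F_def)
  also have "\<dots> = (\<Sum>x\<in>{0..<int p}. F x)" by (rule sum_residues_shift[OF p0 F_cong])
  also have "\<dots> = (\<Sum>x\<in>{1..<int p}. F x)"
  proof (rule sum.mono_neutral_right)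
    have "F 0 = 0" using dirichlet_character_eq_0_iff[OF D, of 0] p2 by (simp add: F_def)
    thus "\<forall>x\<in>{0..<int p} - {1..<int p}. F x = 0" by (auto simp: not_le) (metis F_def less_one linorder_neqE_linordered_idom not_less zless_imp_add1_zle add_0)
  qed auto
  also have "\<dots> = (\<Sum>t\<in>{1..<int p}. F (y t))"
    by (rule sum.reindex_bij_witness[of _ y y]) (use y_range y_invol in auto)
  finally have quad: "quad_sum p chi a b c d = (\<Sum>t\<in>{1..<int p}. F (y t))" .
  \<comment> \<open>\<open>u k\<close> is \<open>1 / (k - a)\<close>, the image of the point
    \<open>- k\<close> under the inversion:
    \<open>t * (- 1 / t + (k - a)) = - (k - a) * (u k - t)\<close>.\<close>
  define u where "u k = (- y (k - a)) mod int p" for k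
  have u: "[(k - a) * u k = 1] (mod int p)" if "\<not> [a = k] (mod int p)" for k
  proof -
    have "\<not> int p dvd k - a" using that by (metis cong_iff_dvd_diff cong_sym)
    from ty[OF this] have "[- ((k - a) * y (k - a)) = - (- 1)] (mod int p)" by (simp only: cong_minus_minus_iff)
    thus ?thesis unfolding u_def cong_def by (simp add: mod_mult_right_eq)
  qed
  have factor: "chi t * chi (y t + (k - a)) = chi (- (k - a)) * chi (u k - t)"
    if t: "t \<in> {1..<int p}" and k: "\<not> [a = k] (mod int p)" for t k
  proof -
    have "\<not> int p dvd t" using t zdvd_not_zless by auto
    from cong_add[OF ty[OF this] cong_refl, of "t * (k - a)"]
    have "[t * (y t + (k - a)) = - 1 + t * (k - a)] (mod int p)" by (simp add: distrib_left)
    also have "[- 1 + t * (k - a) = - ((k - a) * u k) + t * (k - a)] (mod int p)"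
      using u[OF k] by (intro cong_add cong_refl) (simp add: cong_minus_minus_iff cong_sym)
    also have "- ((k - a) * u k) + t * (k - a) = - (k - a) * (u k - t)" by (simp add: algebra_simps)
    finally show ?thesis unfolding mult[symmetric] by (rule cong)
  qed
  define K where "K = chi (- 1) * chi (- (b - a)) * cnj (chi (- (c - a))) * cnj (chi (- (d - a)))"
  define G where "G t = chi (u b - t) * cnj (chi (u c - t)) * cnj (chi (u d - t))" for t
  have FG: "F (y t) = K * G t" if t: "t \<in> {1..<int p}" for t
  proof -
    have t': "\<not> int p dvd t" using t zdvd_not_zless by auto
    have one: "chi t * cnj (chi t) = 1" by (rule dirichlet_character_mult_cnj[OF D]) (simp add: cop_iff t')
    have m1: "chi t * chi (y t) = chi (- 1)" unfolding mult[symmetric] by (rule cong[OF ty[OF t']])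
    \<comment> \<open>Two plain and two conjugated factors each absorb one \<open>chi t\<close> or
      \<open>cnj (chi t)\<close>, so clearing the denominators \<open>t\<close> costs
      nothing.\<close>
    have "F (y t) = F (y t) * (chi t * cnj (chi t)) * (chi t * cnj (chi t))" by (simp add: one)
    also have "\<dots> = (chi t * chi (y t)) * (chi t * chi (y t + (b - a))) * cnj (chi t * chi (y t + (c - a))) * cnj (chi t * chi (y t + (d - a)))"
      unfolding F_def by (simp add: algebra_simps)
    also have "\<dots> = K * G t"
      unfolding m1 factor[OF t ab] factor[OF t ac] factor[OF t ad] K_def G_def by (simp add: algebra_simps)
    finally show ?thesis .
  qed
  have norms: "cmod (chi k) \<le> 1" for k by (rule norm_dirichlet_character_le[OF D])
  have K: "cmod K \<le> 1"
    unfolding K_def norm_mult complex_mod_cnj by (intro mult_le_one norms norm_ge_zero mult_nonneg_nonneg)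
  have G: "cmod (G t) \<le> 1" for t
    unfolding G_def norm_mult complex_mod_cnj by (intro mult_le_one norms norm_ge_zero mult_nonneg_nonneg)
  define U where "U = {u b, u c, u d}"
  \<comment> \<open>Two or all three of \<open>u b\<close>, \<open>u c\<close>, \<open>u d\<close>
    may coincide; then the set \<open>U\<close> shrinks and the exponents at a common point add
    up.\<close>
  define e where "e v = (if v = u b then 1 else 0) + (if v = u c then p - 2 else 0) + (if v = u d then p - 2 else 0)" for v
  have prodU: "(\<Prod>v\<in>U. z v ^ (if v = u k then n else 0)) = z (u k) ^ n" if "u k \<in> U" for z :: "int \<Rightarrow> complex" and k n
  proof -
    have "(\<Prod>v\<in>U. z v ^ (if v = u k then n else 0)) = (\<Prod>v\<in>U. if v = u k then z v ^ n else 1)"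
      by (intro prod.cong) auto
    also have "\<dots> = z (u k) ^ n" using that by (simp add: U_def)
    finally show ?thesis .
  qed
  have GU: "G t = (\<Prod>v\<in>U. chi (v - t) ^ e v)" for t
    unfolding e_def power_add prod.distrib G_def cnj_dirichlet_character_prime[OF D p p2]
    by (subst (1 2 3) prodU) (auto simp: U_def)
  \<comment> \<open>The total is one less than a multiple of \<open>p - 1\<close>, hence coprime to
    it.\<close>
  have "(\<Sum>v\<in>U. e v) = 1 + 2 * (p - 2)"
    unfolding e_def sum.distrib by (simp add: U_def)
  also have "\<dots> + 1 = 2 * (p - 1)" using p2 by simp
  finally have e: "(\<Sum>v\<in>U. e v) + 1 = 2 * (p - 1)" by simp
  have cop: "coprime (\<Sum>v\<in>U. e v) (p - 1)"
  proof (rule coprimeI)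
    fix k assume k: "k dvd (\<Sum>v\<in>U. e v)" "k dvd p - 1"
    hence "k dvd (\<Sum>v\<in>U. e v) + 1" unfolding e by simp
    thus "is_unit k" using dvd_add_right_iff[OF k(1), of 1] by blast
  qed
  have "cmod (\<Sum>t\<in>{0..<int p}. G t) \<le> 2 * sqrt p"
    unfolding GU using weil_three_points_prime[OF p, unfolded weil_three_points_def, rule_format, OF D nt _ _ cop] p0
    by (auto simp: U_def u_def card_insert_if)
  \<comment> \<open>The residue \<open>t = 0\<close> corresponds to the point at infinity; removing
    it costs at most \<open>1 \<le> sqrt p\<close>, which turns the constant 2 into 3.\<close>
  moreover have "(\<Sum>t\<in>{0..<int p}. G t) = G 0 + (\<Sum>t\<in>{1..<int p}. G t)"
  proof -
    have "{0..<int p} = insert 0 {1..<int p}" using p0 by auto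
    thus ?thesis by simp
  qed
  ultimately have "cmod (\<Sum>t\<in>{1..<int p}. G t) \<le> 2 * sqrt p + 1"
    using G[of 0] norm_triangle_ineq4[of "\<Sum>t\<in>{0..<int p}. G t" "G 0"] by simp
  moreover have "quad_sum p chi a b c d = K * (\<Sum>t\<in>{1..<int p}. G t)"
    unfolding quad using FG by (simp add: sum_distrib_left)
  hence "cmod (quad_sum p chi a b c d) \<le> 1 * cmod (\<Sum>t\<in>{1..<int p}. G t)"
    using K by (simp only: norm_mult mult_right_mono norm_ge_zero)
  moreover have "1 \<le> sqrt p" using p2 by simp
  ultimately show ?thesis by linarith
qed

section \<open>Splitting primitive characters and four-point sums over the primes of the
  modulus\<close>

lemma primitive_character_nontrivial:
  assumes "primitive_character m chi" "m > 1"
  shows "\<exists>a. coprime a (int m) \<and> chi a \<noteq> 1"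
proof (rule ccontr)
  assume "\<not> ?thesis"
  hence "induced_by m chi (\<lambda>_. 1)" by (auto simp: induced_by_def)
  moreover have "dirichlet_character 1 (\<lambda>_. 1)" by (simp add: dirichlet_character_def)
  ultimately show False using assms unfolding primitive_character_def by (metis one_dvd)
qed

text \<open>\<open>e1\<close> and \<open>e2\<close> are the idempotents of the Chinese remainder
  theorem: \<open>x * e1 + e2\<close> is \<open>x\<close> modulo \<open>p\<close> and 1 modulo
  \<open>q\<close>, so evaluating \<open>chi\<close> there isolates its component at
  \<open>p\<close>.\<close>

lemma dirichlet_character_component:
  assumes D: "dirichlet_character (p * q) chi" and pq: "p > 0" "coprime p q"
    and e1: "[e1 = 1] (mod int p)" "[e1 = 0] (mod int q)" and e2: "[e2 = 0] (mod int p)" "[e2 = 1] (mod int q)"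
  shows "dirichlet_character p (\<lambda>x. chi (x * e1 + e2))"
proof -
  have p: "[x * e1 + e2 = x] (mod int p)" for x
    using cong_add[OF cong_mult[OF cong_refl[of x] e1(1)] e2(1)] by simp
  have q: "[x * e1 + e2 = 1] (mod int q)" for x
    using cong_add[OF cong_mult[OF cong_refl[of x] e1(2)] e2(2)] by simp
  have cop: "coprime (int p) (int q)" using pq by simp
  have chi_eq: "chi x = chi y" if "[x = y] (mod int p)" "[x = y] (mod int q)" for x y
    using coprime_cong_mult[OF that cop] dirichlet_character_cong[OF D, of x y] by simp
  show ?thesis
    unfolding dirichlet_character_def
  proof (intro conjI allI impI)
    fix a b
    have "chi (a * b * e1 + e2) = chi ((a * e1 + e2) * (b * e1 + e2))"
    proof (rule chi_eq)
      show "[a * b * e1 + e2 = (a * e1 + e2) * (b * e1 + e2)] (mod int p)"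
        using p[of "a * b"] cong_mult[OF p[of a] p[of b]] by (metis cong_sym cong_trans)
      show "[a * b * e1 + e2 = (a * e1 + e2) * (b * e1 + e2)] (mod int q)"
        using q[of "a * b"] cong_mult[OF q[of a] q[of b]] by (metis cong_sym cong_trans mult_1)
    qed
    thus "chi (a * b * e1 + e2) = chi (a * e1 + e2) * chi (b * e1 + e2)"
      by (simp add: dirichlet_character_mult[OF D])
  next
    fix a b assume "[a = b] (mod int p)"
    thus "chi (a * e1 + e2) = chi (b * e1 + e2)"
      using p[of a] p[of b] q[of a] q[of b] by (intro chi_eq) (metis cong_sym cong_trans)+
  next
    fix a
    have "coprime (a * e1 + e2) (int p) \<longleftrightarrow> coprime a (int p)"
      using p[of a] by (metis cong_imp_coprime cong_sym)
    moreover have "coprime (a * e1 + e2) (int q)"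
      using q[of a] by (metis cong_imp_coprime cong_sym coprime_1_left)
    ultimately show "(chi (a * e1 + e2) \<noteq> 0) = coprime a (int p)"
      using dirichlet_character_eq_0_iff[OF D, of "a * e1 + e2"] by simp
  qed (use pq in simp)
qed

text \<open>If one component were trivial, \<open>chi\<close> would be induced by the other one,
  whose modulus is a proper divisor; primitivity excludes this.\<close>

lemma primitive_character_factor:
  assumes P: "primitive_character (p * q) chi" and pq: "p > 1" "q > 1" "coprime p q"
  obtains chi1 chi2 where "dirichlet_character p chi1" "dirichlet_character q chi2" "\<And>x. chi x = chi1 x * chi2 x"
    "\<exists>a. coprime a (int p) \<and> chi1 a \<noteq> 1" "\<exists>a. coprime a (int q) \<and> chi2 a \<noteq> 1"
proof -
  have D: "dirichlet_character (p * q) chi" using P by (simp add: primitive_character_def)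
  have cop: "coprime (int p) (int q)" using pq by simp
  obtain u v where u: "[int q * u = 1] (mod int p)" and v: "[int p * v = 1] (mod int q)"
    using cong_solve_coprime_int[of "int q" "int p"] cong_solve_coprime_int[of "int p" "int q"] cop
    by (auto simp: coprime_commute)
  define e1 e2 where "e1 = int q * u" and "e2 = int p * v"
  have e: "[e1 = 1] (mod int p)" "[e1 = 0] (mod int q)" "[e2 = 0] (mod int p)" "[e2 = 1] (mod int q)"
    using u v by (simp_all add: e1_def e2_def cong_0_iff)
  define chi1 chi2 where "chi1 x = chi (x * e1 + e2)" and "chi2 x = chi (x * e2 + e1)" for x
  have D1: "dirichlet_character p chi1" unfolding chi1_def
    using dirichlet_character_component[OF D _ _ e(1,2,3,4)] pq by simp
  have D2: "dirichlet_character q chi2" unfolding chi2_def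
    using dirichlet_character_component[of q p chi e2 e1] D e pq by (simp add: mult.commute coprime_commute)
  have prod: "chi x = chi1 x * chi2 x" for x
  proof -
    have p: "[x * e1 + e2 = x] (mod int p)" "[x * e2 + e1 = 1] (mod int p)"
      using cong_add[OF cong_mult[OF cong_refl[of x] e(1)] e(3)] cong_add[OF cong_mult[OF cong_refl[of x] e(3)] e(1)] by simp_all
    have q: "[x * e1 + e2 = 1] (mod int q)" "[x * e2 + e1 = x] (mod int q)"
      using cong_add[OF cong_mult[OF cong_refl[of x] e(2)] e(4)] cong_add[OF cong_mult[OF cong_refl[of x] e(4)] e(2)] by simp_all
    have "[(x * e1 + e2) * (x * e2 + e1) = x] (mod int p * int q)"
      using cong_mult[OF p] cong_mult[OF q] by (intro coprime_cong_mult cop) simp_all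
    hence "chi ((x * e1 + e2) * (x * e2 + e1)) = chi x" by (intro dirichlet_character_cong[OF D]) simp
    thus ?thesis by (simp add: chi1_def chi2_def dirichlet_character_mult[OF D])
  qed
  have nt1: "\<exists>a. coprime a (int p) \<and> chi1 a \<noteq> 1"
  proof (rule ccontr)
    assume "\<not> ?thesis"
    hence "induced_by (p * q) chi chi2" using prod by (auto simp: induced_by_def)
    moreover have "q dvd p * q" "q < p * q" using pq by auto
    ultimately show False using P D2 unfolding primitive_character_def by blast
  qed
  have nt2: "\<exists>a. coprime a (int q) \<and> chi2 a \<noteq> 1"
  proof (rule ccontr)
    assume "\<not> ?thesis"
    hence "induced_by (p * q) chi chi1" using prod by (auto simp: induced_by_def)
    moreover have "p dvd p * q" "p < p * q" using pq by auto
    ultimately show False using P D1 unfolding primitive_character_def by blast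
  qed
  show ?thesis by (rule that[OF D1 D2 prod nt1 nt2])
qed

lemma quad_sum_mult:
  assumes "dirichlet_character p chi1" "dirichlet_character q chi2" "coprime p q" "\<And>x. chi x = chi1 x * chi2 x"
  shows "quad_sum (p * q) chi a b c d = quad_sum p chi1 a b c d * quad_sum q chi2 a b c d"
proof -
  define f where "f chi x = chi (x + a) * chi (x + b) * cnj (chi (x + c)) * cnj (chi (x + d))" for chi :: "int \<Rightarrow> complex" and x
  have f_cong: "f chi x = f chi y" if "dirichlet_character n chi" "[x = y] (mod int n)" for n chi x y
  proof -
    have "chi (x + k) = chi (y + k)" for k
      using that(2) by (intro dirichlet_character_cong[OF that(1)]) (simp add: cong_add_rcancel)
    from this[of a] this[of b] this[of c] this[of d] show ?thesis by (simp add: f_def)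
  qed
  have pos: "int p > 0" "int q > 0" using assms by (auto simp: dirichlet_character_def)
  have "quad_sum (p * q) chi a b c d = (\<Sum>x\<in>{0..<int p * int q}. f chi1 x * f chi2 x)"
    unfolding quad_sum_def by (intro sum.cong) (auto simp: f_def assms(4) algebra_simps)
  also have "\<dots> = (\<Sum>x\<in>{0..<int p}. f chi1 x) * (\<Sum>x\<in>{0..<int q}. f chi2 x)"
    using assms f_cong by (intro sum_residues_mult pos) auto
  finally show ?thesis by (simp add: quad_sum_def f_def)
qed

text \<open>Each prime factor \<open>r\<close> contributes \<open>3 * sqrt r\<close>, and there are
  at most two of them.\<close>

lemma quad_sum_coarse_bound:
  assumes m: "coarse m" "primitive_character m chi"
    and neq: "\<And>r. prime r \<Longrightarrow> r dvd m \<Longrightarrow> \<not> [a = b] (mod int r) \<and> \<not> [a = c] (mod int r) \<and> \<not> [a = d] (mod int r)"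
  shows "cmod (quad_sum m chi a b c d) \<le> 9 * sqrt m"
proof (cases "prime m")
  case True
  have "cmod (quad_sum m chi a b c d) \<le> 3 * sqrt m"
    using m True neq[OF True] primitive_character_nontrivial[OF m(2)] prime_gt_1_nat[OF True]
    by (intro quad_sum_prime_bound) (auto simp: primitive_character_def)
  moreover have "0 \<le> sqrt m" by simp
  ultimately show ?thesis by linarith
next
  case False
  then obtain p q where pq: "prime p" "prime q" "p \<noteq> q" "m = p * q" using m(1) by (auto simp: coarse_def)
  have cop: "coprime p q" using pq by (simp add: primes_coprime)
  obtain chi1 chi2 where chi: "dirichlet_character p chi1" "dirichlet_character q chi2" "\<And>x. chi x = chi1 x * chi2 x"
    "\<exists>a. coprime a (int p) \<and> chi1 a \<noteq> 1" "\<exists>a. coprime a (int q) \<and> chi2 a \<noteq> 1"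
    using primitive_character_factor[of p q chi] m(2) pq prime_gt_1_nat cop by metis
  have "cmod (quad_sum p chi1 a b c d) \<le> 3 * sqrt p" "cmod (quad_sum q chi2 a b c d) \<le> 3 * sqrt q"
    using neq[of p] neq[of q] pq chi by (auto intro!: quad_sum_prime_bound)
  hence "cmod (quad_sum p chi1 a b c d) * cmod (quad_sum q chi2 a b c d) \<le> (3 * sqrt p) * (3 * sqrt q)"
    by (intro mult_mono) auto
  thus ?thesis
    unfolding pq(4) quad_sum_mult[OF chi(1,2) cop chi(3)] norm_mult by (simp add: real_sqrt_mult)
qed

lemma quad_sum_commute: "quad_sum m chi a b c d = quad_sum m chi b a c d"
  by (simp add: quad_sum_def mult.commute)

lemma quad_sum_cnj: "quad_sum m chi a b c d = cnj (quad_sum m chi c d a b)"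
  unfolding quad_sum_def cnj_sum by (intro sum.cong) (auto simp: algebra_simps)

lemma quad_sum_trivial_bound:
  assumes "dirichlet_character m chi"
  shows "cmod (quad_sum m chi a b c d) \<le> m"
proof -
  have "cmod (quad_sum m chi a b c d) \<le> (\<Sum>x\<in>{0..<int m}. 1)"
    unfolding quad_sum_def
  proof (rule sum_norm_le)
    show "cmod (chi (x + a) * chi (x + b) * cnj (chi (x + c)) * cnj (chi (x + d))) \<le> 1" for x
      unfolding norm_mult complex_mod_cnj
      by (intro mult_le_one norm_dirichlet_character_le[OF assms] norm_ge_zero mult_nonneg_nonneg)
  qed
  thus ?thesis by simp
qed

text \<open>Unless the four entries fall into two equal pairs, one of them differs from the other
  three, and the symmetries of the sum bring it to the first place. The pairing
  \<open>a = b\<close>, \<open>c = d\<close> is excluded too, because for real characters it gives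
  no cancellation. Distinct shifts up to \<open>H \<le> r\<close> remain incongruent modulo
  \<open>r\<close>.\<close>

lemma quad_sum_off_diagonal_bound:
  assumes m: "coarse m" "primitive_character m chi"
    and H: "\<And>r. prime r \<Longrightarrow> r dvd m \<Longrightarrow> H \<le> r"
    and abcd: "a \<in> {1..int H}" "b \<in> {1..int H}" "c \<in> {1..int H}" "d \<in> {1..int H}"
    and off: "\<not> (a = c \<and> b = d \<or> a = d \<and> b = c \<or> a = b \<and> c = d)"
  shows "cmod (quad_sum m chi a b c d) \<le> 9 * sqrt m"
proof -
  have neq: "\<not> [x = y] (mod int r)" if "prime r" "r dvd m" "x \<in> {1..int H}" "y \<in> {1..int H}" "x \<noteq> y" for r x y
  proof
    assume "[x = y] (mod int r)"
    hence "int r dvd x - y" by (simp add: cong_iff_dvd_diff)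
    hence "int r \<le> \<bar>x - y\<bar>" using that(5) dvd_imp_le_int[of "x - y" "int r"] by simp
    thus False using H[OF that(1,2)] that(3,4) by auto
  qed
  have *: "cmod (quad_sum m chi x y z w) \<le> 9 * sqrt m"
    if "x \<in> {1..int H}" "y \<in> {1..int H}" "z \<in> {1..int H}" "w \<in> {1..int H}" "x \<noteq> y" "x \<noteq> z" "x \<noteq> w" for x y z w
    using that neq by (intro quad_sum_coarse_bound[OF m]) blast
  consider "a \<noteq> b" "a \<noteq> c" "a \<noteq> d" | "b \<noteq> a" "b \<noteq> c" "b \<noteq> d" | "c \<noteq> d" "c \<noteq> a" "c \<noteq> b" | "d \<noteq> c" "d \<noteq> a" "d \<noteq> b"
    using off by metis
  thus ?thesis
  proof cases
    case 1 thus ?thesis using *[of a b c d] abcd by simp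
  next
    case 2 thus ?thesis using *[of b a c d] abcd by (simp add: quad_sum_commute[of m chi a])
  next
    case 3 thus ?thesis using *[of c d a b] abcd by (simp add: quad_sum_cnj[of m chi a])
  next
    case 4 thus ?thesis using *[of d c a b] abcd by (simp add: quad_sum_cnj[of m chi a] quad_sum_commute[of m chi c])
  qed
qed

text \<open>Of the \<open>H ^ 4\<close> quadruples at most \<open>3 * H ^ 2\<close> follow one of
  the three pairing patterns and are bounded trivially by \<open>m\<close>; all others have square
  root cancellation.\<close>

lemma fourth_moment_bound:
  assumes m: "coarse m" "primitive_character m chi"
    and H: "\<And>r. prime r \<Longrightarrow> r dvd m \<Longrightarrow> H \<le> r"
  shows "(\<Sum>x\<in>{0..<int m}. cmod (\<Sum>b\<in>{1..int H}. chi (x + b)) ^ 4) \<le> 3 * real H ^ 2 * real m + 9 * real H ^ 4 * sqrt m"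
proof -
  define I where "I = {1..int H}"
  define J where "J = I \<times> I \<times> I \<times> I"
  define Q where "Q = {(a,b,c,d)\<in>J. a = c \<and> b = d \<or> a = d \<and> b = c \<or> a = b \<and> c = d}"
  define W where "W x = (\<Sum>b\<in>I. chi (x + b))" for x
  have D: "dirichlet_character m chi" using m by (simp add: primitive_character_def)
  have fin: "finite I" "finite J" by (simp_all add: I_def J_def)
  have cardI: "card I = H" by (simp add: I_def)
  have W4: "complex_of_real (cmod (W x) ^ 4) = (\<Sum>(a,b,c,d)\<in>J. chi (x + a) * chi (x + b) * cnj (chi (x + c)) * cnj (chi (x + d)))" for x
  proof -
    have "complex_of_real (cmod (W x) ^ 4) = (complex_of_real ((cmod (W x))\<^sup>2))\<^sup>2"
      by simp
    also have "\<dots> = W x * (W x * (cnj (W x) * cnj (W x)))"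
      unfolding complex_norm_square by (simp add: power2_eq_square algebra_simps)
    also have "\<dots> = (\<Sum>a\<in>I. \<Sum>b\<in>I. \<Sum>c\<in>I. \<Sum>d\<in>I. chi (x + a) * (chi (x + b) * (cnj (chi (x + c)) * cnj (chi (x + d)))))"
    proof -
      have step: "W x * z = (\<Sum>a\<in>I. chi (x + a) * z)" "cnj (W x) * z = (\<Sum>a\<in>I. cnj (chi (x + a)) * z)" for z
        by (simp_all add: W_def sum_distrib_right cnj_sum)
      have "W x * (W x * (cnj (W x) * cnj (W x))) = W x * (W x * (cnj (W x) * (cnj (W x) * 1)))" by simp
      also have "\<dots> = (\<Sum>a\<in>I. chi (x + a) * (\<Sum>b\<in>I. chi (x + b) * (\<Sum>c\<in>I. cnj (chi (x + c)) * (\<Sum>d\<in>I. cnj (chi (x + d)) * 1))))"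
        by (simp only: step)
      finally show ?thesis by (simp only: sum_distrib_left mult_1_right)
    qed
    also have "\<dots> = (\<Sum>(a,b,c,d)\<in>J. chi (x + a) * chi (x + b) * cnj (chi (x + c)) * cnj (chi (x + d)))"
      unfolding J_def by (simp add: sum.cartesian_product mult.assoc)
    finally show ?thesis .
  qed
  have "complex_of_real (\<Sum>x\<in>{0..<int m}. cmod (W x) ^ 4) = (\<Sum>(a,b,c,d)\<in>J. quad_sum m chi a b c d)"
    unfolding of_real_sum W4 quad_sum_def by (subst sum.swap) (simp add: case_prod_unfold)
  hence "cmod (complex_of_real (\<Sum>x\<in>{0..<int m}. cmod (W x) ^ 4)) = cmod (\<Sum>(a,b,c,d)\<in>J. quad_sum m chi a b c d)"
    by simp
  also have "cmod (complex_of_real (\<Sum>x\<in>{0..<int m}. cmod (W x) ^ 4)) = (\<Sum>x\<in>{0..<int m}. cmod (W x) ^ 4)"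
    unfolding norm_of_real by (intro abs_of_nonneg sum_nonneg) simp
  also have "cmod (\<Sum>(a,b,c,d)\<in>J. quad_sum m chi a b c d) \<le> (\<Sum>t\<in>J. (if t \<in> Q then real m else 0) + 9 * sqrt m)"
  proof (rule sum_norm_le)
    fix t assume "t \<in> J"
    then obtain a b c d where t: "t = (a,b,c,d)" "a \<in> I" "b \<in> I" "c \<in> I" "d \<in> I" by (auto simp: J_def)
    show "cmod (case t of (a,b,c,d) \<Rightarrow> quad_sum m chi a b c d) \<le> (if t \<in> Q then real m else 0) + 9 * sqrt m"
    proof (cases "t \<in> Q")
      case True
      thus ?thesis using quad_sum_trivial_bound[OF D, of a b c d] real_sqrt_ge_zero[of "real m"] by (simp add: t(1) add_increasing2)
    next
      case False
      thus ?thesis using quad_sum_off_diagonal_bound[OF m H, of a b c d] t by (auto simp: Q_def J_def I_def)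
    qed
  qed
  also have "\<dots> = real (card Q) * real m + real (card J) * (9 * sqrt m)"
  proof -
    have "Q \<subseteq> J" by (auto simp: Q_def)
    hence "J \<inter> Q = Q" by auto
    thus ?thesis using fin by (simp add: sum.distrib flip: sum.inter_restrict)
  qed
  also have "real (card J) = real H ^ 4"
    by (simp add: J_def card_cartesian_product cardI power4_eq_xxxx)
  also have "card Q \<le> 3 * H ^ 2"
  proof -
    have "Q \<subseteq> (\<lambda>(a,b). (a,b,a,b)) ` (I \<times> I) \<union> (\<lambda>(a,b). (a,b,b,a)) ` (I \<times> I) \<union> (\<lambda>(a,b). (a,a,b,b)) ` (I \<times> I)"
      by (auto simp: Q_def J_def image_iff)
    hence "card Q \<le> card ((\<lambda>(a,b). (a,b,a,b)) ` (I \<times> I) \<union> (\<lambda>(a,b). (a,b,b,a)) ` (I \<times> I) \<union> (\<lambda>(a,b). (a,a,b,b)) ` (I \<times> I))"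
      using fin by (intro card_mono) auto
    also have "\<dots> \<le> card (I \<times> I) + card (I \<times> I) + card (I \<times> I)"
      using fin by (intro order.trans[OF card_Un_le] add_mono card_image_le) auto
    also have "\<dots> = 3 * H ^ 2" by (simp add: card_cartesian_product cardI power2_eq_square)
    finally show ?thesis .
  qed
  hence "real (card Q) * real m \<le> real (3 * H ^ 2) * real m"
    by (intro mult_right_mono of_nat_mono) auto
  finally show ?thesis by (simp add: W_def I_def algebra_simps)
qed

section \<open>The Polya-Vinogradov inequality\<close>

definition add_char :: "nat \<Rightarrow> int \<Rightarrow> complex" where
  "add_char m k = cis (2 * pi * real_of_int k / real m)"

lemma add_char_add: "add_char m (j + k) = add_char m j * add_char m k"
  by (simp add: add_char_def cis_mult add_divide_distrib distrib_left)

lemma add_char_0 [simp]: "add_char m 0 = 1"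
  by (simp add: add_char_def)

lemma norm_add_char [simp]: "cmod (add_char m k) = 1"
  by (simp add: add_char_def)

lemma cnj_add_char: "cnj (add_char m k) = add_char m (- k)"
  by (simp add: add_char_def cis_cnj)

lemma add_char_eq_1_iff: "m > 0 \<Longrightarrow> add_char m k = 1 \<longleftrightarrow> int m dvd k"
proof
  assume m: "m > 0" and "add_char m k = 1"
  hence "cos (2 * pi * real_of_int k / real m) = 1" by (simp add: add_char_def complex_eq_iff)
  then obtain n :: int where "2 * pi * real_of_int k / real m = real_of_int n * 2 * pi"
    using cos_one_2pi_int by blast
  hence "real_of_int k = real_of_int (n * int m)" using m by (simp add: field_simps)
  hence "k = n * int m" by (simp only: of_int_eq_iff)
  thus "int m dvd k" by simp
next
  assume "m > 0" "int m dvd k"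
  then obtain n where "k = int m * n" by (elim dvdE)
  hence "add_char m k = cis (2 * pi * real_of_int n)"
    using \<open>m > 0\<close> by (simp add: add_char_def mult.assoc del: cis_multiple_2pi)
  moreover have "cis (2 * pi * real_of_int n) = 1" by (rule cis_multiple_2pi) simp
  ultimately show "add_char m k = 1" by (simp only:)
qed

lemma add_char_cong: "m > 0 \<Longrightarrow> [j = k] (mod int m) \<Longrightarrow> add_char m j = add_char m k"
  using add_char_eq_1_iff[of m "j - k"] add_char_add[of m "j - k" k] by (simp add: cong_iff_dvd_diff)

lemma sum_add_char:
  assumes m: "m > 0"
  shows "(\<Sum>a\<in>{0..<int m}. add_char m (a * k)) = (if int m dvd k then of_nat m else 0)"
proof (cases "int m dvd k")
  case True
  hence "add_char m (a * k) = 1" for a using add_char_eq_1_iff[OF m] by simp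
  thus ?thesis using True by simp
next
  case False
  define s where "s = (\<Sum>a\<in>{0..<int m}. add_char m (a * k))"
  have "s = (\<Sum>a\<in>{0..<int m}. add_char m ((a + 1) * k))"
    unfolding s_def
  proof (rule sum_residues_shift[symmetric])
    show "add_char m (a * k) = add_char m (b * k)" if "[a = b] (mod int m)" for a b
      using that by (intro add_char_cong m cong_mult cong_refl)
  qed (use m in simp)
  also have "\<dots> = add_char m k * s"
    unfolding s_def sum_distrib_left by (intro sum.cong) (auto simp: distrib_right add_char_add)
  finally have "(add_char m k - 1) * s = 0" by (simp add: algebra_simps)
  thus ?thesis using False add_char_eq_1_iff[OF m, of k] by (simp add: s_def)
qed

definition gauss_sum :: "nat \<Rightarrow> (int \<Rightarrow> complex) \<Rightarrow> int \<Rightarrow> complex" where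
  "gauss_sum m chi a = (\<Sum>x\<in>{0..<int m}. chi x * add_char m (a * x))"

lemma gauss_sum_mult:
  assumes D: "dirichlet_character m chi" and y: "coprime y (int m)"
  shows "gauss_sum m chi a = chi y * gauss_sum m chi (a * y)"
proof -
  have m: "m > 0" using D by (simp add: dirichlet_character_def)
  obtain z where z: "[y * z = 1] (mod int m)" using cong_solve_coprime_int[OF y] by auto
  have yz: "[y * (z * x) = x] (mod int m)" "[z * (y * x) = x] (mod int m)" for x
    using cong_mult[OF z cong_refl[of x]] by (simp_all add: ac_simps)
  define f where "f x = chi x * add_char m (a * x)" for x
  have f: "f x = f x'" if "[x = x'] (mod int m)" for x x'
    unfolding f_def using that dirichlet_character_cong[OF D that] by (simp add: add_char_cong[OF m] cong_mult)
  have "(\<Sum>x\<in>{0..<int m}. f x) = (\<Sum>x\<in>{0..<int m}. f (y * x))"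
  proof (rule sum.reindex_bij_witness[of _ "\<lambda>x. (y * x) mod int m" "\<lambda>x. (z * x) mod int m"])
    show "(y * ((z * x) mod int m)) mod int m = x" if "x \<in> {0..<int m}" for x
      using yz(1)[of x] that by (simp add: cong_def mod_mult_right_eq)
    show "(z * ((y * x) mod int m)) mod int m = x" if "x \<in> {0..<int m}" for x
      using yz(2)[of x] that by (simp add: cong_def mod_mult_right_eq)
    show "f (y * ((z * x) mod int m)) = f x" for x
      using yz(1)[of x] by (intro f) (simp add: cong_def mod_mult_right_eq)
  qed (use m in auto)
  also have "\<dots> = chi y * (\<Sum>x\<in>{0..<int m}. chi x * add_char m (a * y * x))"
    unfolding sum_distrib_left f_def by (intro sum.cong) (auto simp: dirichlet_character_mult[OF D] ac_simps)
  finally show ?thesis by (simp add: gauss_sum_def f_def)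
qed

lemma gauss_sum_cong:
  assumes "m > 0" "[a = b] (mod int m)"
  shows "gauss_sum m chi a = gauss_sum m chi b"
  unfolding gauss_sum_def using assms by (intro sum.cong refl arg_cong2[of _ _ _ _ "(*)"] add_char_cong cong_mult cong_refl)

lemma gauss_sum_parseval:
  assumes D: "dirichlet_character m chi"
  shows "(\<Sum>a\<in>{0..<int m}. (cmod (gauss_sum m chi a))\<^sup>2) = real m * card {x\<in>{0..<int m}. coprime x (int m)}"
proof -
  have m: "m > 0" using D by (simp add: dirichlet_character_def)
  let ?R = "{0..<int m}"
  have "complex_of_real (\<Sum>a\<in>?R. (cmod (gauss_sum m chi a))\<^sup>2) = (\<Sum>a\<in>?R. gauss_sum m chi a * cnj (gauss_sum m chi a))"
    by (simp only: of_real_sum complex_norm_square)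
  also have "\<dots> = (\<Sum>a\<in>?R. \<Sum>x\<in>?R. \<Sum>y\<in>?R. chi x * cnj (chi y) * add_char m (a * (x - y)))"
  proof (rule sum.cong[OF refl])
    fix a
    show "gauss_sum m chi a * cnj (gauss_sum m chi a) = (\<Sum>x\<in>?R. \<Sum>y\<in>?R. chi x * cnj (chi y) * add_char m (a * (x - y)))"
      unfolding gauss_sum_def cnj_sum sum_product
      by (intro sum.cong refl) (simp add: cnj_add_char right_diff_distrib add_char_add[of m "a * _" "- _", simplified])
  qed
  also have "\<dots> = (\<Sum>x\<in>?R. \<Sum>a\<in>?R. \<Sum>y\<in>?R. chi x * cnj (chi y) * add_char m (a * (x - y)))"
    by (rule sum.swap)
  also have "\<dots> = (\<Sum>x\<in>?R. \<Sum>y\<in>?R. \<Sum>a\<in>?R. chi x * cnj (chi y) * add_char m (a * (x - y)))"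
    by (rule sum.cong[OF refl], rule sum.swap)
  also have "\<dots> = (\<Sum>x\<in>?R. \<Sum>y\<in>?R. chi x * cnj (chi y) * (if y = x then of_nat m else 0))"
  proof (intro sum.cong refl)
    fix x y assume "x \<in> ?R" "y \<in> ?R"
    hence "int m dvd x - y \<longleftrightarrow> y = x"
      by (auto simp: mod_eq_dvd_iff[symmetric])
    thus "(\<Sum>a\<in>?R. chi x * cnj (chi y) * add_char m (a * (x - y))) = chi x * cnj (chi y) * (if y = x then of_nat m else 0)"
      unfolding sum_distrib_left[symmetric] sum_add_char[OF m] by simp
  qed
  also have "\<dots> = (\<Sum>x\<in>?R. chi x * cnj (chi x) * of_nat m)"
    by (intro sum.cong refl) (simp add: if_distrib[of "\<lambda>z. _ * z"] cong: if_cong)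
  also have "\<dots> = (\<Sum>x\<in>?R. if coprime x (int m) then of_nat m else 0)"
  proof (intro sum.cong refl)
    fix x show "chi x * cnj (chi x) * of_nat m = (if coprime x (int m) then of_nat m else 0)"
      using dirichlet_character_mult_cnj[OF D, of x] dirichlet_character_eq_0_iff[OF D, of x] by auto
  qed
  also have "\<dots> = of_nat (m * card {x\<in>?R. coprime x (int m)})"
    by (simp flip: sum.inter_filter)
  finally have "complex_of_real (\<Sum>a\<in>?R. (cmod (gauss_sum m chi a))\<^sup>2) = complex_of_real (real m * card {x\<in>?R. coprime x (int m)})"
    by simp
  thus ?thesis by (simp only: of_real_eq_iff)
qed

text \<open>Some prime factor \<open>q\<close> of \<open>m\<close> divides \<open>a\<close>. A
  residue that is 1 modulo the other prime and has a nontrivial character value modulo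
  \<open>q\<close> changes \<open>chi\<close> but not \<open>a\<close> modulo \<open>m\<close>. This
  forces Gauss sums at non-units to vanish.\<close>

lemma primitive_coarse_separating:
  assumes m: "m > 1" "coarse m" "primitive_character m chi" and a: "\<not> coprime a (int m)"
  shows "\<exists>y. coprime y (int m) \<and> chi y \<noteq> 1 \<and> [a * y = a] (mod int m)"
proof -
  show ?thesis
  proof (cases "int m dvd a")
    case True
    obtain y where "coprime y (int m)" "chi y \<noteq> 1" using primitive_character_nontrivial[OF m(3,1)] by blast
    thus ?thesis using True by (auto simp: cong_iff_dvd_diff)
  next
    case False
    have "\<not> prime m"
      using a False by (metis coprime_commute prime_imp_coprime prime_nat_int_transfer)
    then obtain p0 q0 where pq0: "prime p0" "prime q0" "p0 \<noteq> q0" "m = p0 * q0" using m(2) by (auto simp: coarse_def)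
    have "\<exists>p q. prime p \<and> prime q \<and> p \<noteq> q \<and> m = p * q \<and> int q dvd a"
    proof -
      have "\<not> coprime a (int p0) \<or> \<not> coprime a (int q0)" using a by (simp add: pq0(4))
      thus ?thesis
      proof
        assume "\<not> coprime a (int p0)"
        hence "int p0 dvd a" using pq0(1) by (metis coprime_commute prime_imp_coprime prime_nat_int_transfer)
        thus ?thesis using pq0 by (metis mult.commute)
      next
        assume "\<not> coprime a (int q0)"
        hence "int q0 dvd a" using pq0(2) by (metis coprime_commute prime_imp_coprime prime_nat_int_transfer)
        thus ?thesis using pq0 by blast
      qed
    qed
    then obtain p q where pq: "prime p" "prime q" "p \<noteq> q" "m = p * q" "int q dvd a" by blast
    have cop: "coprime p q" using pq by (simp add: primes_coprime)
    obtain chi1 chi2 where chi: "dirichlet_character p chi1" "dirichlet_character q chi2" "\<And>x. chi x = chi1 x * chi2 x"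
      "\<exists>a. coprime a (int q) \<and> chi2 a \<noteq> 1"
      using primitive_character_factor[of p q chi] m(3) pq prime_gt_1_nat cop by metis
    obtain b where b: "coprime b (int q)" "chi2 b \<noteq> 1" using chi(4) by blast
    obtain y where y: "[y = 1] (mod int p)" "[y = b] (mod int q)"
      using binary_chinese_remainder_int[of "int p" "int q" 1 b] cop by auto
    have "coprime y (int p)" using y(1) by (metis cong_imp_coprime cong_sym coprime_1_left)
    moreover have "coprime y (int q)" using b(1) y(2) by (metis cong_imp_coprime cong_sym)
    ultimately have "coprime y (int m)" by (simp add: pq(4))
    moreover have "chi y \<noteq> 1"
      unfolding chi(3) dirichlet_character_cong[OF chi(1) y(1)] dirichlet_character_cong[OF chi(2) y(2)]
      using b(2) by (simp add: dirichlet_character_1[OF chi(1)])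
    moreover have "[a * y = a] (mod int m)"
    proof -
      have "int p dvd y - 1" using y(1) by (simp add: cong_iff_dvd_diff)
      hence "int p * int q dvd (y - 1) * a" using pq(5) by (rule mult_dvd_mono)
      thus ?thesis by (simp add: cong_iff_dvd_diff pq(4) algebra_simps)
    qed
    ultimately show ?thesis by blast
  qed
qed

text \<open>The sum vanishes at non-units and has the same modulus at all units, so Parseval's
  identity distributes the total \<open>m * card C\<close> evenly over the units.\<close>

lemma norm_gauss_sum_le:
  assumes m: "m > 1" "coarse m" "primitive_character m chi"
  shows "cmod (gauss_sum m chi a) \<le> sqrt m"
proof (cases "coprime a (int m)")
  case False
  have D: "dirichlet_character m chi" using m by (simp add: primitive_character_def)
  obtain y where y: "coprime y (int m)" "chi y \<noteq> 1" "[a * y = a] (mod int m)"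
    using primitive_coarse_separating[OF m False] by blast
  have "gauss_sum m chi a = chi y * gauss_sum m chi a"
    using gauss_sum_mult[OF D y(1), of a] gauss_sum_cong[OF _ y(3), of chi] m(1) by simp
  hence "gauss_sum m chi a = 0" using y(2) by simp
  thus ?thesis by simp
next
  case True
  have D: "dirichlet_character m chi" using m by (simp add: primitive_character_def)
  define C where "C = {x\<in>{0..<int m}. coprime x (int m)}"
  have "1 \<in> C" using m(1) by (simp add: C_def)
  moreover have "finite C" unfolding C_def by (rule finite_subset[of _ "{0..<int m}"]) auto
  ultimately have cC: "card C > 0" by (auto simp: card_gt_0_iff)
  have eq: "cmod (gauss_sum m chi b) = cmod (gauss_sum m chi 1)" if "coprime b (int m)" for b
    using gauss_sum_mult[OF D that, of 1] norm_dirichlet_character[OF D that] by (simp add: norm_mult)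
  have "real (card C) * (cmod (gauss_sum m chi a))\<^sup>2 = (\<Sum>b\<in>C. (cmod (gauss_sum m chi b))\<^sup>2)"
  proof -
    have "cmod (gauss_sum m chi b) = cmod (gauss_sum m chi a)" if "b \<in> C" for b
      unfolding eq[OF True] by (rule eq) (use that in \<open>simp add: C_def\<close>)
    thus ?thesis by simp
  qed
  also have "\<dots> \<le> (\<Sum>b\<in>{0..<int m}. (cmod (gauss_sum m chi b))\<^sup>2)"
    by (intro sum_mono2) (auto simp: C_def)
  also have "\<dots> = real (card C) * real m" using gauss_sum_parseval[OF D] by (simp add: C_def)
  finally have "(cmod (gauss_sum m chi a))\<^sup>2 \<le> real m" using cC by simp
  thus ?thesis by (rule real_le_rsqrt)
qed

section \<open>Bounds for sums of additive characters over intervals\<close>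

lemma sin_ge_third:
  fixes x :: real
  assumes "0 \<le> x" "x \<le> pi / 2"
  shows "sin x \<ge> x / 3"
proof -
  have "\<bar>sin x - x\<bar> \<le> x ^ 3 / 6"
    using Maclaurin_sin_bound[of x 3] assms by (simp add: sin_coeff_def eval_nat_numeral lessThan_Suc field_simps)
  \<comment> \<open>The crude bound \<open>pi / 2 \<le> 2\<close> is enough: it leaves
    \<open>x - x ^ 3 / 6 \<ge> x / 3\<close>.\<close>
  moreover have "x ^ 3 / 6 \<le> x * (2 / 3)"
  proof -
    have "x \<le> 2" using assms(2) pi_half_le_two by linarith
    hence "x\<^sup>2 \<le> 2\<^sup>2" using assms by (intro power_mono) auto
    hence "x * x\<^sup>2 \<le> x * 4" using assms by (intro mult_left_mono) auto
    thus ?thesis by (simp add: power3_eq_cube power2_eq_square)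
  qed
  ultimately show ?thesis by linarith
qed

lemma harm_le_one_plus_ln: "n > 0 \<Longrightarrow> harm n \<le> 1 + ln (real n)"
  using euler_mascheroni_sequence_decreasing[of 1 n] by (simp add: harm_expand)

text \<open>The chord has length \<open>2 * sin (pi * a / m)\<close>, at least
  \<open>4 / 3 * c / m\<close> where \<open>c\<close> is the distance from \<open>a\<close> to the
  nearest multiple of \<open>m\<close>. Replacing \<open>1 / c\<close> by
  \<open>1 / a + 1 / (m - a)\<close> avoids the minimum and sums to harmonic numbers.\<close>

lemma norm_add_char_minus_1_ge:
  assumes a: "a \<in> {1..<m}"
  shows "1 / cmod (add_char m (- int a) - 1) \<le> 3 / 4 * real m * (1 / real a + 1 / real (m - a))"
proof -
  define x where "x = pi * real a / real m"
  have m: "m > 0" "a < m" "a > 0" using a by auto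
  have "cmod (add_char m (- int a) - 1) = 2 * \<bar>sin (- x)\<bar>"
    using dist_exp_i_1[of "- 2 * x"] by (simp add: add_char_def cis_conv_exp x_def mult.assoc)
  also have "\<dots> = 2 * sin x"
  proof -
    have "0 \<le> x" "x \<le> pi" using m by (simp_all add: x_def field_simps)
    thus ?thesis using sin_ge_zero[of x] by simp
  qed
  finally have eq: "cmod (add_char m (- int a) - 1) = 2 * sin x" .
  have pi: "pi \<ge> 2" by (rule pi_ge_two)
  define c where "c = min (real a) (real (m - a))"
  have c: "c > 0" using m by (simp add: c_def)
  have "sin x \<ge> (pi * c / real m) / 3"
  proof (cases "2 * a \<le> m")
    case True
    hence "x \<le> pi / 2" using m by (simp add: x_def field_simps)
    moreover have "0 \<le> x" by (simp add: x_def)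
    moreover have "c = a" using True by (simp add: c_def)
    ultimately show ?thesis using sin_ge_third[of x] by (simp add: x_def)
  next
    case False
    have e: "pi - x = pi * real (m - a) / real m" using m by (simp add: x_def field_simps of_nat_diff)
    have "pi * real (m - a) / real m \<le> pi / 2" using m False by (simp add: field_simps of_nat_diff)
    hence "(pi - x) / 3 \<le> sin (pi - x)" by (intro sin_ge_third) (simp_all add: e)
    hence "(pi - x) / 3 \<le> sin x" by (simp only: sin_pi_minus)
    moreover have "c = m - a" using False by (simp add: c_def)
    ultimately show ?thesis by (simp only: e)
  qed
  moreover have "(pi * c / real m) / 3 \<ge> (2 * c / real m) / 3"
    using pi c by (intro divide_right_mono mult_right_mono) auto
  ultimately have "2 * sin x \<ge> 4 / 3 * c / real m" by simp
  hence "1 / (2 * sin x) \<le> 1 / (4 / 3 * c / real m)"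
  proof -
    have "4 / 3 * c / real m > 0" using c m by simp
    with \<open>2 * sin x \<ge> 4 / 3 * c / real m\<close> show ?thesis
      by (intro divide_left_mono mult_pos_pos) linarith+
  qed
  also have "\<dots> = 3 / 4 * real m * (1 / c)" by simp
  also have "\<dots> \<le> 3 / 4 * real m * (1 / real a + 1 / real (m - a))"
    using m by (intro mult_left_mono) (auto simp: c_def min_def)
  finally show ?thesis unfolding eq .
qed

lemma norm_sum_add_char_le:
  assumes a: "a \<in> {1..<m}" and N: "N \<ge> 0"
  shows "cmod (\<Sum>n\<in>{M<..M+N}. add_char m (- (int a * n))) \<le> 3 / 2 * real m * (1 / real a + 1 / real (m - a))"
proof -
  define z where "z = add_char m (- int a)"
  define e where "e n = add_char m (- (int a * n))" for n
  have step: "e (n + 1) = z * e n" for n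
    by (simp add: e_def z_def algebra_simps flip: add_char_add)
  have z1: "z \<noteq> 1"
    using add_char_eq_1_iff[of m "- int a"] a by (auto simp: z_def dest: zdvd_imp_le)
  have "(z - 1) * (\<Sum>n\<in>{M<..M+int k}. e n) = e (M + int k + 1) - e (M + 1)" for k
  proof (induction k)
    case (Suc k)
    have "{M<..M+int (Suc k)} = insert (M + int k + 1) {M<..M+int k}" by auto
    thus ?case using Suc step[of "M + int k + 1"] by (simp add: algebra_simps)
  qed simp
  from this[of "nat N"] have "(z - 1) * (\<Sum>n\<in>{M<..M+N}. e n) = e (M + N + 1) - e (M + 1)" using N by simp
  hence "cmod (z - 1) * cmod (\<Sum>n\<in>{M<..M+N}. e n) \<le> 2"
    using norm_triangle_ineq4[of "e (M + N + 1)" "e (M + 1)"] by (simp add: e_def flip: norm_mult)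
  hence "cmod (\<Sum>n\<in>{M<..M+N}. e n) \<le> 2 * (1 / cmod (z - 1))" using z1 by (simp add: field_simps)
  also have "\<dots> \<le> 2 * (3 / 4 * real m * (1 / real a + 1 / real (m - a)))"
    unfolding z_def by (intro mult_left_mono norm_add_char_minus_1_ge a) simp
  finally show ?thesis by (simp add: e_def)
qed

text \<open>Finite Fourier inversion expresses \<open>chi\<close> through its Gauss sums, each at
  most \<open>sqrt m\<close>; the geometric sums over the interval then add up to a harmonic
  sum.\<close>

theorem polya_vinogradov:
  assumes m: "m > 1" "coarse m" "primitive_character m chi" and ln: "ln (real m) \<ge> 3" and N: "N \<ge> 0"
  shows "cmod (char_sum chi N M) \<le> 4 * sqrt m * ln m"
proof -
  have D: "dirichlet_character m chi" using m by (simp add: primitive_character_def)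
  have m0: "m > 0" using m by simp
  let ?R = "{0..<int m}" and ?I = "{M<..M+N}"
  have inv: "of_nat m * chi n = (\<Sum>a\<in>?R. gauss_sum m chi a * add_char m (- (a * n)))" for n
  proof -
    have "(\<Sum>a\<in>?R. gauss_sum m chi a * add_char m (- (a * n))) = (\<Sum>a\<in>?R. \<Sum>x\<in>?R. chi x * add_char m (a * (x - n)))"
      unfolding gauss_sum_def sum_distrib_right
      by (intro sum.cong refl) (simp add: right_diff_distrib add_char_add[of m "a * _" "- _", simplified] mult.assoc flip: add_char_add)
    also have "\<dots> = (\<Sum>x\<in>?R. \<Sum>a\<in>?R. chi x * add_char m (a * (x - n)))" by (rule sum.swap)
    also have "\<dots> = (\<Sum>x\<in>?R. if x = n mod int m then of_nat m * chi x else 0)"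
    proof (rule sum.cong[OF refl])
      fix x assume "x \<in> ?R"
      hence "int m dvd x - n \<longleftrightarrow> x = n mod int m" by (auto simp: mod_eq_dvd_iff[symmetric])
      thus "(\<Sum>a\<in>?R. chi x * add_char m (a * (x - n))) = (if x = n mod int m then of_nat m * chi x else 0)"
        unfolding sum_distrib_left[symmetric] sum_add_char[OF m0] by simp
    qed
    also have "\<dots> = of_nat m * chi n" using m0 by (simp add: dirichlet_character_mod[OF D])
    finally show ?thesis by simp
  qed
  have "of_nat m * char_sum chi N M = (\<Sum>a\<in>?R. gauss_sum m chi a * (\<Sum>n\<in>?I. add_char m (- (a * n))))"
    unfolding char_sum_def sum_distrib_left inv by (rule sum.swap)
  also have "\<dots> = (\<Sum>a\<in>{1..<int m}. gauss_sum m chi a * (\<Sum>n\<in>?I. add_char m (- (a * n))))"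
  proof (rule sum.mono_neutral_right)
    \<comment> \<open>The frequency 0, where the inner sum has no cancellation, drops out because
      its Gauss sum vanishes.\<close>
    have "\<not> coprime 0 (int m)" using m(1) by simp
    then obtain y where y: "coprime y (int m)" "chi y \<noteq> 1" using primitive_coarse_separating[OF m] by blast
    have "gauss_sum m chi 0 = 0" using gauss_sum_mult[OF D y(1), of 0] y(2) by simp
    moreover have "?R - {1..<int m} \<subseteq> {0}" by auto
    ultimately show "\<forall>a\<in>?R - {1..<int m}. gauss_sum m chi a * (\<Sum>n\<in>?I. add_char m (- (a * n))) = 0" by auto
  qed auto
  also have "\<dots> = (\<Sum>a\<in>{1..<m}. gauss_sum m chi (int a) * (\<Sum>n\<in>?I. add_char m (- (int a * n))))"
    by (rule sum.reindex_bij_witness[of _ int nat]) auto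
  finally have eq: "of_nat m * char_sum chi N M = (\<Sum>a\<in>{1..<m}. gauss_sum m chi (int a) * (\<Sum>n\<in>?I. add_char m (- (int a * n))))" .
  have "real m * cmod (char_sum chi N M) = cmod (of_nat m * char_sum chi N M)" by (simp add: norm_mult)
  also have "\<dots> \<le> (\<Sum>a\<in>{1..<m}. sqrt m * (3 / 2 * real m * (1 / real a + 1 / real (m - a))))"
    unfolding eq by (rule sum_norm_le, unfold norm_mult, intro mult_mono norm_gauss_sum_le[OF m] norm_sum_add_char_le N) auto
  also have "\<dots> = real m * (sqrt m * (3 / 2) * (\<Sum>a\<in>{1..<m}. 1 / real a + 1 / real (m - a)))"
    unfolding sum_distrib_left by (intro sum.cong refl) (simp only: mult_ac)
  also have "(\<Sum>a\<in>{1..<m}. 1 / real a + 1 / real (m - a)) = 2 * harm (m - 1)"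
  proof -
    have "(\<Sum>a\<in>{1..<m}. 1 / real (m - a)) = (\<Sum>a\<in>{1..<m}. 1 / real a)"
      by (rule sum.reindex_bij_witness[of _ "\<lambda>a. m - a" "\<lambda>a. m - a"]) auto
    moreover have "harm (m - 1) = (\<Sum>a\<in>{1..<m}. 1 / real a)"
      unfolding harm_def using m0 by (intro sum.cong) (auto simp: inverse_eq_divide)
    ultimately show ?thesis unfolding sum.distrib by linarith
  qed
  finally have "cmod (char_sum chi N M) \<le> 3 * sqrt m * harm (m - 1)" using m0 by simp
  also have "\<dots> \<le> 3 * sqrt m * (1 + ln m)"
  proof -
    have "harm (m - 1) \<le> 1 + ln (real (m - 1))" using m by (intro harm_le_one_plus_ln) simp
    also have "\<dots> \<le> 1 + ln (real m)" using m by simp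
    finally show ?thesis by (intro mult_left_mono) auto
  qed
  also have "\<dots> \<le> 3 * sqrt m * (4 / 3 * ln m)" using ln by (intro mult_left_mono) auto
  finally show ?thesis by simp
qed

section \<open>Burgess's method\<close>

lemma card_congruent_le:
  fixes S :: "int set" and c N :: int and k :: nat
  assumes S: "S \<subseteq> {c<..c+N}" and k: "k > 0" and cong: "\<And>x y. x \<in> S \<Longrightarrow> y \<in> S \<Longrightarrow> [x = y] (mod int k)" and N: "N \<ge> 0"
  shows "real (card S) \<le> 1 + real_of_int N / real k"
proof (cases "S = {}")
  case False
  have fin: "finite S" by (rule finite_subset[OF S]) simp
  define x0 where "x0 = Min S"
  have x0: "x0 \<in> S" "\<And>x. x \<in> S \<Longrightarrow> x0 \<le> x" using fin False by (auto simp: x0_def)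
  have "S \<subseteq> (\<lambda>j. x0 + int k * j) ` {0..(N - 1) div int k}"
  proof
    fix x assume x: "x \<in> S"
    have "int k dvd x - x0" using cong[OF x x0(1)] by (simp add: cong_iff_dvd_diff)
    then obtain j where j: "x - x0 = int k * j" by (elim dvdE)
    have "c < x0" "x \<le> c + N" "x0 \<le> x" using x x0 S by auto
    hence "0 \<le> x - x0" "x - x0 \<le> N - 1" by linarith+
    hence "0 \<le> j" using k j by (simp add: zero_le_mult_iff)
    moreover have "j \<le> (N - 1) div int k"
      using \<open>x - x0 \<le> N - 1\<close> k j by (metis nonzero_mult_div_cancel_left of_nat_0_less_iff zdiv_mono1 less_irrefl)
    ultimately show "x \<in> (\<lambda>j. x0 + int k * j) ` {0..(N - 1) div int k}" using j by (intro image_eqI[of _ _ j]) auto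
  qed
  hence "card S \<le> card {0..(N - 1) div int k}"
    by (meson card_image_le card_mono finite_atLeastAtMost_int finite_imageI order_trans)
  also have "real \<dots> \<le> 1 + real_of_int N / real k"
  proof -
    have "real_of_int ((N - 1) div int k) \<le> real_of_int (N - 1) / real k"
      using real_of_int_div4[of "N - 1" "int k"] by simp
    also have "\<dots> \<le> real_of_int N / real k" by (intro divide_right_mono) auto
    finally show ?thesis using N by (cases "(N - 1) div int k \<ge> 0") auto
  qed
  finally show ?thesis by simp
qed (use N in simp)

text \<open>The pairs are grouped by the value \<open>\<beta> * n - \<alpha> * n'\<close>, a
  multiple of \<open>m\<close> in an interval of length \<open>(\<alpha> + \<beta>) * N\<close>. For
  a fixed value, coprimality determines \<open>n\<close> modulo \<open>\<alpha>\<close> and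
  \<open>n'\<close> modulo \<open>\<beta>\<close>, and each of the two determines the other.\<close>

lemma card_linear_congruence_le:
  fixes \<alpha> \<beta> m :: nat and M N :: int
  assumes "\<alpha> > 0" "\<beta> > 0" "coprime \<alpha> \<beta>" "m > 0" "N > 0"
  shows "real (card {(n,n')\<in>{M<..M+N} \<times> {M<..M+N}. [int \<beta> * n = int \<alpha> * n'] (mod int m)}) \<le>
     (1 + real (\<alpha> + \<beta>) * real_of_int N / real m) * (1 + real_of_int N / real (max \<alpha> \<beta>))"
proof -
  define I where "I = {M<..M+N}"
  define S where "S = {(n,n')\<in>I \<times> I. [int \<beta> * n = int \<alpha> * n'] (mod int m)}"
  define D where "D = (\<lambda>(n,n'). int \<beta> * n - int \<alpha> * n')"
  have fin: "finite S" unfolding S_def by (rule finite_subset[of _ "I \<times> I"]) (auto simp: I_def)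
  have cop: "coprime (int \<alpha>) (int \<beta>)" using assms by simp
  have fibre: "real (card {p\<in>S. D p = t}) \<le> 1 + real_of_int N / real (max \<alpha> \<beta>)" for t
  proof -
    define F where "F = {p\<in>S. D p = t}"
    have diff: "int \<beta> * (fst p - fst p') = int \<alpha> * (snd p - snd p')" if "p \<in> F" "p' \<in> F" for p p'
      using that by (auto simp: F_def D_def case_prod_unfold algebra_simps)
    have "inj_on fst F"
    proof (rule inj_onI)
      fix p p' assume "p \<in> F" "p' \<in> F" "fst p = fst p'"
      with diff[of p p'] assms(1) show "p = p'" by (simp add: prod_eq_iff)
    qed
    moreover have "inj_on snd F"
    proof (rule inj_onI)
      fix p p' assume "p \<in> F" "p' \<in> F" "snd p = snd p'"
      with diff[of p p'] assms(2) show "p = p'" by (simp add: prod_eq_iff)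
    qed
    ultimately have c: "card F = card (fst ` F)" "card F = card (snd ` F)" by (simp_all add: card_image)
    have sub: "fst ` F \<subseteq> {M<..M+N}" "snd ` F \<subseteq> {M<..M+N}" by (auto simp: F_def S_def I_def)
    have "real (card (fst ` F)) \<le> 1 + real_of_int N / real \<alpha>"
    proof (rule card_congruent_le[OF sub(1) assms(1)])
      fix x y assume "x \<in> fst ` F" "y \<in> fst ` F"
      then obtain p p' where p: "p \<in> F" "p' \<in> F" "x = fst p" "y = fst p'" by auto
      have "int \<alpha> dvd int \<beta> * (x - y)" using diff[OF p(1,2)] by (simp add: p)
      thus "[x = y] (mod int \<alpha>)" using cop by (simp add: cong_iff_dvd_diff coprime_dvd_mult_right_iff)
    qed (use assms in simp)
    moreover have "real (card (snd ` F)) \<le> 1 + real_of_int N / real \<beta>"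
    proof (rule card_congruent_le[OF sub(2) assms(2)])
      fix x y assume "x \<in> snd ` F" "y \<in> snd ` F"
      then obtain p p' where p: "p \<in> F" "p' \<in> F" "x = snd p" "y = snd p'" by auto
      have "int \<beta> dvd int \<alpha> * (x - y)" using diff[OF p(1,2), symmetric] by (simp add: p)
      thus "[x = y] (mod int \<beta>)" using cop by (simp add: cong_iff_dvd_diff coprime_dvd_mult_right_iff coprime_commute)
    qed (use assms in simp)
    ultimately show ?thesis using c unfolding F_def by (simp add: max_def)
  qed
  define Y where "Y = D ` S"
  have "real (card Y) \<le> 1 + real_of_int (int (\<alpha> + \<beta>) * N) / real m"
  proof (rule card_congruent_le[OF _ assms(4)])
    show "Y \<subseteq> {int \<beta> * M - int \<alpha> * (M + N)<..int \<beta> * M - int \<alpha> * (M + N) + int (\<alpha> + \<beta>) * N}"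
    proof
      fix y assume "y \<in> Y"
      then obtain n n' where y: "y = int \<beta> * n - int \<alpha> * n'" "n \<in> I" "n' \<in> I" by (auto simp: Y_def D_def S_def)
      have "int \<beta> * M < int \<beta> * n" "int \<beta> * n \<le> int \<beta> * (M + N)" "int \<alpha> * n' \<le> int \<alpha> * (M + N)" "int \<alpha> * M \<le> int \<alpha> * n'"
        using y assms by (auto simp: I_def)
      thus "y \<in> {int \<beta> * M - int \<alpha> * (M + N)<..int \<beta> * M - int \<alpha> * (M + N) + int (\<alpha> + \<beta>) * N}"
        by (simp add: y algebra_simps)
    qed
    show "[x = y] (mod int m)" if "x \<in> Y" "y \<in> Y" for x y
    proof -
      have "int m dvd z" if "z \<in> Y" for z
        using that by (auto simp: Y_def D_def S_def cong_iff_dvd_diff)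
      thus ?thesis using that by (simp add: cong_iff_dvd_diff)
    qed
  qed (use assms in simp)
  hence Y: "real (card Y) \<le> 1 + real (\<alpha> + \<beta>) * real_of_int N / real m" by simp
  have "card S = (\<Sum>t\<in>Y. card {p\<in>S. D p = t})"
    using sum.group[of S Y D "\<lambda>_. 1::nat"] fin by (simp add: Y_def)
  hence "real (card S) = (\<Sum>t\<in>Y. real (card {p\<in>S. D p = t}))" by simp
  also have "\<dots> \<le> (\<Sum>t\<in>Y. 1 + real_of_int N / real (max \<alpha> \<beta>))" by (intro sum_mono fibre)
  also have "\<dots> = real (card Y) * (1 + real_of_int N / real (max \<alpha> \<beta>))" by simp
  also have "\<dots> \<le> (1 + real (\<alpha> + \<beta>) * real_of_int N / real m) * (1 + real_of_int N / real (max \<alpha> \<beta>))"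
    using assms by (intro mult_right_mono Y) auto
  finally show ?thesis by (simp add: S_def I_def)
qed

text \<open>By symmetry it is enough to double the part with \<open>b \<le> a\<close>. Bounding
  \<open>gcd a b\<close> by the sum of all common divisors gives at most \<open>a\<close> times the
  number of divisors of \<open>a\<close>; dividing by \<open>a\<close> leaves a divisor count, whose
  sum is at most \<open>A\<close> times a harmonic number.\<close>

lemma sum_gcd_div_max_le:
  assumes "A > 0"
  shows "(\<Sum>a\<in>{1..A}. \<Sum>a'\<in>{1..A}. real (gcd a a') / real (max a a')) \<le> 2 * real A * (1 + ln (real A))"
proof -
  define f where "f a a' = real (gcd a a') / real (max a a')" for a a' :: nat
  have f0: "f a a' \<ge> 0" and fsym: "f a a' = f a' a" for a a' by (simp_all add: f_def gcd.commute max.commute)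
  have mult: "card {b\<in>{1..a}. g dvd b} \<le> a div g" if "g > 0" for a g :: nat
  proof -
    have "{b\<in>{1..a}. g dvd b} \<subseteq> (\<lambda>k. g * k) ` {1..a div g}"
    proof
      fix b assume "b \<in> {b\<in>{1..a}. g dvd b}"
      then obtain k where k: "b = g * k" "b \<le> a" "b \<ge> 1" by auto
      hence "k \<le> a div g" using that by (metis div_le_mono nonzero_mult_div_cancel_left less_irrefl)
      moreover have "k \<ge> 1" using k by (cases k) auto
      ultimately show "b \<in> (\<lambda>k. g * k) ` {1..a div g}" using k by auto
    qed
    hence "card {b\<in>{1..a}. g dvd b} \<le> card {1..a div g}"
      by (meson card_image_le card_mono finite_atLeastAtMost finite_imageI order_trans)
    thus ?thesis by simp
  qed
  have inner: "(\<Sum>b\<in>{1..a}. f a b) \<le> (\<Sum>g\<in>{1..A}. if g dvd a then 1 else 0)" if a: "a \<in> {1..A}" for a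
  proof -
    have "(\<Sum>b\<in>{1..a}. real (gcd a b)) \<le> (\<Sum>b\<in>{1..a}. \<Sum>g\<in>{1..A}. if g dvd a \<and> g dvd b then real g else 0)"
    proof (rule sum_mono)
      fix b assume b: "b \<in> {1..a}"
      have "gcd a b \<le> a" "gcd a b > 0" using a by (auto intro: gcd_le1_nat)
      hence "gcd a b \<in> {1..A}" using a by (simp only: atLeastAtMost_iff) linarith
      hence "(\<Sum>g\<in>{gcd a b}. if g dvd a \<and> g dvd b then real g else 0) \<le> (\<Sum>g\<in>{1..A}. if g dvd a \<and> g dvd b then real g else 0)"
        by (intro sum_mono2) auto
      thus "real (gcd a b) \<le> (\<Sum>g\<in>{1..A}. if g dvd a \<and> g dvd b then real g else 0)" by simp
    qed
    also have "\<dots> = (\<Sum>g\<in>{1..A}. \<Sum>b\<in>{1..a}. if g dvd a \<and> g dvd b then real g else 0)" by (rule sum.swap)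
    also have "\<dots> \<le> (\<Sum>g\<in>{1..A}. if g dvd a then real a else 0)"
    proof (rule sum_mono)
      fix g assume g: "g \<in> {1..A}"
      show "(\<Sum>b\<in>{1..a}. if g dvd a \<and> g dvd b then real g else 0) \<le> (if g dvd a then real a else 0)"
      proof (cases "g dvd a")
        case True
        have "(\<Sum>b\<in>{1..a}. if g dvd a \<and> g dvd b then real g else 0) = real (card {b\<in>{1..a}. g dvd b} * g)"
          using True by (simp flip: sum.inter_filter)
        also have "\<dots> \<le> real (a div g * g)" using mult[of g a] g by (intro of_nat_mono mult_right_mono) auto
        also have "\<dots> = real a" using True by simp
        finally show ?thesis using True by simp
      qed simp
    qed
    also have "\<dots> = real a * (\<Sum>g\<in>{1..A}. if g dvd a then 1 else 0)"
      unfolding sum_distrib_left by (intro sum.cong) auto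
    finally have le: "(\<Sum>b\<in>{1..a}. real (gcd a b)) \<le> real a * (\<Sum>g\<in>{1..A}. if g dvd a then 1 else 0)" .
    have "(\<Sum>b\<in>{1..a}. f a b) = (\<Sum>b\<in>{1..a}. real (gcd a b)) / real a"
      unfolding sum_divide_distrib f_def by (intro sum.cong) (auto simp: max_def)
    also have "\<dots> \<le> (\<Sum>g\<in>{1..A}. if g dvd a then 1 else 0)"
      using le a by (simp add: divide_le_eq mult.commute)
    finally show ?thesis .
  qed
  have "(\<Sum>a\<in>{1..A}. \<Sum>b\<in>{1..A}. f a b) \<le> (\<Sum>a\<in>{1..A}. \<Sum>b\<in>{1..A}. (if b \<le> a then f a b else 0) + (if a \<le> b then f b a else 0))"
    using f0 fsym by (intro sum_mono) auto
  also have "\<dots> = (\<Sum>a\<in>{1..A}. \<Sum>b\<in>{1..A}. if b \<le> a then f a b else 0) + (\<Sum>b\<in>{1..A}. \<Sum>a\<in>{1..A}. if a \<le> b then f b a else 0)"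
    unfolding sum.distrib by (subst (3) sum.swap) simp
  also have "\<dots> = 2 * (\<Sum>a\<in>{1..A}. \<Sum>b\<in>{1..a}. f a b)"
  proof -
    have "(\<Sum>b\<in>{1..A}. if b \<le> a then f a b else 0) = (\<Sum>b\<in>{1..a}. f a b)" if "a \<in> {1..A}" for a
    proof -
      have "{b\<in>{1..A}. b \<le> a} = {1..a}" using that by auto
      thus ?thesis by (simp flip: sum.inter_filter)
    qed
    thus ?thesis by simp
  qed
  also have "\<dots> \<le> 2 * (\<Sum>a\<in>{1..A}. \<Sum>g\<in>{1..A}. if g dvd a then 1 else 0)"
    using inner by (intro mult_left_mono sum_mono) auto
  also have "(\<Sum>a\<in>{1..A}. \<Sum>g\<in>{1..A}. if g dvd a then 1 else (0::real)) = (\<Sum>g\<in>{1..A}. \<Sum>a\<in>{1..A}. if g dvd a then 1 else 0)"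
    by (rule sum.swap)
  also have "\<dots> = (\<Sum>g\<in>{1..A}. real (card {a\<in>{1..A}. g dvd a}))"
    by (intro sum.cong refl) (simp flip: sum.inter_filter)
  also have "\<dots> \<le> (\<Sum>g\<in>{1..A}. real A * inverse (real g))"
  proof (rule sum_mono)
    fix g assume g: "g \<in> {1..A}"
    have "real (card {a\<in>{1..A}. g dvd a}) \<le> real (A div g)" using mult[of g A] g by auto
    also have "\<dots> \<le> real A / real g" by (rule of_nat_div_le_of_nat)
    finally show "real (card {a\<in>{1..A}. g dvd a}) \<le> real A * inverse (real g)" by (simp add: divide_inverse)
  qed
  also have "\<dots> = real A * harm A" by (simp add: harm_def sum_distrib_left)
  also have "\<dots> \<le> real A * (1 + ln (real A))" using harm_le_one_plus_ln[OF assms] by (intro mult_left_mono) auto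
  finally show ?thesis by (simp add: f_def)
qed

lemma coprime_if_less_prime_factors:
  fixes a m :: nat
  assumes "a > 0" "\<And>r. prime r \<Longrightarrow> r dvd m \<Longrightarrow> a < r"
  shows "coprime a m"
proof (rule coprimeI)
  fix k assume k: "k dvd a" "k dvd m"
  show "is_unit k"
  proof (rule ccontr)
    assume "\<not> is_unit k"
    then obtain r where r: "prime r" "r dvd k" using prime_factor_nat[of k] by auto
    have "r \<le> a" using dvd_trans[OF r(2) k(1)] assms(1) by (intro dvd_imp_le) auto
    thus False using assms(2)[OF r(1) dvd_trans[OF r(2) k(2)]] by simp
  qed
qed

text \<open>The common divisor \<open>g\<close> of \<open>a\<close> and \<open>a'\<close> is
  invertible modulo \<open>m\<close> because \<open>g \<le> A < r\<close> for all prime factors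
  \<open>r\<close>. Cancelling it leaves coprime coefficients and replaces
  \<open>1 / max \<alpha> \<beta>\<close> by \<open>gcd a a' / max a a'\<close>, whose sum costs
  only a logarithm.\<close>

lemma card_ratio_pairs_le:
  assumes m: "m > 0" and A: "A > 0" "\<And>r. prime r \<Longrightarrow> r dvd m \<Longrightarrow> A < r" and N: "N > 0"
  shows "(\<Sum>a\<in>{1..A}. \<Sum>a'\<in>{1..A}. real (card {(n,n')\<in>{M<..M+N} \<times> {M<..M+N}. [int a' * n = int a * n'] (mod int m)})) \<le>
     real A ^ 2 + 2 * real_of_int N * real A * (1 + ln (real A)) + 2 * real A ^ 3 * real_of_int N / m + 2 * real A ^ 2 * real_of_int N ^ 2 / m"
proof -
  have "real (card {(n,n')\<in>{M<..M+N} \<times> {M<..M+N}. [int a' * n = int a * n'] (mod int m)}) \<le>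
      1 + real_of_int N * (real (gcd a a') / real (max a a')) + 2 * real A * real_of_int N / m + 2 * real_of_int N ^ 2 / m"
    if a: "a \<in> {1..A}" "a' \<in> {1..A}" for a a'
  proof -
    define g where "g = gcd a a'"
    have "gcd a a' \<noteq> 0" using a by simp
    then obtain \<alpha> \<beta> where \<alpha>: "a = g * \<alpha>" "a' = g * \<beta>" "coprime \<alpha> \<beta>"
      using gcd_coprime_exists[of a a'] unfolding g_def by (metis mult.commute)
    have pos: "g > 0" "\<alpha> > 0" "\<beta> > 0" using a \<alpha> by (auto intro!: Nat.gr0I)
    have "g \<le> a" unfolding g_def using a by (intro gcd_le1_nat) auto
    hence "g \<le> A" using a by simp
    hence "coprime g m"
      using A(2) pos(1) by (intro coprime_if_less_prime_factors) (auto intro: le_less_trans)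
    hence cg: "coprime (int g) (int m)" by simp
    have "[int a' * n = int a * n'] (mod int m) \<longleftrightarrow> [int \<beta> * n = int \<alpha> * n'] (mod int m)" for n n'
      unfolding \<alpha> of_nat_mult mult.assoc by (rule cong_mult_lcancel[OF cg])
    hence "real (card {(n,n')\<in>{M<..M+N} \<times> {M<..M+N}. [int a' * n = int a * n'] (mod int m)}) \<le>
        (1 + real (\<alpha> + \<beta>) * real_of_int N / real m) * (1 + real_of_int N / real (max \<alpha> \<beta>))"
      using card_linear_congruence_le[OF pos(2,3) \<alpha>(3) m N, of M] by simp
    also have "\<dots> = 1 + real_of_int N / real (max \<alpha> \<beta>) + real (\<alpha> + \<beta>) * real_of_int N / real m
        + (real (\<alpha> + \<beta>) / real (max \<alpha> \<beta>)) * (real_of_int N ^ 2 / real m)"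
    proof -
      have "(1 + u) * (1 + v) = 1 + v + u + u * v" for u v :: real by (simp add: algebra_simps)
      thus ?thesis by (simp add: power2_eq_square mult_ac)
    qed
    also have "real_of_int N / real (max \<alpha> \<beta>) = real_of_int N * (real (gcd a a') / real (max a a'))"
    proof -
      have "max a a' = g * max \<alpha> \<beta>" unfolding \<alpha> by (simp add: nat_mult_max_right)
      thus ?thesis unfolding g_def[symmetric] using pos by simp
    qed
    also have "real (\<alpha> + \<beta>) * real_of_int N / real m \<le> 2 * real A * real_of_int N / m"
    proof -
      have "\<alpha> \<le> a" "\<beta> \<le> a'" unfolding \<alpha> using pos by simp_all
      hence "real (\<alpha> + \<beta>) \<le> 2 * real A" using a by simp
      thus ?thesis using N by (intro divide_right_mono mult_right_mono) auto
    qed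
    also have "(real (\<alpha> + \<beta>) / real (max \<alpha> \<beta>)) * (real_of_int N ^ 2 / real m) \<le> 2 * (real_of_int N ^ 2 / real m)"
      using pos by (intro mult_right_mono) (auto simp: divide_le_eq)
    finally show ?thesis by simp
  qed
  hence "(\<Sum>a\<in>{1..A}. \<Sum>a'\<in>{1..A}. real (card {(n,n')\<in>{M<..M+N} \<times> {M<..M+N}. [int a' * n = int a * n'] (mod int m)})) \<le>
      (\<Sum>a\<in>{1..A}. \<Sum>a'\<in>{1..A}. 1 + real_of_int N * (real (gcd a a') / real (max a a')) + 2 * real A * real_of_int N / m + 2 * real_of_int N ^ 2 / m)"
    by (intro sum_mono) auto
  also have "\<dots> = real A ^ 2 + real_of_int N * (\<Sum>a\<in>{1..A}. \<Sum>a'\<in>{1..A}. real (gcd a a') / real (max a a'))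
      + 2 * real A ^ 3 * real_of_int N / m + 2 * real A ^ 2 * real_of_int N ^ 2 / m"
    by (simp add: sum.distrib sum_distrib_left power2_eq_square power3_eq_cube mult_ac)
  also have "\<dots> \<le> real A ^ 2 + real_of_int N * (2 * real A * (1 + ln (real A)))
      + 2 * real A ^ 3 * real_of_int N / m + 2 * real A ^ 2 * real_of_int N ^ 2 / m"
    using sum_gcd_div_max_le[OF A(1)] N by (intro add_mono mult_left_mono) auto
  finally show ?thesis by (simp add: mult_ac)
qed

text \<open>With \<open>v y\<close> the number of pairs \<open>(a, n)\<close> with
  \<open>n / a = y\<close>, two applications of Cauchy-Schwarz give the product of
  \<open>(\<Sum>v)^2\<close>, \<open>\<Sum>v^2\<close> and the fourth moment. The first sum is
  \<open>A * N\<close>, and the second counts coincidences of fractions.\<close>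

lemma burgess_sum_bound:
  fixes chi :: "int \<Rightarrow> complex" and M N :: int and A H m :: nat
  assumes m: "m > 1" "coarse m" "primitive_character m chi"
    and A: "A > 0" "\<And>r. prime r \<Longrightarrow> r dvd m \<Longrightarrow> A < r"
    and H: "\<And>r. prime r \<Longrightarrow> r dvd m \<Longrightarrow> H \<le> r" and N: "N > 0"
  shows "(\<Sum>a\<in>{1..A}. \<Sum>n\<in>{M<..M+N}. cmod (\<Sum>b\<in>{1..int H}. chi (n + int a * b))) ^ 4 \<le>
    (real A * real_of_int N) ^ 2 *
    (real A ^ 2 + 2 * real_of_int N * real A * (1 + ln (real A)) + 2 * real A ^ 3 * real_of_int N / m + 2 * real A ^ 2 * real_of_int N ^ 2 / m) *
    (3 * real H ^ 2 * real m + 9 * real H ^ 4 * sqrt m)"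
proof -
  have D: "dirichlet_character m chi" using m by (simp add: primitive_character_def)
  have m0: "m > 0" using m by simp
  define I where "I = {M<..M+N}"
  define R where "R = {0..<int m}"
  define P where "P = {1..A} \<times> I"
  define W where "W x = cmod (\<Sum>b\<in>{1..int H}. chi (x + b))" for x
  have fin: "finite I" "finite R" "finite P" by (simp_all add: I_def R_def P_def)
  have cop: "coprime (int a) (int m)" if "a \<in> {1..A}" for a
  proof -
    have "coprime a m"
      using A(2) that by (intro coprime_if_less_prime_factors) (auto intro: le_less_trans)
    thus ?thesis by simp
  qed
  have "\<exists>z. \<forall>a\<in>{1..A}. [int a * z a = 1] (mod int m)"
    using cong_solve_coprime_int[OF cop] by (intro bchoice) blast
  then obtain z where z: "\<And>a. a \<in> {1..A} \<Longrightarrow> [int a * z a = 1] (mod int m)" by blast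
  define x where "x = (\<lambda>(a,n). (z a * n) mod int m)"
  have xR: "x p \<in> R" for p using m0 by (simp add: x_def R_def case_prod_unfold)
  have ax: "[int a * x (a, n) = n] (mod int m)" if "a \<in> {1..A}" for a n
    using cong_mult[OF z[OF that] cong_refl[of n]] by (simp add: x_def cong_def mod_mult_right_eq mult.assoc)
  have W: "cmod (\<Sum>b\<in>{1..int H}. chi (n + int a * b)) = W (x (a, n))" if a: "a \<in> {1..A}" for a n
  proof -
    have "chi (n + int a * b) = chi (int a) * chi (x (a, n) + b)" for b
    proof -
      have "[n + int a * b = int a * (x (a, n) + b)] (mod int m)"
        unfolding distrib_left by (intro cong_add cong_refl cong_sym[OF ax[OF a]])
      thus ?thesis using dirichlet_character_cong[OF D] dirichlet_character_mult[OF D] by metis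
    qed
    thus ?thesis
      using norm_dirichlet_character[OF D cop[OF a]] by (simp add: W_def norm_mult flip: sum_distrib_left)
  qed
  define T where "T = (\<Sum>p\<in>P. W (x p))"
  have T: "(\<Sum>a\<in>{1..A}. \<Sum>n\<in>I. cmod (\<Sum>b\<in>{1..int H}. chi (n + int a * b))) = T"
    unfolding T_def P_def sum.cartesian_product[symmetric] case_prod_unfold using W
    by (simp add: sum.cartesian_product')
  define v where "v y = card {p\<in>P. x p = y}" for y
  have group: "(\<Sum>p\<in>P. f (x p)) = (\<Sum>y\<in>R. real (v y) * f y)" for f :: "int \<Rightarrow> real"
  proof -
    have "(\<Sum>p\<in>P. f (x p)) = (\<Sum>y\<in>R. \<Sum>p\<in>{p\<in>P. x p = y}. f (x p))"
      using xR fin by (intro sum.group[symmetric]) auto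
    also have "\<dots> = (\<Sum>y\<in>R. real (v y) * f y)" by (intro sum.cong refl) (simp add: v_def)
    finally show ?thesis .
  qed
  have cardP: "real (card P) = real A * real_of_int N" using N by (simp add: P_def I_def card_cartesian_product)
  have "T\<^sup>2 = (\<Sum>p\<in>P. 1 * W (x p))\<^sup>2" by (simp add: T_def)
  also have "\<dots> \<le> (\<Sum>p\<in>P. 1\<^sup>2) * (\<Sum>p\<in>P. (W (x p))\<^sup>2)" by (rule Cauchy_Schwarz_ineq_sum)
  also have "\<dots> = (real A * real_of_int N) * (\<Sum>y\<in>R. real (v y) * (W y)\<^sup>2)"
    using group[of "\<lambda>y. (W y)\<^sup>2"] by (simp add: cardP)
  finally have T2: "T\<^sup>2 \<le> (real A * real_of_int N) * (\<Sum>y\<in>R. real (v y) * (W y)\<^sup>2)" .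
  have "T ^ 4 = (T\<^sup>2)\<^sup>2" by simp
  also have "\<dots> \<le> ((real A * real_of_int N) * (\<Sum>y\<in>R. real (v y) * (W y)\<^sup>2))\<^sup>2"
    using T2 by (intro power_mono) auto
  also have "\<dots> = (real A * real_of_int N)\<^sup>2 * (\<Sum>y\<in>R. real (v y) * (W y)\<^sup>2)\<^sup>2"
    by (rule power_mult_distrib)
  also have "\<dots> \<le> (real A * real_of_int N)\<^sup>2 * ((\<Sum>y\<in>R. (real (v y))\<^sup>2) * (\<Sum>y\<in>R. ((W y)\<^sup>2)\<^sup>2))"
    by (intro mult_left_mono Cauchy_Schwarz_ineq_sum) auto
  finally have T4: "T ^ 4 \<le> (real A * real_of_int N)\<^sup>2 * ((\<Sum>y\<in>R. (real (v y))\<^sup>2) * (\<Sum>y\<in>R. W y ^ 4))" by simp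
  have "(\<Sum>y\<in>R. (real (v y))\<^sup>2) = (\<Sum>p\<in>P. real (v (x p)))"
    using group[of "\<lambda>y. real (v y)"] by (simp add: power2_eq_square)
  also have "\<dots> = (\<Sum>p\<in>P. \<Sum>p'\<in>P. if x p' = x p then 1 else 0)"
    using fin by (simp add: v_def flip: sum.inter_filter)
  also have "\<dots> = (\<Sum>a\<in>{1..A}. \<Sum>n\<in>I. \<Sum>a'\<in>{1..A}. \<Sum>n'\<in>I. if x (a', n') = x (a, n) then 1 else 0)"
    unfolding P_def by (simp add: sum.cartesian_product')
  also have "\<dots> = (\<Sum>a\<in>{1..A}. \<Sum>a'\<in>{1..A}. \<Sum>n\<in>I. \<Sum>n'\<in>I. if x (a', n') = x (a, n) then 1 else 0)"
    by (intro sum.cong[OF refl] sum.swap)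
  also have "\<dots> \<le> (\<Sum>a\<in>{1..A}. \<Sum>a'\<in>{1..A}. real (card {(n,n')\<in>I \<times> I. [int a' * n = int a * n'] (mod int m)}))"
  proof (intro sum_mono)
    fix a a' assume a: "a \<in> {1..A}" "a' \<in> {1..A}"
    have "(\<Sum>n\<in>I. \<Sum>n'\<in>I. if x (a', n') = x (a, n) then 1 else 0) = (\<Sum>p\<in>I \<times> I. if x (a', snd p) = x (a, fst p) then 1 else (0::real))"
      by (simp add: sum.cartesian_product case_prod_unfold)
    also have "\<dots> = real (card {p\<in>I \<times> I. x (a', snd p) = x (a, fst p)})"
      using fin by (simp flip: sum.inter_filter)
    also have "\<dots> \<le> real (card {(n,n')\<in>I \<times> I. [int a' * n = int a * n'] (mod int m)})"
    proof (intro of_nat_mono card_mono)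
      show "finite {(n,n')\<in>I \<times> I. [int a' * n = int a * n'] (mod int m)}"
        by (rule finite_subset[of _ "I \<times> I"]) (use fin in auto)
      have "[int a' * n = int a * n'] (mod int m)" if "x (a', n') = x (a, n)" for n n'
      proof -
        have "[int a' * n = int a' * (int a * x (a, n))] (mod int m)"
          by (intro cong_mult cong_refl cong_sym[OF ax[OF a(1)]])
        also have "int a' * (int a * x (a, n)) = int a * (int a' * x (a', n'))" by (simp add: that)
        also have "[int a * (int a' * x (a', n')) = int a * n'] (mod int m)"
          by (intro cong_mult cong_refl ax[OF a(2)])
        finally show ?thesis .
      qed
      thus "{p\<in>I \<times> I. x (a', snd p) = x (a, fst p)} \<subseteq> {(n,n')\<in>I \<times> I. [int a' * n = int a * n'] (mod int m)}" by auto
    qed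
    finally show "(\<Sum>n\<in>I. \<Sum>n'\<in>I. if x (a', n') = x (a, n) then 1 else 0) \<le> real (card {(n,n')\<in>I \<times> I. [int a' * n = int a * n'] (mod int m)})" .
  qed
  also have "\<dots> \<le> real A ^ 2 + 2 * real_of_int N * real A * (1 + ln (real A)) + 2 * real A ^ 3 * real_of_int N / m + 2 * real A ^ 2 * real_of_int N ^ 2 / m"
    unfolding I_def by (rule card_ratio_pairs_le[OF m0 A N])
  finally have V: "(\<Sum>y\<in>R. (real (v y))\<^sup>2) \<le> real A ^ 2 + 2 * real_of_int N * real A * (1 + ln (real A)) + 2 * real A ^ 3 * real_of_int N / m + 2 * real A ^ 2 * real_of_int N ^ 2 / m" .
  have W4: "(\<Sum>y\<in>R. W y ^ 4) \<le> 3 * real H ^ 2 * real m + 9 * real H ^ 4 * sqrt m"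
    unfolding R_def W_def by (rule fourth_moment_bound[OF m(2,3) H])
  have "0 \<le> (\<Sum>y\<in>R. (real (v y))\<^sup>2)" "0 \<le> (\<Sum>y\<in>R. W y ^ 4)" by (simp_all add: sum_nonneg)
  hence "T ^ 4 \<le> (real A * real_of_int N)\<^sup>2 * ((real A ^ 2 + 2 * real_of_int N * real A * (1 + ln (real A)) + 2 * real A ^ 3 * real_of_int N / m + 2 * real A ^ 2 * real_of_int N ^ 2 / m) * (3 * real H ^ 2 * real m + 9 * real H ^ 4 * sqrt m))"
    using V W4 by (intro order.trans[OF T4] mult_left_mono mult_mono) auto
  thus ?thesis unfolding T[symmetric] I_def by (simp only: mult.assoc)
qed

section \<open>Shifting the range of summation and choosing the parameters\<close>

lemma char_sum_add:
  assumes "N1 \<ge> 0" "N2 \<ge> 0"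
  shows "char_sum chi (N1 + N2) M = char_sum chi N1 M + char_sum chi N2 (M + N1)"
proof -
  have "{M<..M + (N1 + N2)} = {M<..M+N1} \<union> {M+N1<..M+N1+N2}" using assms by auto
  thus ?thesis unfolding char_sum_def by (simp add: sum.union_disjoint)
qed

lemma char_sum_shift: "char_sum chi N (M + h) = (\<Sum>n\<in>{M<..M+N}. chi (n + h))"
  unfolding char_sum_def by (rule sum.reindex_bij_witness[of _ "\<lambda>n. n + h" "\<lambda>n. n - h"]) auto

lemma norm_char_sum_le:
  assumes "dirichlet_character m chi" "N \<ge> 0"
  shows "cmod (char_sum chi N M) \<le> real_of_int N"
proof -
  have "cmod (char_sum chi N M) \<le> (\<Sum>n\<in>{M<..M+N}. 1)"
    unfolding char_sum_def by (intro sum_norm_le norm_dirichlet_character_le[OF assms(1)])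
  thus ?thesis using assms by simp
qed

text \<open>Moving the interval by \<open>a * b\<close> changes the sum by two boundary sums of
  length \<open>a * b\<close>, each at most \<open>E\<close>; averaging over all
  \<open>A * H\<close> pairs gives the inequality.\<close>

lemma burgess_shift:
  fixes A H :: nat and N :: int
  assumes N: "N \<ge> 0"
    and E: "\<And>h M. 0 < h \<Longrightarrow> h \<le> int A * int H \<Longrightarrow> cmod (char_sum chi h M) \<le> E"
  shows "real A * real H * cmod (char_sum chi N M) \<le>
    (\<Sum>a\<in>{1..A}. \<Sum>n\<in>{M<..M+N}. cmod (\<Sum>b\<in>{1..int H}. chi (n + int a * b))) + real A * real H * (2 * E)"
proof -
  let ?B = "{1..int H}"
  have shift: "char_sum chi N M = char_sum chi N (M + h) + (char_sum chi h M - char_sum chi h (M + N))" if "h \<ge> 0" for h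
    using char_sum_add[OF N that, of chi M] char_sum_add[OF that N, of chi M] by (simp add: algebra_simps)
  have "real A * real H * cmod (char_sum chi N M) = cmod (\<Sum>a\<in>{1..A}. \<Sum>b\<in>?B. char_sum chi N M)"
    by (simp add: norm_mult mult.assoc)
  also have "(\<Sum>a\<in>{1..A}. \<Sum>b\<in>?B. char_sum chi N M) =
      (\<Sum>a\<in>{1..A}. \<Sum>b\<in>?B. char_sum chi N (M + int a * b) + (char_sum chi (int a * b) M - char_sum chi (int a * b) (M + N)))"
    by (intro sum.cong refl shift) auto
  also have "\<dots> = (\<Sum>a\<in>{1..A}. \<Sum>b\<in>?B. char_sum chi N (M + int a * b)) +
      (\<Sum>a\<in>{1..A}. \<Sum>b\<in>?B. char_sum chi (int a * b) M - char_sum chi (int a * b) (M + N))"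
    by (simp only: sum.distrib)
  also have "cmod \<dots> \<le> cmod (\<Sum>a\<in>{1..A}. \<Sum>b\<in>?B. char_sum chi N (M + int a * b)) +
      cmod (\<Sum>a\<in>{1..A}. \<Sum>b\<in>?B. char_sum chi (int a * b) M - char_sum chi (int a * b) (M + N))"
    by (rule norm_triangle_ineq)
  also have "cmod (\<Sum>a\<in>{1..A}. \<Sum>b\<in>?B. char_sum chi (int a * b) M - char_sum chi (int a * b) (M + N)) \<le> (\<Sum>a\<in>{1..A}. \<Sum>b\<in>?B. 2 * E)"
  proof (intro sum_norm_le)
    fix a b assume "a \<in> {1..A}" "b \<in> ?B"
    hence "0 < int a * b" "int a * b \<le> int A * int H" by (auto intro: mult_mono)
    thus "cmod (char_sum chi (int a * b) M - char_sum chi (int a * b) (M + N)) \<le> 2 * E"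
      using E[of "int a * b" M] E[of "int a * b" "M + N"] norm_triangle_ineq4[of "char_sum chi (int a * b) M" "char_sum chi (int a * b) (M + N)"] by linarith
  qed
  also have "(\<Sum>a\<in>{1..A}. \<Sum>b\<in>?B. 2 * E) = real A * real H * (2 * E)" by simp
  also have "(\<Sum>a\<in>{1..A}. \<Sum>b\<in>?B. char_sum chi N (M + int a * b)) = (\<Sum>a\<in>{1..A}. \<Sum>n\<in>{M<..M+N}. \<Sum>b\<in>?B. chi (n + int a * b))"
    unfolding char_sum_shift by (rule sum.cong[OF refl], rule sum.swap)
  also have "cmod \<dots> \<le> (\<Sum>a\<in>{1..A}. \<Sum>n\<in>{M<..M+N}. cmod (\<Sum>b\<in>?B. chi (n + int a * b)))"
    by (intro sum_norm_le order_refl)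
  finally show ?thesis by simp
qed

text \<open>Here \<open>s = m^(1/8)\<close>, which makes all exponents integral. Because
  \<open>L \<ge> 24\<close>, every term of the count \<open>V\<close> fits into
  \<open>A * N * L^2 / 10\<close>, and the fourth moment is at most
  \<open>15 * H ^ 3 * s ^ 6\<close>. Together with \<open>N \<le> 50 * A * H\<close> the constants
  multiply to 75, to be compared with \<open>6 ^ 4 = 1296\<close>.\<close>

lemma burgess_numerics:
  fixes s L N A H m :: real
  assumes s: "s \<ge> 1" and m: "m = s ^ 8" and L: "L \<ge> 24" and N: "N > 0" "N \<le> 4 / 25 * s ^ 5 * L"
    and H: "s\<^sup>2 \<le> 2 * H" "H \<le> s\<^sup>2" and A: "A > 0" "N \<le> 50 * A * H" "25 * A * H \<le> N" "lnA \<le> L"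
    and H1: "H \<ge> 1"
  shows "(A * N)\<^sup>2 * (A\<^sup>2 + 2 * N * A * (1 + lnA) + 2 * A ^ 3 * N / m + 2 * A\<^sup>2 * N\<^sup>2 / m) * (3 * H\<^sup>2 * m + 9 * H ^ 4 * s ^ 4)
    < (6 * A * H) ^ 4 * (N * s ^ 3 * L)\<^sup>2"
proof -
  have s0: "s > 0" and m0: "m > 0" and H0: "H > 0" using s m H1 by auto
  have "A * 1 \<le> A * (25 * H)" using A(1) H1 by (intro mult_left_mono) auto
  hence AN: "A \<le> N" using A(3) by (simp add: mult_ac)
  have ANm: "A * N / m \<le> 32 / 15625 * L\<^sup>2"
  proof -
    have "25 * A * s\<^sup>2 \<le> 25 * A * (2 * H)" using H A by (intro mult_left_mono) auto
    also have "\<dots> \<le> 2 * N" using A(3) by simp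
    finally have "(25 * A * s\<^sup>2) * N \<le> (2 * N) * N" using N by (intro mult_right_mono) auto
    hence "25 * (A * N) * s\<^sup>2 \<le> 2 * N\<^sup>2" by (simp add: power2_eq_square mult_ac)
    also have "\<dots> \<le> 2 * (4 / 25 * s ^ 5 * L)\<^sup>2" using N by (intro mult_left_mono power_mono) auto
    also have "\<dots> = (32 / 625 * L\<^sup>2 * s ^ 8) * s\<^sup>2" by (simp add: power_mult_distrib power2_eq_square eval_nat_numeral)
    finally have "25 * (A * N) \<le> 32 / 625 * L\<^sup>2 * s ^ 8" using s0 by simp
    thus ?thesis using m0 unfolding m by (simp add: pos_divide_le_eq)
  qed
  define V where "V = A\<^sup>2 + 2 * N * A * (1 + lnA) + 2 * A ^ 3 * N / m + 2 * A\<^sup>2 * N\<^sup>2 / m"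
  have V: "V \<le> A * N * (L\<^sup>2 / 10)"
  proof -
    have "A\<^sup>2 \<le> A * N" using AN A(1) by (simp add: power2_eq_square)
    moreover have "2 * N * A * (1 + lnA) \<le> 2 * N * A * (1 + L)" using A N by (intro mult_left_mono) auto
    moreover have "2 * A ^ 3 * N / m \<le> 2 * A\<^sup>2 * N\<^sup>2 / m"
    proof -
      have "2 * A\<^sup>2 * N * A \<le> 2 * A\<^sup>2 * N * N" using AN A N by (intro mult_left_mono) auto
      thus ?thesis using m0 by (intro divide_right_mono) (auto simp: power2_eq_square power3_eq_cube mult_ac)
    qed
    ultimately have "V \<le> A * N + 2 * N * A * (1 + L) + 4 * A\<^sup>2 * N\<^sup>2 / m" by (simp add: V_def)
    also have "\<dots> = A * N * (3 + 2 * L + 4 * (A * N / m))" by (simp add: algebra_simps power2_eq_square)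
    also have "\<dots> \<le> A * N * (L\<^sup>2 / 10)"
    proof (intro mult_left_mono)
      have "L * L \<ge> 24 * L" using L by (intro mult_right_mono) auto
      hence "L\<^sup>2 \<ge> 24 * L" by (simp add: power2_eq_square)
      thus "3 + 2 * L + 4 * (A * N / m) \<le> L\<^sup>2 / 10" using ANm L by linarith
    qed (use A N in auto)
    finally show ?thesis .
  qed
  define W where "W = 3 * H\<^sup>2 * m + 9 * H ^ 4 * s ^ 4"
  have W: "W \<le> 15 * H ^ 3 * s ^ 6"
  proof -
    have "3 * H\<^sup>2 * m = 3 * H\<^sup>2 * s ^ 6 * s\<^sup>2" unfolding m by (simp add: eval_nat_numeral)
    also have "\<dots> \<le> 3 * H\<^sup>2 * s ^ 6 * (2 * H)" using H s0 by (intro mult_left_mono) auto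
    also have "\<dots> = 6 * H ^ 3 * s ^ 6" by (simp add: eval_nat_numeral)
    finally have 1: "3 * H\<^sup>2 * m \<le> 6 * H ^ 3 * s ^ 6" .
    have "9 * H ^ 4 * s ^ 4 = 9 * H ^ 3 * s ^ 4 * H" by (simp add: eval_nat_numeral)
    also have "\<dots> \<le> 9 * H ^ 3 * s ^ 4 * s\<^sup>2" using H s0 H0 by (intro mult_left_mono) auto
    also have "\<dots> = 9 * H ^ 3 * s ^ 6" by (simp add: eval_nat_numeral)
    finally show ?thesis using 1 unfolding W_def mult.assoc by linarith
  qed
  have "(A * N)\<^sup>2 * V * W \<le> (A * N)\<^sup>2 * (A * N * (L\<^sup>2 / 10)) * (15 * H ^ 3 * s ^ 6)"
    using m0 H0 s0 A N by (intro mult_mono[OF mult_left_mono[OF V] W]) (auto simp: W_def)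
  also have "\<dots> = 3 / 2 * (A ^ 3 * N\<^sup>2 * L\<^sup>2 * H ^ 3 * s ^ 6) * N" by (simp add: eval_nat_numeral)
  also have "\<dots> \<le> 3 / 2 * (A ^ 3 * N\<^sup>2 * L\<^sup>2 * H ^ 3 * s ^ 6) * (50 * A * H)"
    using A H0 s0 by (intro mult_left_mono) auto
  also have "\<dots> = 75 * (A ^ 4 * H ^ 4 * (N\<^sup>2 * s ^ 6 * L\<^sup>2))" by (simp add: eval_nat_numeral)
  also have "\<dots> < 1296 * (A ^ 4 * H ^ 4 * (N\<^sup>2 * s ^ 6 * L\<^sup>2))"
    using A H0 N s0 L by (intro mult_strict_right_mono mult_pos_pos) auto
  also have "\<dots> = (6 * A * H) ^ 4 * (N * s ^ 3 * L)\<^sup>2" by (simp add: eval_nat_numeral)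
  finally show ?thesis by (simp add: V_def W_def)
qed

text \<open>For composite \<open>m\<close> this is the definition, as
  \<open>m powr (3/8) = s ^ 3\<close>. A prime \<open>m\<close> is its own prime factor, and
  \<open>s ^ 8\<close> exceeds \<open>s ^ 3 * ln m\<close> already by size.\<close>

lemma coarse_prime_factor_ge:
  fixes m :: nat and s :: real
  assumes m: "coarse m" "m > 1" and s: "s \<ge> 2" "real m = s ^ 8" and r: "prime r" "r dvd m"
  shows "real r \<ge> s ^ 3 * ln m"
proof (cases "prime m")
  case True
  hence "r = m" using r by (simp add: primes_dvd_imp_eq)
  have "ln (real m) = 8 * ln s" using s by (simp add: ln_realpow)
  also have "\<dots> \<le> 8 * s" using ln_bound[of s] s by simp
  also have "\<dots> \<le> s ^ 3 * s" using power_mono[of 2 s 3] s by (intro mult_right_mono) auto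
  also have "\<dots> \<le> s ^ 5" using power_increasing[of 4 5 s] s by (simp add: eval_nat_numeral)
  finally have "s ^ 3 * ln m \<le> s ^ 3 * s ^ 5" using s by (intro mult_left_mono) auto
  thus ?thesis using s \<open>r = m\<close> by (simp flip: power_add)
next
  case False
  then obtain p q where pq: "prime p" "prime q" "m = p * q" "real p > real m powr (3/8) * ln (real m)"
      "real q > real m powr (3/8) * ln (real m)"
    using m by (auto simp: coarse_def)
  have "r = p \<or> r = q" using r pq by (metis prime_dvd_mult_iff primes_dvd_imp_eq)
  moreover have "real m powr (3/8) = s ^ 3"
  proof -
    have "real m powr (3/8) = (s powr 8) powr (3/8)" using s by (simp add: powr_realpow)
    also have "\<dots> = s ^ 3" unfolding powr_powr using s by (simp add: powr_realpow)
    finally show ?thesis .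
  qed
  ultimately show ?thesis using pq by auto
qed

theorem theorem10p3:
  fixes m :: nat and chi :: "int \<Rightarrow> complex" and M N :: int
  assumes "m > 10 ^ 11"
    and "coarse m"
    and "primitive_character m chi"
    and "N > 0"
  shows "cmod (char_sum chi N M) <
    10 * real_of_int N powr (1/2) * real m powr (3/16) * ln (real m) powr (1/2)"
proof -
  define s L where "s = real m powr (1/8)" and "L = ln (real m)"
  have m1: "m > 1" using assms(1) by simp
  have m0: "real m > 0" using m1 by simp
  have D: "dirichlet_character m chi" using assms(3) by (simp add: primitive_character_def)
  have s8: "real m = s ^ 8" using m0 by (simp add: s_def powr_powr flip: powr_realpow)
  have s2: "s \<ge> 2"
  proof (rule ccontr)
    assume "\<not> s \<ge> 2"
    hence "s ^ 8 \<le> 2 ^ 8" by (intro power_mono) (auto simp: s_def)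
    thus False using assms(1) s8 by simp
  qed
  have s0: "s > 0" using s2 by simp
  have L: "L \<ge> 24"
  proof -
    \<comment> \<open>The power \<open>2 ^ 36\<close> lies below \<open>10 ^ 11\<close>, and
      \<open>ln 2 \<ge> 2 / 3\<close> gives \<open>36 * 2 / 3 = 24\<close>.\<close>
    have "(2::real) ^ 36 \<le> real m" using assms(1) by simp
    hence "ln ((2::real) ^ 36) \<le> L" unfolding L_def by (intro ln_mono) auto
    moreover have "ln ((2::real) ^ 36) = 36 * ln 2" by (subst ln_realpow) simp_all
    ultimately show ?thesis using ln2_ge_two_thirds by linarith
  qed
  have sqrtm: "sqrt m = s ^ 4" unfolding s8 using s0 by (intro real_sqrt_unique) (simp_all flip: power_mult)
  have factor: "real r \<ge> s ^ 3 * L" if "prime r" "r dvd m" for r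
    unfolding L_def by (rule coarse_prime_factor_ge[OF assms(2) m1 s2 s8 that])
  define B where "B N = sqrt (real_of_int N * s ^ 3 * L)" for N :: int
  have main: "cmod (char_sum chi (int k) M) < 10 * B (int k)" if "k > 0" for k M
    using that
  proof (induction k arbitrary: M rule: less_induct)
    case (less k)
    define n where "n = real k"
    have n: "n > 0" using less.prems by (simp add: n_def)
    have Bk: "B (int k) = sqrt (n * s ^ 3 * L)" by (simp add: B_def n_def)
    have B2: "(B (int k))\<^sup>2 = n * s ^ 3 * L" using n s0 L by (simp add: Bk)
    have Bpos: "B (int k) > 0" using n s0 L by (simp add: Bk)
    \<comment> \<open>The thresholds are where the other bounds reach
      \<open>10 * sqrt (n * s ^ 3 * L)\<close>: the trivial bound \<open>n\<close> does so at
      \<open>100 * s ^ 3 * L\<close>, and \<open>4 * s ^ 4 * L\<close> does so at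
      \<open>4 / 25 * s ^ 5 * L\<close>.\<close>
    consider "n < 100 * s ^ 3 * L" | "n > 4 / 25 * s ^ 5 * L" | "100 * s ^ 3 * L \<le> n" "n \<le> 4 / 25 * s ^ 5 * L" by linarith
    thus ?case
    proof cases
      case 1
      have "n * n < n * (100 * s ^ 3 * L)" using 1 n by (intro mult_strict_left_mono)
      hence "n\<^sup>2 < (10 * B (int k))\<^sup>2" unfolding power_mult_distrib B2 by (simp add: power2_eq_square mult_ac)
      hence "n < 10 * B (int k)" by (rule power_less_imp_less_base) (use Bpos in simp)
      thus ?thesis using norm_char_sum_le[OF D, of "int k" M] by (simp add: n_def)
    next
      case 2
      have "(4 * s ^ 4 * L)\<^sup>2 = 100 * s ^ 3 * L * (4 / 25 * s ^ 5 * L)" by (simp add: eval_nat_numeral)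
      also have "\<dots> < 100 * s ^ 3 * L * n" using 2 s0 L by (intro mult_strict_left_mono) auto
      also have "\<dots> = (10 * B (int k))\<^sup>2" by (simp add: power_mult_distrib B2 mult_ac)
      finally have "4 * s ^ 4 * L < 10 * B (int k)" by (rule power_less_imp_less_base) (use Bpos in simp)
      moreover have "cmod (char_sum chi (int k) M) \<le> 4 * sqrt m * ln m"
        by (rule polya_vinogradov[OF m1 assms(2,3)]) (use L in \<open>simp_all add: L_def\<close>)
      ultimately show ?thesis unfolding sqrtm L_def[symmetric] by linarith
    next
      case 3
      \<comment> \<open>About \<open>m^(1/4)\<close>, where the two parts \<open>H ^ 2 * m\<close>
        and \<open>H ^ 4 * sqrt m\<close> of the fourth moment balance.\<close>
      define H where "H = nat \<lfloor>s\<^sup>2\<rfloor>"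
      have s24: "s\<^sup>2 \<ge> 4" using power_mono[OF s2, of 2] by simp
      have H: "real H \<le> s\<^sup>2" "s\<^sup>2 < real H + 1" using s24 by (auto simp: H_def)
      have H': "s\<^sup>2 \<le> 2 * real H" "real H \<ge> 1" using H s24 by linarith+
      define A where "A = nat \<lfloor>n / (25 * real H)\<rfloor>"
      have q0: "n / (25 * real H) \<ge> 0" using n by simp
      have A: "real A \<le> n / (25 * real H)" "n / (25 * real H) < real A + 1" using q0 by (auto simp: A_def)
      have s3L: "s ^ 3 * L \<ge> s\<^sup>2"
      proof -
        have "s\<^sup>2 * 1 \<le> s\<^sup>2 * (s * L)" using mult_mono[of 1 s 1 L] s2 L by (intro mult_left_mono) auto
        thus ?thesis by (simp add: eval_nat_numeral mult_ac)
      qed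
      have "n \<ge> 50 * real H" using 3 s3L H(1) by linarith
      hence "n / (50 * real H) \<ge> 1" using H' by simp
      moreover have "n / (25 * real H) = n / (50 * real H) + n / (50 * real H)" using H' by (simp add: field_simps)
      ultimately have A': "real A \<ge> n / (50 * real H)" "real A > 0" using A(2) by linarith+
      have A1: "25 * real A * real H \<le> n" using A(1) H' by (simp add: field_simps)
      have A2: "n \<le> 50 * real A * real H" using A'(1) H' by (simp add: field_simps)
      \<comment> \<open>The upper end of the middle range yields
        \<open>A \<le> 8 / 625 * s ^ 3 * L\<close>, well below every prime factor of a coarse
        modulus.\<close>
      have Ar: "A < r" if "prime r" "r dvd m" for r
      proof -
        have "25 * real A * s\<^sup>2 \<le> 25 * real A * (2 * real H)" using H' by (intro mult_left_mono) auto
        also have "\<dots> \<le> 2 * n" using A1 by simp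
        also have "\<dots> \<le> 2 * (4 / 25 * s ^ 5 * L)" using 3 by linarith
        also have "\<dots> = (8 / 25 * (s ^ 3 * L)) * s\<^sup>2" by (simp add: eval_nat_numeral)
        finally have "25 * real A \<le> 8 / 25 * (s ^ 3 * L)" using s0 by simp
        moreover have "s ^ 3 * L > 0" using s0 L by simp
        ultimately have "real A < s ^ 3 * L" by linarith
        thus ?thesis using factor[OF that] by linarith
      qed
      have Hr: "H \<le> r" if "prime r" "r dvd m" for r
        using factor[OF that] H(1) s3L by linarith
      have lnA: "ln (real A) \<le> L"
      proof -
        obtain r where r: "prime r" "r dvd m" using prime_factor_nat[of m] m1 by auto
        hence "A \<le> m" using Ar[OF r] m1 dvd_imp_le[OF r(2)] by linarith
        thus ?thesis unfolding L_def using A' by (intro ln_mono) auto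
      qed
      define T where "T = (\<Sum>a\<in>{1..A}. \<Sum>j\<in>{M<..M+int k}. cmod (\<Sum>b\<in>{1..int H}. chi (j + int a * b)))"
      have "T ^ 4 \<le> (real A * n)\<^sup>2 *
          ((real A)\<^sup>2 + 2 * n * real A * (1 + ln (real A)) + 2 * real A ^ 3 * n / m + 2 * (real A)\<^sup>2 * n\<^sup>2 / m) *
          (3 * (real H)\<^sup>2 * real m + 9 * real H ^ 4 * s ^ 4)"
        using burgess_sum_bound[OF m1 assms(2,3) _ Ar Hr, of "int k" M] A' less.prems unfolding T_def n_def sqrtm by simp
      also have "\<dots> < (6 * real A * real H) ^ 4 * (n * s ^ 3 * L)\<^sup>2"
        using s2 L n 3 H H' A' A1 A2 lnA s8 by (intro burgess_numerics) auto
      also have "\<dots> = (6 * real A * real H * B (int k)) ^ 4"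
        unfolding B2[symmetric] by (simp add: power_mult_distrib)
      finally have T: "T < 6 * real A * real H * B (int k)"
        by (rule power_less_imp_less_base) (use Bpos in simp)
      have "real A * real H * cmod (char_sum chi (int k) M) \<le> T + real A * real H * (2 * (2 * B (int k)))"
        unfolding T_def
      proof (rule burgess_shift)
        fix h M assume h: "0 < h" "h \<le> int A * int H"
        have "real_of_int h \<le> real_of_int (int A * int H)" using h(2) by (simp only: of_int_le_iff)
        hence hn: "25 * real_of_int h \<le> n" using A1 by simp
        hence "real_of_int h < n" using h n by linarith
        hence "nat h < k" using h by (simp add: n_def)
        hence "cmod (char_sum chi (int (nat h)) M) < 10 * B (int (nat h))" using h by (intro less.IH) auto
        hence "cmod (char_sum chi h M) < 10 * B h" using h by simp
        \<comment> \<open>Since \<open>h \<le> n / 25\<close> and \<open>B\<close> grows like a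
          square root, the induction hypothesis gains a factor 5.\<close>
        also have "10 * B h \<le> 2 * B (int k)"
        proof -
          have "25 * (real_of_int h * s ^ 3 * L) \<le> n * s ^ 3 * L"
            using mult_right_mono[OF hn, of "s ^ 3 * L"] s0 L by (simp add: mult_ac)
          hence "sqrt (25 * (real_of_int h * s ^ 3 * L)) \<le> sqrt (n * s ^ 3 * L)" by simp
          thus ?thesis unfolding Bk B_def real_sqrt_mult[of 25] by (simp add: n_def)
        qed
        finally show "cmod (char_sum chi h M) \<le> 2 * B (int k)" by simp
      qed simp
      \<comment> \<open>Six units from the averaged sum and four from the boundary sums.\<close>
      also have "\<dots> < real A * real H * (10 * B (int k))" using T by (simp add: algebra_simps)
      finally show ?thesis using A' H' by simp
    qed
  qed
  have "cmod (char_sum chi N M) < 10 * B N" using main[of "nat N" M] assms(4) by simp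
  also have "B N = real_of_int N powr (1/2) * real m powr (3/16) * ln (real m) powr (1/2)"
  proof -
    have "real m powr (3/16) = (s ^ 3) powr (1/2)"
      using s0 by (simp add: s_def powr_powr flip: powr_realpow)
    thus ?thesis using assms(4) s0 L unfolding B_def by (simp add: L_def powr_half_sqrt real_sqrt_mult)
  qed
  finally show ?thesis by (simp add: mult.assoc)
qed

end
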